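(* Let $n\geq1$, $T>0$, and let $a_{jk}:[0,T]\times\mathbb R^n\to\mathbb R$, $j,k=1,\dots,n$, be measurable, bounded and such that (i) $a_{jk}=a_{kj}$; (ii) there is $\kappa\in(0,1)$ with $\kappa|\xi|^2\leq\sum_{j,k}a_{jk}(t,x)\xi_j\xi_k\leq\frac1\kappa|\xi|^2$ for all $(t,x,\xi)\in[0,T]\times\mathbb R^n\times\mathbb R^n$; (iii) $A_{LL}<\infty$ and $A<\infty$, where $$A_{LL}:=\sup\Big\{\frac{|a_{jk}(t,x)-a_{jk}(t',x)|}{|t-t'|(1+|\log|t-t'||)}: j,k,\ x\in\mathbb R^n,\ t,t'\in[0,T],\ 0<|t-t'|\leq T\Big\},$$ $$A:=\sup\{\|\partial_x^\alpha a_{jk}(t,\cdot)\|_{L^\infty}:|\alpha|\leq1,\ t\in[0,T],\ j,k\}.$$ Consider $Pu=\partial_tu+\sum_{j,k=1}^n\partial_{x_j}(a_{jk}(t,x)\partial_{x_k}u)=0$ on $[0,T]\times\mathbb R^n$ and $\mathcal H:=C^0([0,T],L^2(\mathbb R^n))\cap C^0([0,T),H^1(\mathbb R^n))\cap C^1([0,T),L^2(\mathbb R^n))$. Let $s\in(0,1)$. Then for every $T'\in(0,T)$ and $D>0$ there exist positive constants $\rho',\delta',M',N'$, depending only on $A_{LL},A,\kappa,n,s$ and $T'$, such that if $u\in\mathcal H$ is a solution of $Pu=0$ satisfying $\|u(0,\cdot)\|_{H^{-s}}\leq\rho'$ and $\sup_{t\in[0,T]}\|u(t,\cdot)\|_{L^2}\leq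 D$, then $$\sup_{t\in[0,T']}\|u(t,\cdot)\|_{L^2}\leq M'\exp\Big(-N'\big|\log\big(\|u(0,\cdot)\|_{H^{-s}}\big)\big|^{\delta'}\Big).$$
   Context: $H^\sigma(\mathbb R^n)$ is the standard $L^2$-based Sobolev space of order $\sigma$. A solution $u\in\mathcal H$ of $Pu=0$ means the equation holds for $t\in[0,T)$ in $H^{-1}(\mathbb R^n)$.
   Formalization: The constants ρ', δ', M', N' may depend on D and T as well as on A_LL, A, κ, n, s and T'; constants independent of D, or uniform as T approaches T', are impossible already for high-frequency solutions of the backward heat equation. *)

theory Defs
  imports "HOL-Analysis.Analysis" "HOL-Probability.Essential_Supremum"
begin

definition pd :: "'n::finite \<Rightarrow> (real^'n \<Rightarrow> real) \<Rightarrow> real^'n \<Rightarrow> real" where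
  "pd i f x = deriv (\<lambda>h. f (x + h *\<^sub>R axis i 1)) 0"

fun pd_iter :: "'n::finite list \<Rightarrow> (real^'n \<Rightarrow> real) \<Rightarrow> real^'n \<Rightarrow> real" where
  "pd_iter [] f = f"
| "pd_iter (i # ds) f = pd i (pd_iter ds f)"

definition test_fun :: "(real^'n::finite \<Rightarrow> real) \<Rightarrow> bool" where
  "test_fun \<phi> \<longleftrightarrow> (\<forall>ds x. pd_iter ds \<phi> differentiable (at x)) \<and> bounded {x. \<phi> x \<noteq> 0}"

definition weak_pd :: "'n::finite \<Rightarrow> (real^'n \<Rightarrow> real) \<Rightarrow> (real^'n \<Rightarrow> real) \<Rightarrow> bool" where
  "weak_pd i f g \<longleftrightarrow>
     (\<forall>K. compact K \<longrightarrow> set_integrable lborel K f \<and> set_integrable lborel K g) \<and>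
     (\<forall>\<phi>. test_fun \<phi> \<longrightarrow>
        (\<integral>x. f x * pd i \<phi> x \<partial>lborel) = - (\<integral>x. g x * \<phi> x \<partial>lborel))"

definition inL2 :: "(real^'n::finite \<Rightarrow> real) \<Rightarrow> bool" where
  "inL2 f \<longleftrightarrow> f \<in> borel_measurable lborel \<and> integrable lborel (\<lambda>x. (f x)\<^sup>2)"

definition l2norm :: "(real^'n::finite \<Rightarrow> real) \<Rightarrow> real" where
  "l2norm f = sqrt (\<integral>x. (f x)\<^sup>2 \<partial>lborel)"

definition l2dist :: "(real^'n::finite \<Rightarrow> real) \<Rightarrow> (real^'n \<Rightarrow> real) \<Rightarrow> real" where
  "l2dist f g = l2norm (\<lambda>x. f x - g x)"

text \<open>Unitary Fourier transform of the truncation f * 1_{|x| <= R} (an L1 function for f in L2).\<close>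
definition fourier_trunc :: "real \<Rightarrow> (real^'n::finite \<Rightarrow> real) \<Rightarrow> real^'n \<Rightarrow> complex" where
  "fourier_trunc R f \<xi> = complex_of_real ((2 * pi) powr (- real CARD('n) / 2)) *
     (\<integral>x. complex_of_real (indicator (cball 0 R) x * f x) * cis (- (x \<bullet> \<xi>)) \<partial>lborel)"

text \<open>H^sigma norm (sigma \<le> 0) of an L2 function; the Fourier transform on L2 is the
  L2-limit of the Fourier transforms of truncations, and since the weight is bounded the
  weighted integral converges to the integral against the L2 Fourier transform.\<close>
definition sobolev_norm :: "real \<Rightarrow> (real^'n::finite \<Rightarrow> real) \<Rightarrow> real" where
  "sobolev_norm \<sigma> f = sqrt (Lim at_top (\<lambda>R::real.
      \<integral>\<xi>. (1 + (norm \<xi>)\<^sup>2) powr \<sigma> * (cmod (fourier_trunc R f \<xi>))\<^sup>2 \<partial>lborel))"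

type_synonym 'n coeffs = "'n \<Rightarrow> 'n \<Rightarrow> real \<Rightarrow> real^'n \<Rightarrow> real"

definition A_LL :: "real \<Rightarrow> 'n::finite coeffs \<Rightarrow> ereal" where
  "A_LL T a = Sup {ereal (\<bar>a j k t x - a j k t' x\<bar> / (\<bar>t - t'\<bar> * (1 + \<bar>ln \<bar>t - t'\<bar>\<bar>))) | j k x t t'.
       t \<in> {0..T} \<and> t' \<in> {0..T} \<and> 0 < \<bar>t - t'\<bar> \<and> \<bar>t - t'\<bar> \<le> T}"

definition A_sup :: "real \<Rightarrow> 'n::finite coeffs \<Rightarrow> ereal" where
  "A_sup T a = Sup ({esssup lborel (\<lambda>x. ereal \<bar>a j k t x\<bar>) | j k t. t \<in> {0..T}} \<union>
       {esssup lborel (\<lambda>x. ereal \<bar>g x\<bar>) | j k t i g. t \<in> {0..T} \<and> weak_pd i (a j k t) g})"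

definition coeff_hyp :: "real \<Rightarrow> real \<Rightarrow> real \<Rightarrow> real \<Rightarrow> 'n::finite coeffs \<Rightarrow> bool" where
  "coeff_hyp T \<kappa> aLL aA a \<longleftrightarrow>
     (\<forall>j k. (\<lambda>(t, x). a j k t x) \<in> borel_measurable (restrict_space borel ({0..T} \<times> UNIV))) \<and>
     (\<exists>B. \<forall>j k. \<forall>t\<in>{0..T}. \<forall>x. \<bar>a j k t x\<bar> \<le> B) \<and>
     (\<forall>j k. \<forall>t\<in>{0..T}. \<forall>x. a j k t x = a k j t x) \<and>
     (\<forall>t\<in>{0..T}. \<forall>x \<xi>.
        \<kappa> * (norm \<xi>)\<^sup>2 \<le> (\<Sum>j\<in>UNIV. \<Sum>k\<in>UNIV. a j k t x * \<xi> $ j * \<xi> $ k) \<and>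
        (\<Sum>j\<in>UNIV. \<Sum>k\<in>UNIV. a j k t x * \<xi> $ j * \<xi> $ k) \<le> (norm \<xi>)\<^sup>2 / \<kappa>) \<and>
     (\<forall>j k i. \<forall>t\<in>{0..T}. \<exists>g. weak_pd i (a j k t) g) \<and>
     A_LL T a = ereal aLL \<and> A_sup T a = ereal aA"

text \<open>u in C^0([0,T],L^2) \<inter> C^0([0,T),H^1) \<inter> C^1([0,T),L^2) solving Pu = 0 in H^{-1} for t in [0,T).
  G t i is the weak derivative d_{x_i} u(t), u' is the time derivative in L^2.\<close>
definition is_solution :: "real \<Rightarrow> 'n::finite coeffs \<Rightarrow> (real \<Rightarrow> real^'n \<Rightarrow> real) \<Rightarrow> bool" where
  "is_solution T a u \<longleftrightarrow>
     (\<forall>t\<in>{0..T}. inL2 (u t) \<and> ((\<lambda>s. l2dist (u s) (u t)) \<longlongrightarrow> 0) (at t within {0..T})) \<and>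
     (\<exists>G u'.
        (\<forall>t\<in>{0..<T}. \<forall>i. inL2 (G t i) \<and> weak_pd i (u t) (G t i) \<and>
            ((\<lambda>s. l2dist (G s i) (G t i)) \<longlongrightarrow> 0) (at t within {0..<T})) \<and>
        (\<forall>t\<in>{0..<T}. inL2 (u' t) \<and>
            ((\<lambda>s. l2dist (u' s) (u' t)) \<longlongrightarrow> 0) (at t within {0..<T}) \<and>
            ((\<lambda>s. l2norm (\<lambda>x. (u s x - u t x) / (s - t) - u' t x)) \<longlongrightarrow> 0) (at t within {0..<T})) \<and>
        (\<forall>t\<in>{0..<T}. \<forall>\<phi>. test_fun \<phi> \<longrightarrow>
            (\<integral>x. u' t x * \<phi> x \<partial>lborel)
              - (\<Sum>j\<in>UNIV. \<Sum>k\<in>UNIV. \<integral>x. a j k t x * G t k x * pd j \<phi> x \<partial>lborel) = 0))"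

end

theory Submission
  imports Defs "HOL-Probability.Characteristic_Functions"
begin

text \<open>
  Write \<open>y t\<close> for the squared \<open>L\<^sup>2\<close> norm of \<open>u t\<close>; it is nondecreasing, and its derivative dominates the
  squared norm of the gradient. By the symmetry of the coefficients, the derivative in \<open>s\<close> of the inner
  product of \<open>u (t + s)\<close> and \<open>u (t - s)\<close> only involves the difference of the coefficients at the times
  \<open>t + s\<close> and \<open>t - s\<close>, which is log-Lipschitz small. Hence
  \<open>y t \<le> sqrt (y (t + h) * y (t - h)) + e * (y (t + h) - y (t - h))\<close> with \<open>e\<close> of order \<open>h * ln (1 / h)\<close>:
  the energy is almost log-convex on a grid of mesh \<open>h\<close>. Stepping backwards through a time interval of
  fixed length multiplies the logarithmic increments of \<open>y\<close> by a small power of \<open>1 / h\<close> at most. Squaring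
  the mesh after each such interval, time \<open>0\<close> is reached after finitely many intervals, with
  a total logarithmic increment that is polynomial in \<open>B = ln (D\<^sup>2 / y T')\<close>. In the last step the inner
  product with \<open>u 0\<close> is estimated by the \<open>H\<^sup>-\<^sup>s\<close> norm of \<open>u 0\<close> and a gradient bound. So
  the logarithm of that norm is polynomially bounded in \<open>B\<close>, and solving for \<open>B\<close> gives the estimate.
\<close>

section \<open>The space of square integrable functions\<close>

text \<open>A stretch of length \<open>\<tau>\<close> has \<open>\<tau> * m\<close> steps of mesh 1
  / m, each multiplying the logarithmic increment by 1 + O(ln m / m). The product is a power of m,
  and \<open>48 * C * \<tau> \<le> 1\<close> keeps the exponent at most 1 / 2. The one-step estimate
  is linear only while increments are at most 1, so every stretch must begin with an increment of at
  most 1 / sqrt m. A pigeonhole argument supplies it: first from the total increment B, which forces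
  m to be of order B^2, later by cutting a cell of increment at most 1 into m cells of length 1 /
  m^2. The number J of stretches does not depend on the solution, and the exponent 2 ^ J of m
  becomes the exponent 1 / (2 * 2 ^ J) in the estimate. A second obstacle: the equation is tested
  with smooth functions of compact support, while the energy method needs u itself. Instead of
  mollifying u, the proof smooths in the shift z of the inner product of f with the translate of g
  by z, a bounded continuous function. The heat kernel in the same variable gives access to the
  negative Sobolev norm.\<close>

definition l2inner :: "(real^'n::finite \<Rightarrow> real) \<Rightarrow> (real^'n \<Rightarrow> real) \<Rightarrow> real" where
  "l2inner f g = (\<integral>x. f x * g x \<partial>lborel)"

lemma inL2_measurable [measurable_dest]: "inL2 f \<Longrightarrow> f \<in> borel_measurable borel"
  by (simp add: inL2_def)

lemma inL2_integrable_square: "inL2 f \<Longrightarrow> integrable lborel (\<lambda>x. (f x)\<^sup>2)"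
  by (simp add: inL2_def)

lemma l2norm_square: "(l2norm f)\<^sup>2 = l2inner f f"
  by (simp add: l2norm_def l2inner_def power2_eq_square)

lemma l2norm_nonneg [simp]: "0 \<le> l2norm f"
  by (simp add: l2norm_def)

lemma l2inner_commute: "l2inner f g = l2inner g f"
  by (simp add: l2inner_def mult.commute)

lemma inL2_mult_integrable:
  assumes "inL2 f" "inL2 g"
  shows "integrable lborel (\<lambda>x. f x * g x)"
proof (rule Bochner_Integration.integrable_bound)
  show "integrable lborel (\<lambda>x. (f x)\<^sup>2 + (g x)\<^sup>2)"
    using assms by (simp add: inL2_def)
  have [measurable]: "f \<in> borel_measurable borel" "g \<in> borel_measurable borel"
    using assms by (auto simp: inL2_def)
  show "(\<lambda>x. f x * g x) \<in> borel_measurable lborel" by simp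
  have "\<bar>a * b\<bar> \<le> a\<^sup>2 + b\<^sup>2" for a b :: real
  proof -
    have "0 \<le> \<bar>a\<bar> * \<bar>b\<bar>" by simp
    then show ?thesis
      using sum_squares_bound[of "\<bar>a\<bar>" "\<bar>b\<bar>"] unfolding abs_mult power2_abs by linarith
  qed
  then show "AE x in lborel. norm (f x * g x) \<le> norm ((f x)\<^sup>2 + (g x)\<^sup>2)"
    by simp
qed

lemma inL2_add:
  assumes "inL2 f" "inL2 g"
  shows "inL2 (\<lambda>x. f x + g x)"
proof -
  have "integrable lborel (\<lambda>x. (f x)\<^sup>2 + (g x)\<^sup>2 + 2 * (f x * g x))"
    using assms inL2_mult_integrable[OF assms] by (auto simp: inL2_def)
  then show ?thesis
    using assms by (auto simp: inL2_def power2_sum mult.assoc)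
qed

lemma inL2_cmult: "inL2 f \<Longrightarrow> inL2 (\<lambda>x. c * f x)"
  by (auto simp: inL2_def power_mult_distrib)

lemma inL2_diff: "inL2 f \<Longrightarrow> inL2 g \<Longrightarrow> inL2 (\<lambda>x. f x - g x)"
  using inL2_add[of f "\<lambda>x. (-1) * g x"] inL2_cmult[of g "-1"] by simp

lemma inL2_zero [simp]: "inL2 (\<lambda>x. 0)"
  by (simp add: inL2_def)

lemma inL2_sum:
  assumes "\<And>i. i \<in> I \<Longrightarrow> inL2 (f i)"
  shows "inL2 (\<lambda>x. \<Sum>i\<in>I. f i x)"
  using assms by (induction I rule: infinite_finite_induct) (auto intro: inL2_add)

lemma inL2_bounded:
  assumes f: "inL2 f" and [measurable]: "g \<in> borel_measurable borel"
    and le: "\<And>x. \<bar>g x\<bar> \<le> B * \<bar>f x\<bar>"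
  shows "inL2 g"
  unfolding inL2_def
proof
  show "integrable lborel (\<lambda>x. (g x)\<^sup>2)"
  proof (rule Bochner_Integration.integrable_bound)
    show "integrable lborel (\<lambda>x. B\<^sup>2 * (f x)\<^sup>2)"
      using f by (simp add: inL2_def)
    have "(g x)\<^sup>2 \<le> B\<^sup>2 * (f x)\<^sup>2" for x
      using power_mono[OF le[of x], of 2] by (simp add: power_mult_distrib)
    then show "AE x in lborel. norm ((g x)\<^sup>2) \<le> norm (B\<^sup>2 * (f x)\<^sup>2)"
      by simp
  qed simp
qed simp

lemma inL2_abs: "inL2 f \<Longrightarrow> inL2 (\<lambda>x. \<bar>f x\<bar>)"
  by (auto simp: inL2_def)

lemma l2inner_add_left:
  assumes "inL2 f" "inL2 g" "inL2 h"
  shows "l2inner (\<lambda>x. f x + g x) h = l2inner f h + l2inner g h"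
  using assms by (simp add: l2inner_def distrib_right inL2_mult_integrable)

lemma l2inner_diff_left:
  assumes "inL2 f" "inL2 g" "inL2 h"
  shows "l2inner (\<lambda>x. f x - g x) h = l2inner f h - l2inner g h"
  using assms by (simp add: l2inner_def left_diff_distrib inL2_mult_integrable)

lemma l2inner_cmult_left: "l2inner (\<lambda>x. c * f x) h = c * l2inner f h"
  by (simp add: l2inner_def mult.assoc)

lemma l2inner_add_right:
  assumes "inL2 f" "inL2 g" "inL2 h"
  shows "l2inner h (\<lambda>x. f x + g x) = l2inner h f + l2inner h g"
  using l2inner_add_left[OF assms] by (simp add: l2inner_commute)

lemma l2inner_diff_right:
  assumes "inL2 f" "inL2 g" "inL2 h"
  shows "l2inner h (\<lambda>x. f x - g x) = l2inner h f - l2inner h g"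
  using l2inner_diff_left[OF assms] by (simp add: l2inner_commute)

lemma abs_integral_mult_le:
  assumes "inL2 f" "inL2 g"
  shows "(\<integral>x. \<bar>f x * g x\<bar> \<partial>lborel) \<le> l2norm f * l2norm g"
proof -
  let ?I = "\<integral>x. \<bar>f x * g x\<bar> \<partial>lborel"
  have int: "integrable lborel (\<lambda>x. \<bar>f x * g x\<bar>)"
    using inL2_mult_integrable[OF assms] by simp
  \<comment> \<open>The weights a and b stay free, so that the case of a vanishing norm, where no
    normalisation is possible, follows from the same inequality.\<close>
  have quad: "2 * a * b * ?I \<le> a\<^sup>2 * (l2norm f)\<^sup>2 + b\<^sup>2 * (l2norm g)\<^sup>2" if "0 \<le> a" "0 \<le> b" for a b
  proof -
    have "(\<integral>x. 2 * a * b * \<bar>f x * g x\<bar> \<partial>lborel) \<le> (\<integral>x. a\<^sup>2 * (f x)\<^sup>2 + b\<^sup>2 * (g x)\<^sup>2 \<partial>lborel)"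
    proof (rule integral_mono)
      show "integrable lborel (\<lambda>x. 2 * a * b * \<bar>f x * g x\<bar>)" using int by simp
      show "integrable lborel (\<lambda>x. a\<^sup>2 * (f x)\<^sup>2 + b\<^sup>2 * (g x)\<^sup>2)"
        using assms by (simp add: inL2_def)
      show "2 * a * b * \<bar>f x * g x\<bar> \<le> a\<^sup>2 * (f x)\<^sup>2 + b\<^sup>2 * (g x)\<^sup>2" for x
        using sum_squares_bound[of "a * \<bar>f x\<bar>" "b * \<bar>g x\<bar>"]
        by (simp add: abs_mult power_mult_distrib mult_ac)
    qed
    also have "\<dots> = a\<^sup>2 * (l2norm f)\<^sup>2 + b\<^sup>2 * (l2norm g)\<^sup>2"
      using assms by (simp add: inL2_def l2norm_def)
    finally show ?thesis by simp
  qed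
  show ?thesis
  proof (cases "l2norm f = 0 \<or> l2norm g = 0")
    case False
    then have pos: "0 < l2norm f * l2norm g"
      by (simp add: less_le)
    have "2 * (l2norm f * l2norm g) * ?I \<le> 2 * (l2norm f * l2norm g) * (l2norm f * l2norm g)"
      using quad[of "l2norm g" "l2norm f"] by (simp add: power2_eq_square mult_ac)
    then show ?thesis using pos mult_le_cancel_left_pos[of "2 * (l2norm f * l2norm g)"] by simp
  next
    case True
    have I0: "0 \<le> ?I" by simp
    have "?I \<le> 0"
    proof (rule ccontr)
      assume "\<not> ?I \<le> 0"
      then have Ip: "0 < ?I" by simp
      show False
      proof (cases "l2norm f = 0")
        case True
        \<comment> \<open>With the norm of f equal to 0, the right side of \<open>quad\<close> does
          not depend on a; the weights a = B / I + 1 and b = 1 make the left side larger than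
          B.\<close>
        define B where "B = (l2norm g)\<^sup>2"
        have B: "0 \<le> B" by (simp add: B_def)
        have "2 * (B / ?I + 1) * ?I \<le> B"
          using quad[of "B / ?I + 1" 1] True B Ip by (simp add: B_def)
        moreover have "2 * (B / ?I + 1) * ?I = 2 * B + 2 * ?I"
          using Ip by (simp add: field_simps)
        ultimately show False using B Ip by linarith
      next
        case False
        then have g0: "l2norm g = 0" using True by simp
        define B where "B = (l2norm f)\<^sup>2"
        have B: "0 \<le> B" by (simp add: B_def)
        have "2 * (B / ?I + 1) * ?I \<le> B"
          using quad[of 1 "B / ?I + 1"] g0 B Ip by (simp add: B_def)
        moreover have "2 * (B / ?I + 1) * ?I = 2 * B + 2 * ?I"
          using Ip by (simp add: field_simps)
        ultimately show False using B Ip by linarith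
      qed
    qed
    then show ?thesis using True I0 by auto
  qed
qed

lemma l2inner_le:
  assumes "inL2 f" "inL2 g"
  shows "\<bar>l2inner f g\<bar> \<le> l2norm f * l2norm g"
proof -
  have "\<bar>l2inner f g\<bar> \<le> (\<integral>x. \<bar>f x * g x\<bar> \<partial>lborel)"
    unfolding l2inner_def by (rule integral_abs_bound)
  then show ?thesis using abs_integral_mult_le[OF assms] by linarith
qed

lemma l2norm_cmult: "l2norm (\<lambda>x. c * f x) = \<bar>c\<bar> * l2norm f"
  by (simp add: l2norm_def power_mult_distrib real_sqrt_mult)

lemma l2norm_add_le:
  assumes "inL2 f" "inL2 g"
  shows "l2norm (\<lambda>x. f x + g x) \<le> l2norm f + l2norm g"
proof (rule power2_le_imp_le)
  have "(l2norm (\<lambda>x. f x + g x))\<^sup>2 = (l2norm f)\<^sup>2 + 2 * l2inner f g + (l2norm g)\<^sup>2"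
    using assms by (simp add: l2norm_square l2inner_add_left l2inner_add_right inL2_add l2inner_commute[of g f])
  then show "(l2norm (\<lambda>x. f x + g x))\<^sup>2 \<le> (l2norm f + l2norm g)\<^sup>2"
    using l2inner_le[OF assms] by (simp add: power2_sum)
qed simp

lemma l2norm_diff_le:
  assumes "inL2 f" "inL2 g"
  shows "l2norm (\<lambda>x. f x - g x) \<le> l2norm f + l2norm g"
  using l2norm_add_le[OF assms(1) inL2_cmult[OF assms(2), of "-1"]] l2norm_cmult[of "-1" g] by simp

lemma l2norm_mono:
  assumes "inL2 f" "inL2 g" "\<And>x. \<bar>f x\<bar> \<le> \<bar>g x\<bar>"
  shows "l2norm f \<le> l2norm g"
  unfolding l2norm_def
proof (rule real_sqrt_le_mono, rule integral_mono)
  show "(f x)\<^sup>2 \<le> (g x)\<^sup>2" for x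
    using assms(3)[of x] by (simp add: abs_le_square_iff)
qed (use assms in \<open>auto simp: inL2_def\<close>)

section \<open>Invariance of Lebesgue measure under translations and reflections\<close>

lemma lborel_integral_translate:
  fixes f :: "'a::euclidean_space \<Rightarrow> 'b::{banach, second_countable_topology}"
  shows "(\<integral>x. f (x + z) \<partial>lborel) = (\<integral>x. f x \<partial>lborel)"
proof (cases "f \<in> borel_measurable borel")
  case True
  have "(\<integral>x. f x \<partial>lborel) = (\<integral>x. f x \<partial>(distr lborel borel ((+) z)))"
    by (simp add: lborel_distr_plus)
  also have "\<dots> = (\<integral>x. f (z + x) \<partial>lborel)"
    using True by (subst integral_distr) auto
  finally show ?thesis by (simp add: add.commute)
next
  case False
  \<comment> \<open>A non-measurable function has non-measurable translates, so both integrals take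
    the default value 0.\<close>
  have "(\<lambda>x. f (x + z)) \<notin> borel_measurable borel"
  proof
    assume "(\<lambda>x. f (x + z)) \<in> borel_measurable borel"
    then have "(\<lambda>x. f (x + z)) \<circ> (\<lambda>x. x - z) \<in> borel_measurable borel"
      by (intro measurable_comp) auto
    then show False using False by (simp add: comp_def)
  qed
  then have "\<not> integrable lborel (\<lambda>x. f (x + z))" "\<not> integrable lborel f"
    using False by (auto dest: borel_measurable_integrable)
  then show ?thesis by (simp add: not_integrable_integral_eq)
qed

lemma lborel_distr_reflect:
  fixes z :: "'a::euclidean_space"
  shows "distr lborel borel (\<lambda>x. z - x) = lborel"
  using lborel_affine_euclidean[of "\<lambda>_. -1" z]
  by (simp add: sum_negf euclidean_representation density_1)

lemma lborel_integral_reflect: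
  fixes f :: "'a::euclidean_space \<Rightarrow> 'b::{banach, second_countable_topology}"
  shows "(\<integral>x. f (z - x) \<partial>lborel) = (\<integral>x. f x \<partial>lborel)"
proof (cases "f \<in> borel_measurable borel")
  case True
  have "(\<integral>x. f x \<partial>lborel) = (\<integral>x. f x \<partial>(distr lborel borel (\<lambda>x. z - x)))"
    by (simp add: lborel_distr_reflect)
  also have "\<dots> = (\<integral>x. f (z - x) \<partial>lborel)"
    using True by (subst integral_distr) auto
  finally show ?thesis by simp
next
  case False
  have "(\<lambda>x. f (z - x)) \<notin> borel_measurable borel"
  proof
    assume "(\<lambda>x. f (z - x)) \<in> borel_measurable borel"
    then have "(\<lambda>x. f (z - x)) \<circ> (\<lambda>x. z - x) \<in> borel_measurable borel"
      by (intro measurable_comp) auto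
    then show False using False by (simp add: comp_def)
  qed
  then have "\<not> integrable lborel (\<lambda>x. f (z - x))" "\<not> integrable lborel f"
    using False by (auto dest: borel_measurable_integrable)
  then show ?thesis by (simp add: not_integrable_integral_eq)
qed

lemma lborel_integrable_translate:
  fixes f :: "'a::euclidean_space \<Rightarrow> 'b::{banach, second_countable_topology}"
  assumes "integrable lborel f"
  shows "integrable lborel (\<lambda>x. f (x + z))"
proof -
  have "integrable (distr lborel borel ((+) z)) f"
    using assms by (simp add: lborel_distr_plus)
  then have "integrable lborel (\<lambda>x. f (z + x))"
    by (subst (asm) integrable_distr_eq) (use assms in auto)
  then show ?thesis by (simp add: add.commute)
qed

lemma lborel_integrable_reflect:
  fixes f :: "'a::euclidean_space \<Rightarrow> 'b::{banach, second_countable_topology}"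
  assumes "integrable lborel f"
  shows "integrable lborel (\<lambda>x. f (z - x))"
proof -
  have "integrable (distr lborel borel (\<lambda>x. z - x)) f"
    using assms by (simp add: lborel_distr_reflect)
  then show ?thesis
    by (subst (asm) integrable_distr_eq) (use assms in auto)
qed

lemma inL2_translate: "inL2 f \<Longrightarrow> inL2 (\<lambda>x. f (x - z))"
  using lborel_integrable_translate[of "\<lambda>x. (f x)\<^sup>2" "- z"] by (auto simp: inL2_def)

lemma l2norm_translate: "l2norm (\<lambda>x. f (x - z)) = l2norm f"
  using lborel_integral_translate[of "\<lambda>x. (f x)\<^sup>2" "- z"] by (simp add: l2norm_def)

section \<open>Continuity of translations and correlations\<close>

text \<open>Stated along sequences of shifts, so that dominated convergence applies
  directly.\<close>

definition L1_translation_continuous :: "('a::euclidean_space \<Rightarrow> real) \<Rightarrow> bool" where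
  "L1_translation_continuous f \<longleftrightarrow>
     (\<forall>Z. Z \<longlonglongrightarrow> 0 \<longrightarrow> (\<lambda>n. \<integral>x. \<bar>f (x - Z n) - f x\<bar> \<partial>lborel) \<longlonglongrightarrow> 0)"

lemma lborel_integrable_translate_diff:
  fixes f :: "'a::euclidean_space \<Rightarrow> 'b::{banach, second_countable_topology}"
  shows "integrable lborel f \<Longrightarrow> integrable lborel (\<lambda>x. f (x - z))"
  using lborel_integrable_translate[of f "- z"] by simp

lemma lborel_integral_translate_diff:
  fixes f :: "'a::euclidean_space \<Rightarrow> 'b::{banach, second_countable_topology}"
  shows "(\<integral>x. f (x - z) \<partial>lborel) = (\<integral>x. f x \<partial>lborel)"
  using lborel_integral_translate[of f "- z"] by simp

text \<open>Translation is an L1 isometry, so replacing f by g costs their distance twice, once for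
  the translate: three terms below e / 3.\<close>

lemma L1_translation_continuous_approx:
  assumes f: "integrable lborel f"
    and approx: "\<And>e. 0 < e \<Longrightarrow> \<exists>g. integrable lborel g \<and> L1_translation_continuous g \<and>
                   (\<integral>x. \<bar>f x - g x\<bar> \<partial>lborel) < e"
  shows "L1_translation_continuous f"
  unfolding L1_translation_continuous_def
proof (intro allI impI)
  fix Z :: "nat \<Rightarrow> 'a" assume Z: "Z \<longlonglongrightarrow> 0"
  show "(\<lambda>n. \<integral>x. \<bar>f (x - Z n) - f x\<bar> \<partial>lborel) \<longlonglongrightarrow> 0"
  proof (rule LIMSEQ_I)
    fix e :: real assume "0 < e"
    then obtain g where g: "integrable lborel g" "L1_translation_continuous g"
      and fg: "(\<integral>x. \<bar>f x - g x\<bar> \<partial>lborel) < e / 3"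
      using approx[of "e / 3"] by auto
    have "(\<lambda>n. \<integral>x. \<bar>g (x - Z n) - g x\<bar> \<partial>lborel) \<longlonglongrightarrow> 0"
      using g(2) Z by (auto simp: L1_translation_continuous_def)
    then obtain N where N: "\<And>n. n \<ge> N \<Longrightarrow> (\<integral>x. \<bar>g (x - Z n) - g x\<bar> \<partial>lborel) < e / 3"
      using \<open>0 < e\<close> by (force dest: LIMSEQ_D[where r="e/3"])
    have "(\<integral>x. \<bar>f (x - Z n) - f x\<bar> \<partial>lborel) < e" if "n \<ge> N" for n
    proof -
      note int = lborel_integrable_translate_diff[OF f, of "Z n"]
        lborel_integrable_translate_diff[OF g(1), of "Z n"] f g(1)
      have "(\<integral>x. \<bar>f (x - Z n) - f x\<bar> \<partial>lborel)
          \<le> (\<integral>x. \<bar>f (x - Z n) - g (x - Z n)\<bar> + \<bar>g (x - Z n) - g x\<bar> + \<bar>f x - g x\<bar> \<partial>lborel)"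
        by (rule integral_mono) (use int in auto)
      also have "\<dots> = (\<integral>x. \<bar>f (x - Z n) - g (x - Z n)\<bar> \<partial>lborel)
          + (\<integral>x. \<bar>g (x - Z n) - g x\<bar> \<partial>lborel) + (\<integral>x. \<bar>f x - g x\<bar> \<partial>lborel)"
        using int by simp
      also have "(\<integral>x. \<bar>f (x - Z n) - g (x - Z n)\<bar> \<partial>lborel) = (\<integral>x. \<bar>f x - g x\<bar> \<partial>lborel)"
        by (rule lborel_integral_translate_diff[of "\<lambda>x. \<bar>f x - g x\<bar>"])
      finally show ?thesis using fg N[OF that] by linarith
    qed
    then show "\<exists>N. \<forall>n\<ge>N. norm ((\<integral>x. \<bar>f (x - Z n) - f x\<bar> \<partial>lborel) - 0) < e"
      by auto
  qed
qed

text \<open>For an open set of finite measure the positive part of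
  \<open>indicator U x - indicator U (x - z)\<close> tends to \<open>0\<close> pointwise, and the positive and the
  negative part have the same integral.\<close>

lemma L1_translation_continuous_open:
  fixes U :: "'a::euclidean_space set"
  assumes U: "open U" and fin: "emeasure lborel U < \<infinity>"
  shows "L1_translation_continuous (indicator U)"
  unfolding L1_translation_continuous_def
proof (intro allI impI)
  fix Z :: "nat \<Rightarrow> 'a" assume Z: "Z \<longlonglongrightarrow> 0"
  let ?f = "indicator U :: 'a \<Rightarrow> real"
  have [measurable]: "U \<in> sets borel" using U by simp
  have int: "integrable lborel ?f" using fin by simp
  note int' = lborel_integrable_translate_diff[OF int]
  have "(\<lambda>n. \<integral>x. max 0 (?f x - ?f (x - Z n)) \<partial>lborel) \<longlonglongrightarrow> (\<integral>x. 0 \<partial>(lborel :: 'a measure))"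
  proof (rule integral_dominated_convergence)
    show "integrable lborel ?f" by (rule int)
    have "(\<lambda>n. max 0 (?f x - ?f (x - Z n))) \<longlonglongrightarrow> 0" for x
    proof (cases "x \<in> U")
      case True
      have "(\<lambda>n. x - Z n) \<longlonglongrightarrow> x - 0" by (intro tendsto_intros Z)
      then have "\<forall>\<^sub>F n in sequentially. x - Z n \<in> U"
        using U True by (auto dest: topological_tendstoD)
      then have "\<forall>\<^sub>F n in sequentially. max 0 (?f x - ?f (x - Z n)) = 0"
        by eventually_elim (use True in auto)
      then show ?thesis by (rule tendsto_eventually)
    qed (simp add: indicator_def)
    then show "AE x in lborel. (\<lambda>n. max 0 (?f x - ?f (x - Z n))) \<longlonglongrightarrow> 0" by simp
    show "AE x in lborel. norm (max 0 (?f x - ?f (x - Z n))) \<le> ?f x" for n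
      by (auto simp: indicator_def)
  qed measurable
  then have "(\<lambda>n. 2 * (\<integral>x. max 0 (?f x - ?f (x - Z n)) \<partial>lborel)) \<longlonglongrightarrow> 2 * 0"
    by (intro tendsto_intros) simp
  moreover have "2 * (\<integral>x. max 0 (?f x - ?f (x - Z n)) \<partial>lborel) = (\<integral>x. \<bar>?f (x - Z n) - ?f x\<bar> \<partial>lborel)" for n
  proof -
    have "(\<integral>x. \<bar>?f (x - Z n) - ?f x\<bar> \<partial>lborel)
        = (\<integral>x. 2 * max 0 (?f x - ?f (x - Z n)) + ?f (x - Z n) - ?f x \<partial>lborel)"
      by (rule Bochner_Integration.integral_cong) (auto simp: indicator_def)
    also have "\<dots> = 2 * (\<integral>x. max 0 (?f x - ?f (x - Z n)) \<partial>lborel)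
        + (\<integral>x. ?f (x - Z n) \<partial>lborel) - (\<integral>x. ?f x \<partial>lborel)"
      using int int'[of "Z n"] by simp
    also have "(\<integral>x. ?f (x - Z n) \<partial>lborel) = (\<integral>x. ?f x \<partial>lborel)"
      by (rule lborel_integral_translate_diff)
    finally show ?thesis by simp
  qed
  ultimately show "(\<lambda>n. \<integral>x. \<bar>?f (x - Z n) - ?f x\<bar> \<partial>lborel) \<longlonglongrightarrow> 0" by simp
qed

lemma L1_translation_continuous_add:
  assumes "integrable lborel f" "integrable lborel g"
    "L1_translation_continuous f" "L1_translation_continuous g"
  shows "L1_translation_continuous (\<lambda>x. f x + g x)"
  unfolding L1_translation_continuous_def
proof (intro allI impI)
  fix Z :: "nat \<Rightarrow> 'a" assume Z: "Z \<longlonglongrightarrow> 0"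
  note int = lborel_integrable_translate_diff[OF assms(1)] lborel_integrable_translate_diff[OF assms(2)] assms(1,2)
  have lim: "(\<lambda>n. (\<integral>x. \<bar>f (x - Z n) - f x\<bar> \<partial>lborel) + (\<integral>x. \<bar>g (x - Z n) - g x\<bar> \<partial>lborel)) \<longlonglongrightarrow> 0 + 0"
    using assms Z by (intro tendsto_add) (auto simp: L1_translation_continuous_def)
  show "(\<lambda>n. \<integral>x. \<bar>f (x - Z n) + g (x - Z n) - (f x + g x)\<bar> \<partial>lborel) \<longlonglongrightarrow> 0"
  proof (rule Lim_null_comparison[OF always_eventually lim[unfolded add_0_right]], rule allI)
    fix n
    have "(\<integral>x. \<bar>f (x - Z n) + g (x - Z n) - (f x + g x)\<bar> \<partial>lborel)
        \<le> (\<integral>x. \<bar>f (x - Z n) - f x\<bar> + \<bar>g (x - Z n) - g x\<bar> \<partial>lborel)"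
      by (rule integral_mono) (use int in auto)
    then show "norm (\<integral>x. \<bar>f (x - Z n) + g (x - Z n) - (f x + g x)\<bar> \<partial>lborel)
        \<le> (\<integral>x. \<bar>f (x - Z n) - f x\<bar> \<partial>lborel) + (\<integral>x. \<bar>g (x - Z n) - g x\<bar> \<partial>lborel)"
      using int by simp
  qed
qed

lemma L1_translation_continuous_cmult:
  assumes "L1_translation_continuous f"
  shows "L1_translation_continuous (\<lambda>x. c * f x)"
  unfolding L1_translation_continuous_def
proof (intro allI impI)
  fix Z :: "nat \<Rightarrow> 'a" assume Z: "Z \<longlonglongrightarrow> 0"
  have "(\<lambda>n. \<bar>c\<bar> * (\<integral>x. \<bar>f (x - Z n) - f x\<bar> \<partial>lborel)) \<longlonglongrightarrow> \<bar>c\<bar> * 0"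
    using assms Z by (intro tendsto_mult tendsto_const) (auto simp: L1_translation_continuous_def)
  moreover have "\<bar>c\<bar> * (\<integral>x. \<bar>f (x - Z n) - f x\<bar> \<partial>lborel) = (\<integral>x. \<bar>c * f (x - Z n) - c * f x\<bar> \<partial>lborel)" for n
    by (simp add: abs_mult right_diff_distrib[symmetric])
  ultimately show "(\<lambda>n. \<integral>x. \<bar>c * f (x - Z n) - c * f x\<bar> \<partial>lborel) \<longlonglongrightarrow> 0" by simp
qed

text \<open>Density argument: sets of finite measure are approximated from outside by open sets,
  linear combinations follow, and dominated convergence carries the property to the pointwise
  limit.\<close>

lemma L1_translation_continuous_integrable:
  fixes f :: "'a::euclidean_space \<Rightarrow> real"
  assumes "integrable lborel f"
  shows "L1_translation_continuous f"
  using assms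
proof (induction rule: integrable_induct)
  case (base A c)
  then have [measurable]: "A \<in> sets borel" by simp
  have intA: "integrable lborel (indicator A :: 'a \<Rightarrow> real)" using base by simp
  have "L1_translation_continuous (indicator A :: 'a \<Rightarrow> real)"
  proof (rule L1_translation_continuous_approx[OF intA])
    fix e :: real assume "0 < e"
    from outer_regular_lborel[OF _ this, of A] obtain U where
      U: "open U" "A \<subseteq> U" "emeasure lborel (U - A) < ennreal e" by auto
    have [measurable]: "U \<in> sets borel" using U by simp
    have "emeasure lborel U = emeasure lborel A + emeasure lborel (U - A)"
      using U(2) by (subst plus_emeasure) (auto intro!: arg_cong2[where f=emeasure])
    also have "\<dots> < \<infinity>" using base(2) U(3) by (simp add: ennreal_add_less_top less_top top.extremum_strict order_less_trans[OF _ ennreal_less_top])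
    finally have fin: "emeasure lborel U < \<infinity>" .
    then have intU: "integrable lborel (indicator U :: 'a \<Rightarrow> real)" by simp
    have "(\<integral>x. \<bar>indicator A x - indicator U x :: real\<bar> \<partial>lborel) = (\<integral>x. indicator (U - A) x \<partial>lborel)"
      by (rule Bochner_Integration.integral_cong) (use U(2) in \<open>auto simp: indicator_def\<close>)
    also have "\<dots> = measure lborel (U - A)" by simp
    also have "\<dots> < e"
    proof -
      have "emeasure lborel (U - A) = ennreal (measure lborel (U - A))"
        using U(3) by (intro emeasure_eq_ennreal_measure) (auto simp: top_unique)
      then show ?thesis using U(3) by (simp add: ennreal_less_iff)
    qed
    finally show "\<exists>g. integrable lborel g \<and> L1_translation_continuous g \<and>
        (\<integral>x. \<bar>indicator A x - g x\<bar> \<partial>lborel) < e"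
      using intU L1_translation_continuous_open[OF U(1) fin] by blast
  qed
  from L1_translation_continuous_cmult[OF this, of c] show ?case by (simp add: mult.commute)
next
  case (add f g)
  then show ?case by (intro L1_translation_continuous_add)
next
  case (lim f s)
  have [measurable]: "f \<in> borel_measurable borel" "\<And>i. s i \<in> borel_measurable borel"
    using borel_measurable_integrable[OF \<open>integrable lborel f\<close>] borel_measurable_integrable[OF lim(1)] by simp_all
  show ?case
  proof (rule L1_translation_continuous_approx[OF lim(4)])
    fix e :: real assume "0 < e"
    have "(\<lambda>i. \<integral>x. \<bar>f x - s i x\<bar> \<partial>lborel) \<longlonglongrightarrow> (\<integral>x. 0 \<partial>(lborel :: 'a measure))"
    proof (rule integral_dominated_convergence[where w="\<lambda>x. 3 * \<bar>f x\<bar>"])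
      show "integrable lborel (\<lambda>x. 3 * \<bar>f x\<bar>)" using lim by simp
      have "(\<lambda>i. \<bar>f x - s i x\<bar>) \<longlonglongrightarrow> \<bar>f x - f x\<bar>" for x
        by (intro tendsto_intros) (use lim(2) in auto)
      then show "AE x in lborel. (\<lambda>i. \<bar>f x - s i x\<bar>) \<longlonglongrightarrow> 0" by simp
      have "\<bar>s i x\<bar> \<le> 2 * \<bar>f x\<bar>" for i x using lim(3)[of x i] by simp
      then show "AE x in lborel. norm \<bar>f x - s i x\<bar> \<le> 3 * \<bar>f x\<bar>" for i
        by (intro AE_I2) (smt (verit) real_norm_def)
    qed measurable
    then obtain i where "(\<integral>x. \<bar>f x - s i x\<bar> \<partial>lborel) < e"
      using LIMSEQ_D[OF _ \<open>0 < e\<close>, of "\<lambda>i. \<integral>x. \<bar>f x - s i x\<bar> \<partial>lborel" 0] by force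
    then show "\<exists>g. integrable lborel g \<and> L1_translation_continuous g \<and> (\<integral>x. \<bar>f x - g x\<bar> \<partial>lborel) < e"
      using lim(1,5) by blast
  qed
qed

text \<open>For nonnegative a and b, (a - b)^2 is at most |a^2 - b^2|, so the L1 continuity of the
  square of f suffices.\<close>

lemma L2_translation_continuous_nonneg:
  assumes f: "inL2 f" and nonneg: "\<And>x. 0 \<le> f x" and Z: "Z \<longlonglongrightarrow> 0"
  shows "(\<lambda>n. l2norm (\<lambda>x. f (x - Z n) - f x)) \<longlonglongrightarrow> 0"
proof -
  have lim: "(\<lambda>n. \<integral>x. \<bar>(f (x - Z n))\<^sup>2 - (f x)\<^sup>2\<bar> \<partial>lborel) \<longlonglongrightarrow> 0"
    using L1_translation_continuous_integrable[OF inL2_integrable_square[OF f]] Z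
    by (simp add: L1_translation_continuous_def)
  have sq: "(a - b)\<^sup>2 \<le> \<bar>a\<^sup>2 - b\<^sup>2\<bar>" if "0 \<le> a" "0 \<le> b" for a b :: real
  proof -
    have "(a - b)\<^sup>2 = \<bar>a - b\<bar> * \<bar>a - b\<bar>" by (simp add: power2_eq_square)
    also have "\<dots> \<le> \<bar>a - b\<bar> * (a + b)" using that by (intro mult_left_mono) auto
    also have "\<dots> = \<bar>(a - b) * (a + b)\<bar>" using that by (simp add: abs_mult)
    finally show ?thesis by (simp add: power2_eq_square algebra_simps)
  qed
  have "(\<lambda>n. (l2norm (\<lambda>x. f (x - Z n) - f x))\<^sup>2) \<longlonglongrightarrow> 0"
  proof (rule Lim_null_comparison[OF always_eventually lim], rule allI)
    fix n
    have "(l2norm (\<lambda>x. f (x - Z n) - f x))\<^sup>2 = (\<integral>x. (f (x - Z n) - f x)\<^sup>2 \<partial>lborel)"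
      by (simp add: l2norm_def)
    also have "\<dots> \<le> (\<integral>x. \<bar>(f (x - Z n))\<^sup>2 - (f x)\<^sup>2\<bar> \<partial>lborel)"
    proof (rule integral_mono)
      show "integrable lborel (\<lambda>x. (f (x - Z n) - f x)\<^sup>2)"
        by (intro inL2_integrable_square inL2_diff inL2_translate f)
      show "integrable lborel (\<lambda>x. \<bar>(f (x - Z n))\<^sup>2 - (f x)\<^sup>2\<bar>)"
        using inL2_integrable_square[OF f] inL2_integrable_square[OF inL2_translate[OF f]] by simp
    qed (intro sq nonneg)
    finally show "norm ((l2norm (\<lambda>x. f (x - Z n) - f x))\<^sup>2) \<le> (\<integral>x. \<bar>(f (x - Z n))\<^sup>2 - (f x)\<^sup>2\<bar> \<partial>lborel)"
      by simp
  qed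
  from tendsto_real_sqrt[OF this] show ?thesis by simp
qed

lemma L2_translation_continuous:
  assumes f: "inL2 f" and Z: "Z \<longlonglongrightarrow> 0"
  shows "(\<lambda>n. l2norm (\<lambda>x. f (x - Z n) - f x)) \<longlonglongrightarrow> 0"
proof -
  \<comment> \<open>The inequality between squares needs a sign, hence the split into positive and
    negative part.\<close>
  let ?p = "\<lambda>x. max 0 (f x)" and ?m = "\<lambda>x. max 0 (- f x)"
  have [measurable]: "f \<in> borel_measurable borel" using f by (simp add: inL2_def)
  have p: "inL2 ?p" and m: "inL2 ?m"
    by (rule inL2_bounded[OF f, where B=1]; auto)+
  have lim: "(\<lambda>n. l2norm (\<lambda>x. ?p (x - Z n) - ?p x) + l2norm (\<lambda>x. ?m (x - Z n) - ?m x)) \<longlonglongrightarrow> 0 + 0"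
    by (intro tendsto_add L2_translation_continuous_nonneg[OF p] L2_translation_continuous_nonneg[OF m] Z) auto
  show ?thesis
  proof (rule Lim_null_comparison[OF always_eventually], rule allI)
    fix n
    have eq: "f (x - Z n) - f x = (?p (x - Z n) - ?p x) - (?m (x - Z n) - ?m x)" for x
      by (simp add: max_def)
    have "l2norm (\<lambda>x. (?p (x - Z n) - ?p x) - (?m (x - Z n) - ?m x))
        \<le> l2norm (\<lambda>x. ?p (x - Z n) - ?p x) + l2norm (\<lambda>x. ?m (x - Z n) - ?m x)"
      by (intro l2norm_diff_le inL2_diff inL2_translate[OF p] inL2_translate[OF m] p m)
    then show "norm (l2norm (\<lambda>x. f (x - Z n) - f x))
        \<le> l2norm (\<lambda>x. ?p (x - Z n) - ?p x) + l2norm (\<lambda>x. ?m (x - Z n) - ?m x)"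
      by (simp add: eq)
  qed (use lim in simp)
qed

text \<open>The substitute for mollifying f or g: its value at z = 0 is the inner product, it is
  bounded and continuous for all L2 functions, and weak derivatives of f or g turn into weak
  derivatives in z.\<close>

definition correlation :: "(real^'n::finite \<Rightarrow> real) \<Rightarrow> (real^'n \<Rightarrow> real) \<Rightarrow> real^'n \<Rightarrow> real" where
  "correlation f g z = l2inner f (\<lambda>x. g (x - z))"

lemma correlation_0 [simp]: "correlation f g 0 = l2inner f g"
  by (simp add: correlation_def)

lemma correlation_le: "inL2 f \<Longrightarrow> inL2 g \<Longrightarrow> \<bar>correlation f g z\<bar> \<le> l2norm f * l2norm g"
  using l2inner_le[OF _ inL2_translate, of f g z] by (simp add: correlation_def l2norm_translate)

lemma continuous_correlation:
  fixes f g :: "real^'n::finite \<Rightarrow> real"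
  assumes f: "inL2 f" and g: "inL2 g"
  shows "continuous_on UNIV (correlation f g)"
proof (rule continuous_at_imp_continuous_on, rule ballI)
  fix a :: "real^'n"
  show "isCont (correlation f g) a"
    unfolding continuous_at_sequentially
  proof (intro allI impI)
    fix X :: "nat \<Rightarrow> real^'n" assume X: "X \<longlonglongrightarrow> a"
    have Z: "(\<lambda>n. X n - a) \<longlonglongrightarrow> 0" using X by (simp add: LIM_zero)
    let ?g = "\<lambda>x. g (x - a)"
    have g': "inL2 ?g" by (rule inL2_translate[OF g])
    have "(\<lambda>n. correlation f g (X n) - correlation f g a) \<longlonglongrightarrow> 0"
    proof (rule Lim_null_comparison[OF always_eventually], rule allI)
      fix n
      have "correlation f g (X n) - correlation f g a = l2inner f (\<lambda>x. ?g (x - (X n - a)) - ?g x)"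
        unfolding correlation_def
        by (subst l2inner_diff_right[OF inL2_translate[OF g'] g' f]) simp
      also have "\<bar>\<dots>\<bar> \<le> l2norm f * l2norm (\<lambda>x. ?g (x - (X n - a)) - ?g x)"
        by (intro l2inner_le f inL2_diff inL2_translate[OF g'] g')
      finally show "norm (correlation f g (X n) - correlation f g a)
          \<le> l2norm f * l2norm (\<lambda>x. ?g (x - (X n - a)) - ?g x)" by simp
      show "(\<lambda>n. l2norm f * l2norm (\<lambda>x. ?g (x - (X n - a)) - ?g x)) \<longlonglongrightarrow> 0"
        using tendsto_mult_left[OF L2_translation_continuous[OF g' Z], of "l2norm f"] by simp
    qed
    then show "(correlation f g \<circ> X) \<longlonglongrightarrow> correlation f g a"
      by (simp add: LIM_zero_iff comp_def)
  qed
qed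

lemma measurable_correlation [measurable]:
  "inL2 f \<Longrightarrow> inL2 g \<Longrightarrow> correlation f g \<in> borel_measurable borel"
  by (rule borel_measurable_continuous_onI[OF continuous_correlation])

lemma integrable_mult_correlation:
  assumes K: "integrable lborel K" and f: "inL2 f" and g: "inL2 g"
  shows "integrable lborel (\<lambda>z. K z * correlation f g z)"
proof (rule Bochner_Integration.integrable_bound)
  show "integrable lborel (\<lambda>z. l2norm f * l2norm g * K z)" using K by simp
  have [measurable]: "K \<in> borel_measurable borel" using K by auto
  show "(\<lambda>z. K z * correlation f g z) \<in> borel_measurable lborel" using f g by simp
  show "AE z in lborel. norm (K z * correlation f g z) \<le> norm (l2norm f * l2norm g * K z)"
    using mult_left_mono[OF correlation_le[OF f g], of "\<bar>K _\<bar>"]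
    by (auto simp: abs_mult mult_ac)
qed

interpretation lborel_pair: pair_sigma_finite "lborel :: 'a::euclidean_space measure" "lborel :: 'b::euclidean_space measure"
  by unfold_locales

text \<open>The inner integral of the absolute values is |K z| times the correlation of |f| and |g|,
  which is again bounded.\<close>

lemma integrable_correlation_kernel:
  assumes K: "integrable lborel K" and f: "inL2 f" and g: "inL2 g"
  shows "integrable (lborel \<Otimes>\<^sub>M lborel) (\<lambda>(z, x). K z * (f x * g (x - z)))"
proof -
  have [measurable]: "K \<in> borel_measurable borel" "f \<in> borel_measurable borel" "g \<in> borel_measurable borel"
    using K f g by (auto simp: inL2_def)
  have norm_eq: "(\<integral>x. norm (K z * (f x * g (x - z))) \<partial>lborel)
      = \<bar>K z\<bar> * correlation (\<lambda>x. \<bar>f x\<bar>) (\<lambda>x. \<bar>g x\<bar>) z" for z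
    by (simp add: abs_mult correlation_def l2inner_def)
  show ?thesis
  proof (rule lborel_pair.Fubini_integrable)
    show "integrable lborel (\<lambda>z. \<integral>x. norm (case (z, x) of (z, x) \<Rightarrow> K z * (f x * g (x - z))) \<partial>lborel)"
      unfolding prod.case norm_eq
      by (intro integrable_mult_correlation inL2_abs f g) (use K in simp)
    show "AE z in lborel. integrable lborel (\<lambda>x. case (z, x) of (z, x) \<Rightarrow> K z * (f x * g (x - z)))"
      using inL2_mult_integrable[OF f inL2_translate[OF g]] by simp
  qed measurable
qed

text \<open>Fubini and the substitution y = x - z. The two forms let K act on g or on f, so that a
  derivative falling on K can be moved to either factor.\<close>

lemma integral_mult_correlation:
  fixes K f g :: "real^'n::finite \<Rightarrow> real"
  assumes K: "integrable lborel K" and f: "inL2 f" and g: "inL2 g"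
  shows "(\<integral>z. K z * correlation f g z \<partial>lborel) = (\<integral>x. f x * (\<integral>y. g y * K (x - y) \<partial>lborel) \<partial>lborel)"
    and "(\<integral>z. K z * correlation f g z \<partial>lborel) = (\<integral>y. g y * (\<integral>x. f x * K (x - y) \<partial>lborel) \<partial>lborel)"
proof -
  have 1: "(\<integral>z. K z * correlation f g z \<partial>lborel) = (\<integral>x. \<integral>z. K z * (f x * g (x - z)) \<partial>lborel \<partial>lborel)"
    if "integrable lborel K" "inL2 f" "inL2 g" for K f g :: "real^'n \<Rightarrow> real"
    using lborel_pair.Fubini_integral[OF integrable_correlation_kernel[OF that]]
    by (simp add: correlation_def l2inner_def)
  have 2: "(\<integral>z. K z * (f x * g (x - z)) \<partial>lborel) = f x * (\<integral>y. g y * K (x - y) \<partial>lborel)" for K f g :: "real^'n \<Rightarrow> real" and x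
    using lborel_integral_reflect[of "\<lambda>z. K z * (f x * g (x - z))" x, symmetric]
    by (simp add: mult_ac)
  show "(\<integral>z. K z * correlation f g z \<partial>lborel) = (\<integral>x. f x * (\<integral>y. g y * K (x - y) \<partial>lborel) \<partial>lborel)"
    using 1[OF K f g] by (simp add: 2)
  \<comment> \<open>Replacing z by -z exchanges the factors; the second form is then the first one
    for the reflected kernel.\<close>
  have flip: "correlation f g (0 - z) = correlation g f z" for z
    using lborel_integral_translate[of "\<lambda>x. f (x - z) * g x" z]
    by (simp add: correlation_def l2inner_def mult.commute)
  have "(\<integral>z. K z * correlation f g z \<partial>lborel) = (\<integral>z. K (0 - z) * correlation f g (0 - z) \<partial>lborel)"
    by (rule lborel_integral_reflect[symmetric])
  also have "\<dots> = (\<integral>z. K (- z) * correlation g f z \<partial>lborel)"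
    unfolding flip by simp
  also have "\<dots> = (\<integral>y. \<integral>z. K (- z) * (g y * f (y - z)) \<partial>lborel \<partial>lborel)"
    by (rule 1) (use lborel_integrable_reflect[OF K, of 0] f g in simp_all)
  also have "\<dots> = (\<integral>y. g y * (\<integral>x. f x * K (x - y) \<partial>lborel) \<partial>lborel)"
    using 2[of "\<lambda>z. K (- z)" g _ f] by simp
  finally show "(\<integral>z. K z * correlation f g z \<partial>lborel) = (\<integral>y. g y * (\<integral>x. f x * K (x - y) \<partial>lborel) \<partial>lborel)" .
qed

lemma abs_integral_mult_correlation_le:
  assumes K: "integrable lborel K" and f: "inL2 f" and g: "inL2 g"
  shows "\<bar>\<integral>z. K z * correlation f g z \<partial>lborel\<bar> \<le> (\<integral>z. \<bar>K z\<bar> \<partial>lborel) * (l2norm f * l2norm g)"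
proof -
  have int: "integrable lborel (\<lambda>z. \<bar>K z * correlation f g z\<bar>)"
    using integrable_mult_correlation[OF K f g] by (rule integrable_abs)
  have "\<bar>\<integral>z. K z * correlation f g z \<partial>lborel\<bar> \<le> (\<integral>z. \<bar>K z * correlation f g z\<bar> \<partial>lborel)"
    by (rule integral_abs_bound)
  also have "\<dots> \<le> (\<integral>z. \<bar>K z\<bar> * (l2norm f * l2norm g) \<partial>lborel)"
    by (rule integral_mono[OF int])
      (use K mult_left_mono[OF correlation_le[OF f g]] in \<open>auto simp: abs_mult\<close>)
  finally show ?thesis by simp
qed

section \<open>Test functions and weak derivatives\<close>

lemma pd_eq:
  assumes "(f has_derivative D) (at x)"
  shows "pd i f x = D (axis i 1)"
proof -
  have 1: "((\<lambda>h::real. x + h *\<^sub>R axis i 1) has_derivative (\<lambda>h. h *\<^sub>R axis i 1)) (at 0)"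
    by (auto intro!: derivative_eq_intros)
  have "((\<lambda>h. f (x + h *\<^sub>R axis i 1)) has_derivative (\<lambda>h. D (h *\<^sub>R axis i 1))) (at 0)"
    using has_derivative_compose[OF 1, of f D] assms by simp
  moreover have "D (h *\<^sub>R axis i 1) = h *\<^sub>R D (axis i 1)" for h
    by (rule linear_scale[OF has_derivative_linear[OF assms]])
  ultimately have "((\<lambda>h. f (x + h *\<^sub>R axis i 1)) has_field_derivative D (axis i 1)) (at 0)"
    by (simp add: has_field_derivative_def mult_commute_abs)
  then show ?thesis unfolding pd_def by (rule DERIV_imp_deriv)
qed

text \<open>The classical flat function exp (-1 / t) with additional powers of 1 / t. Thanks to
  these powers the derivative of a member is a linear combination of two members, so one computation
  covers all orders.\<close>

definition flat_exp :: "nat \<Rightarrow> real \<Rightarrow> real" where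
  "flat_exp k t = (if 0 < t then exp (- (1 / t)) / t ^ k else 0)"

lemma tendsto_flat_exp_0: "(flat_exp k \<longlongrightarrow> 0) (at_right 0)"
proof -
  have "((\<lambda>t. inverse t ^ k / exp (inverse t)) \<longlongrightarrow> (0::real)) (at_right 0)"
    by (rule filterlim_compose[OF tendsto_power_div_exp_0 filterlim_inverse_at_top_right])
  moreover have "\<forall>\<^sub>F t in at_right 0. inverse t ^ k / exp (inverse t) = flat_exp k t"
    by (rule eventually_mono[OF eventually_at_right_less])
      (auto simp: flat_exp_def exp_minus field_simps power_inverse)
  ultimately show ?thesis by (rule Lim_transform_eventually)
qed

lemma DERIV_flat_exp: "(flat_exp k has_field_derivative - real k * flat_exp (Suc k) t + flat_exp (k + 2) t) (at t)"
proof -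
  consider "t > 0" | "t < 0" | "t = 0" by linarith
  then show ?thesis
  proof cases
    case 1
    \<comment> \<open>Writing t ^ k as exp (k * ln t) leaves a single exponential to
      differentiate.\<close>
    let ?F = "\<lambda>t. exp (- (1 / t) - real k * ln t)"
    have F: "?F t = flat_exp k t" if "0 < t" for t
      using that by (simp add: flat_exp_def exp_diff exp_of_nat_mult)
    have "(?F has_field_derivative ?F t * (1 / t\<^sup>2 - real k / t)) (at t)"
      using 1 by (auto intro!: derivative_eq_intros simp: power2_eq_square)
    moreover have "?F t * (1 / t\<^sup>2 - real k / t) = - real k * flat_exp (Suc k) t + flat_exp (k + 2) t"
      unfolding F[OF 1] using 1 by (simp add: flat_exp_def field_simps power2_eq_square)
    ultimately have "(?F has_field_derivative - real k * flat_exp (Suc k) t + flat_exp (k + 2) t) (at t)"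
      by simp
    then show ?thesis
      by (rule has_field_derivative_transform_within_open[where S="{0<..}"]) (use 1 F in auto)
  next
    case 2
    have "((\<lambda>t. 0) has_field_derivative - real k * flat_exp (Suc k) t + flat_exp (k + 2) t) (at t)"
      using 2 by (simp add: flat_exp_def)
    then show ?thesis
      by (rule has_field_derivative_transform_within_open[where S="{..<0}"]) (use 2 in \<open>auto simp: flat_exp_def\<close>)
  next
    case 3
    \<comment> \<open>At 0 the right difference quotient of \<open>flat_exp k\<close> is
      \<open>flat_exp (Suc k)\<close>, which tends to 0; the left one is 0.\<close>
    have "((\<lambda>h. (flat_exp k (0 + h) - flat_exp k 0) / h) \<longlongrightarrow> 0) (at 0)"
      unfolding filterlim_at_split
    proof
      show "((\<lambda>h. (flat_exp k (0 + h) - flat_exp k 0) / h) \<longlongrightarrow> 0) (at_right 0)"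
        by (rule Lim_transform_eventually[OF tendsto_flat_exp_0[of "Suc k"]],
            rule eventually_mono[OF eventually_at_right_less]) (simp add: flat_exp_def)
      have "\<forall>\<^sub>F h in at_left 0. 0 = (flat_exp k (0 + h) - flat_exp k 0) / h"
        by (simp add: eventually_at_filter flat_exp_def)
      then show "((\<lambda>h. (flat_exp k (0 + h) - flat_exp k 0) / h) \<longlongrightarrow> 0) (at_left 0)"
        by (rule Lim_transform_eventually[OF tendsto_const])
    qed
    then show ?thesis using 3 by (simp add: DERIV_def flat_exp_def)
  qed
qed

text \<open>A class of functions closed under \<open>pd\<close> that contains the standard bump of radius \<open>e\<close>.\<close>

inductive bump_algebra :: "real \<Rightarrow> (real^'n::finite \<Rightarrow> real) \<Rightarrow> bool" for e where
  const: "bump_algebra e (\<lambda>x. c)"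
| coord: "bump_algebra e (\<lambda>x. x $ i)"
| add: "bump_algebra e f \<Longrightarrow> bump_algebra e g \<Longrightarrow> bump_algebra e (\<lambda>x. f x + g x)"
| mult: "bump_algebra e f \<Longrightarrow> bump_algebra e g \<Longrightarrow> bump_algebra e (\<lambda>x. f x * g x)"
| flat: "bump_algebra e (\<lambda>x. flat_exp k (e\<^sup>2 - x \<bullet> x))"

text \<open>The induction carries a total derivative along with the membership of its partials:
  \<open>pd\<close> is a mere \<open>deriv\<close> along a line and does not by itself provide the
  differentiability demanded of test functions at every order.\<close>

lemma bump_algebra_has_derivative:
  fixes f :: "real^'n::finite \<Rightarrow> real"
  assumes "bump_algebra e f"
  shows "\<exists>D. (\<forall>x. (f has_derivative D x) (at x)) \<and> (\<forall>i. bump_algebra e (\<lambda>x. D x (axis i 1)))"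
  using assms
proof induction
  case (const c)
  show ?case by (rule exI[of _ "\<lambda>x h. 0"]) (auto intro: bump_algebra.const)
next
  case (coord j)
  have "bump_algebra e (\<lambda>x::real^'n. axis i 1 $ j)" for i :: 'n by (rule bump_algebra.const)
  then show ?case
    by (intro exI[of _ "\<lambda>x h. h $ j"])
      (auto intro: bounded_linear_imp_has_derivative bounded_linear_vec_nth)
next
  case (add f g)
  then obtain D E where
    "\<And>x. (f has_derivative D x) (at x)" "\<And>i. bump_algebra e (\<lambda>x. D x (axis i 1))"
    "\<And>x. (g has_derivative E x) (at x)" "\<And>i. bump_algebra e (\<lambda>x. E x (axis i 1))"
    by blast
  then show ?case
    by (intro exI[of _ "\<lambda>x h. D x h + E x h"])
      (auto intro!: bump_algebra.add has_derivative_add)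
next
  case (mult f g)
  then obtain D E where
    "\<And>x. (f has_derivative D x) (at x)" "\<And>i. bump_algebra e (\<lambda>x. D x (axis i 1))"
    "\<And>x. (g has_derivative E x) (at x)" "\<And>i. bump_algebra e (\<lambda>x. E x (axis i 1))"
    by blast
  with mult.hyps show ?case
    by (intro exI[of _ "\<lambda>x h. f x * E x h + D x h * g x"])
      (auto intro!: bump_algebra.add bump_algebra.mult has_derivative_mult)
next
  case (flat k)
  let ?d = "\<lambda>t. - real k * flat_exp (Suc k) t + flat_exp (k + 2) t"
  let ?D = "\<lambda>(x::real^'n) h. ?d (e\<^sup>2 - x \<bullet> x) * (- 2 * (x \<bullet> h))"
  have "((\<lambda>x. flat_exp k (e\<^sup>2 - x \<bullet> x)) has_derivative ?D x) (at x)" for x :: "real^'n"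
  proof -
    have "((\<lambda>x. e\<^sup>2 - x \<bullet> x) has_derivative (\<lambda>h. - 2 * (x \<bullet> h))) (at x)"
      by (auto intro!: derivative_eq_intros simp: inner_commute)
    from has_derivative_compose[OF this DERIV_flat_exp[of k, unfolded has_field_derivative_def]]
    show ?thesis by simp
  qed
  moreover have "bump_algebra e (\<lambda>x. ?D x (axis i 1))" for i :: 'n
    unfolding inner_axis inner_real_def mult_1_right
    by (intro bump_algebra.intros)
  ultimately show ?case by (intro exI[of _ ?D] conjI allI) auto
qed

lemma bump_algebra_pd_iter: "bump_algebra e f \<Longrightarrow> bump_algebra e (pd_iter ds f)"
proof (induction ds)
  case (Cons i ds)
  from bump_algebra_has_derivative[OF Cons.IH[OF Cons.prems]] obtain D where
    D: "\<And>x. (pd_iter ds f has_derivative D x) (at x)" "bump_algebra e (\<lambda>x. D x (axis i 1))" by blast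
  have "pd_iter (i # ds) f = (\<lambda>x. D x (axis i 1))"
    using pd_eq[OF D(1)] by auto
  then show ?case using D(2) by simp
qed simp

lemma bump_algebra_test_fun:
  assumes "bump_algebra e f" "bounded {x. f x \<noteq> 0}"
  shows "test_fun f"
  unfolding test_fun_def differentiable_def
  using bump_algebra_has_derivative[OF bump_algebra_pd_iter[OF assms(1)]] assms(2) by blast

section \<open>Closure of test functions under derivatives, reflections and translations\<close>

lemma test_fun_differentiable: "test_fun \<phi> \<Longrightarrow> \<phi> differentiable (at x)"
  unfolding test_fun_def by (metis pd_iter.simps(1))

lemma pd_iter_append: "pd_iter (xs @ ys) f = pd_iter xs (pd_iter ys f)"
  by (induction xs) auto

lemma test_fun_pd:
  assumes \<phi>: "test_fun \<phi>"
  shows "test_fun (pd i \<phi>)"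
proof -
  obtain R where R: "\<And>x. \<phi> x \<noteq> 0 \<Longrightarrow> norm x \<le> R"
    using \<phi> by (auto simp: test_fun_def bounded_iff)
  have "norm x \<le> R" if "pd i \<phi> x \<noteq> 0" for x
  proof (rule ccontr)
    assume "\<not> norm x \<le> R"
    then have "x \<in> - cball 0 R" by simp
    \<comment> \<open>The function vanishes on the open complement of the ball, so differentiation
      does not enlarge the support.\<close>
    have "(\<phi> has_derivative (\<lambda>h. 0)) (at x)"
      by (rule has_derivative_transform_within_open[of "\<lambda>x. 0" _ _ _ "- cball 0 R"])
        (use \<open>x \<in> - cball 0 R\<close> R in \<open>auto simp: not_le[symmetric]\<close>)
    from pd_eq[OF this] that show False by simp
  qed
  then have "bounded {x. pd i \<phi> x \<noteq> 0}" by (auto simp: bounded_iff)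
  moreover have "pd_iter ds (pd i \<phi>) differentiable (at x)" for ds x
  proof -
    have "pd_iter ds (pd i \<phi>) = pd_iter (ds @ [i]) \<phi>" by (simp add: pd_iter_append)
    then show ?thesis using \<phi> by (simp only: test_fun_def)
  qed
  ultimately show ?thesis by (simp add: test_fun_def)
qed

lemma pd_reflect:
  assumes "f differentiable (at (a - y))"
  shows "pd i (\<lambda>y. f (a - y)) y = - pd i f (a - y)"
proof -
  from assms obtain D where D: "(f has_derivative D) (at (a - y))" by (auto simp: differentiable_def)
  have "((\<lambda>y. a - y) has_derivative (\<lambda>h. - h)) (at y)" by (auto intro!: derivative_eq_intros)
  from has_derivative_compose[OF this, of f D] D
  have "((\<lambda>y. f (a - y)) has_derivative (\<lambda>h. D (- h))) (at y)" by simp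
  from pd_eq[OF this] pd_eq[OF D] show ?thesis
    by (simp add: linear_neg[OF has_derivative_linear[OF D]])
qed

lemma pd_cmult:
  assumes "f differentiable (at x)"
  shows "pd i (\<lambda>y. c * f y) x = c * pd i f x"
proof -
  from assms obtain D where D: "(f has_derivative D) (at x)" by (auto simp: differentiable_def)
  from pd_eq[OF has_derivative_mult_right[OF D]] pd_eq[OF D] show ?thesis by simp
qed

lemma test_fun_reflect:
  assumes \<phi>: "test_fun \<phi>"
  shows "test_fun (\<lambda>y. \<phi> (a - y))"
proof -
  \<comment> \<open>Each derivative of the reflection contributes a factor -1, so all iterates are
    explicit.\<close>
  have it: "pd_iter ds (\<lambda>y. \<phi> (a - y)) = (\<lambda>y. (-1) ^ length ds * pd_iter ds \<phi> (a - y))" for ds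
  proof (induction ds)
    case (Cons i ds)
    have d: "pd_iter ds \<phi> differentiable (at z)" for z using \<phi> by (simp add: test_fun_def)
    have "(\<lambda>y. a - y) differentiable (at y)" for y by (auto intro!: derivative_intros)
    then have d': "(\<lambda>y. pd_iter ds \<phi> (a - y)) differentiable (at y)" for y
      by (rule differentiable_compose[rotated]) (rule d)
    show ?case
      by (simp add: Cons.IH fun_eq_iff pd_cmult[OF d'] pd_reflect[OF d])
  qed simp
  have "(\<lambda>y. pd_iter ds \<phi> (a - y)) differentiable (at y)" for ds y
    by (rule differentiable_compose) (use \<phi> in \<open>auto intro!: derivative_intros simp: test_fun_def\<close>)
  then have "pd_iter ds (\<lambda>y. \<phi> (a - y)) differentiable (at y)" for ds y
    unfolding it by (intro differentiable_mult differentiable_const)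
  moreover have "bounded {y. \<phi> (a - y) \<noteq> 0}"
  proof -
    obtain R where R: "\<And>x. \<phi> x \<noteq> 0 \<Longrightarrow> norm x \<le> R"
      using \<phi> by (auto simp: test_fun_def bounded_iff)
    have "norm y \<le> norm a + R" if "\<phi> (a - y) \<noteq> 0" for y
      using R[OF that] norm_triangle_ineq4[of a "a - y"] by simp
    then show ?thesis by (auto simp: bounded_iff)
  qed
  ultimately show ?thesis by (simp add: test_fun_def)
qed

lemma test_fun_translate:
  assumes "test_fun \<phi>"
  shows "test_fun (\<lambda>y. \<phi> (y - a))"
  using test_fun_reflect[OF test_fun_reflect[OF assms, of 0], of a] by simp

lemma pd_translate:
  assumes "f differentiable (at (y - a))"
  shows "pd i (\<lambda>y. f (y - a)) y = pd i f (y - a)"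
proof -
  from assms obtain D where D: "(f has_derivative D) (at (y - a))" by (auto simp: differentiable_def)
  have "((\<lambda>y. y - a) has_derivative (\<lambda>h. h)) (at y)" by (auto intro!: derivative_eq_intros)
  from has_derivative_compose[OF this, of f D] D
  have "((\<lambda>y. f (y - a)) has_derivative D) (at y)" by simp
  from pd_eq[OF this] pd_eq[OF D] show ?thesis by simp
qed

lemma test_fun_has_derivative:
  assumes "test_fun \<phi>"
  shows "(\<phi> has_derivative (\<lambda>h. \<Sum>i\<in>UNIV. h $ i * pd i \<phi> x)) (at x)"
proof -
  from test_fun_differentiable[OF assms, of x] obtain D where
    D: "(\<phi> has_derivative D) (at x)" by (auto simp: differentiable_def)
  have "D h = (\<Sum>i\<in>UNIV. h $ i * pd i \<phi> x)" for h
  proof -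
    have "D h = D (\<Sum>i\<in>UNIV. h $ i *\<^sub>R axis i 1)"
      using basis_expansion[of h] by (simp add: scalar_mult_eq_scaleR)
    also have "\<dots> = (\<Sum>i\<in>UNIV. h $ i * D (axis i 1))"
      using has_derivative_linear[OF D] by (simp add: linear_sum linear_scale)
    finally show ?thesis by (simp add: pd_eq[OF D])
  qed
  then have "D = (\<lambda>h. \<Sum>i\<in>UNIV. h $ i * pd i \<phi> x)" by auto
  then show ?thesis using D by simp
qed

lemma test_fun_continuous: "test_fun \<phi> \<Longrightarrow> continuous_on S \<phi>"
  by (intro continuous_at_imp_continuous_on ballI differentiable_imp_continuous_within test_fun_differentiable)

lemma test_fun_measurable [measurable_dest]: "test_fun \<phi> \<Longrightarrow> \<phi> \<in> borel_measurable borel"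
  by (intro borel_measurable_continuous_onI test_fun_continuous)

lemma test_fun_bounded:
  assumes \<phi>: "test_fun \<phi>"
  obtains B R where "0 \<le> B" "\<And>x. \<bar>\<phi> x\<bar> \<le> B * indicator (cball 0 R) x"
proof -
  obtain R where R: "\<And>x. \<phi> x \<noteq> 0 \<Longrightarrow> norm x \<le> R"
    using \<phi> by (auto simp: test_fun_def bounded_iff)
  have "compact (\<phi> ` cball 0 R)"
    by (intro compact_continuous_image test_fun_continuous \<phi> compact_cball)
  then obtain B where "\<forall>y\<in>\<phi> ` cball 0 R. norm y \<le> B"
    by (auto dest!: compact_imp_bounded simp: bounded_iff)
  then have B: "\<And>x. x \<in> cball 0 R \<Longrightarrow> \<bar>\<phi> x\<bar> \<le> B" by auto
  show ?thesis
  proof (rule that[of "\<bar>B\<bar>" R])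
    show "\<bar>\<phi> x\<bar> \<le> \<bar>B\<bar> * indicator (cball 0 R) x" for x
      using R[of x] B[of x] by (cases "\<phi> x = 0") (auto simp: indicator_def)
  qed simp
qed

lemma integrable_indicator_cball [simp]:
  "integrable lborel (indicator (cball (a::'a::euclidean_space) R) :: _ \<Rightarrow> real)"
  by (rule integrable_real_indicator[OF _ emeasure_lborel_cball_finite]) simp

lemma test_fun_integrable:
  assumes \<phi>: "test_fun \<phi>"
  shows "integrable lborel \<phi>"
proof -
  obtain B R where B: "0 \<le> B" "\<And>x. \<bar>\<phi> x\<bar> \<le> B * indicator (cball 0 R) x"
    by (rule test_fun_bounded[OF \<phi>]) blast
  show ?thesis
  proof (rule Bochner_Integration.integrable_bound)
    show "integrable lborel (\<lambda>x. B * indicator (cball 0 R) x)" by simp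
    show "AE x in lborel. norm (\<phi> x) \<le> norm (B * indicator (cball 0 R) x :: real)"
      using B by simp
  qed (use \<phi> in measurable)
qed

lemma integrable_mult_bounded:
  fixes K c :: "'a \<Rightarrow> real"
  assumes K: "integrable M K" and c: "c \<in> borel_measurable M" "\<And>z. \<bar>c z\<bar> \<le> B"
  shows "integrable M (\<lambda>z. K z * c z)"
proof (rule Bochner_Integration.integrable_bound)
  show "integrable M (\<lambda>z. B * K z)" using K by simp
  have "\<bar>K z\<bar> * \<bar>c z\<bar> \<le> \<bar>B\<bar> * \<bar>K z\<bar>" for z
    using mult_left_mono[of "\<bar>c z\<bar>" "\<bar>B\<bar>" "\<bar>K z\<bar>"] c(2)[of z] by (simp add: mult.commute)
  then show "AE z in M. norm (K z * c z) \<le> norm (B * K z)" by (simp add: abs_mult)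
qed (use K c in measurable)

lemma unit_bump_exists:
  assumes "0 < e"
  obtains \<phi> :: "real^'n::finite \<Rightarrow> real" where "test_fun \<phi>" "\<And>x. 0 \<le> \<phi> x" "(\<integral>x. \<phi> x \<partial>lborel) = 1"
    "\<And>x. e \<le> norm x \<Longrightarrow> \<phi> x = 0"
proof -
  define b :: "real^'n \<Rightarrow> real" where "b = (\<lambda>x. flat_exp 0 (e\<^sup>2 - x \<bullet> x))"
  have nonneg: "0 \<le> b x" for x by (simp add: b_def flat_exp_def)
  have zero: "b x = 0" if "e \<le> norm x" for x
    using power_mono[OF that, of 2] assms by (simp add: b_def flat_exp_def power2_norm_eq_inner)
  have bdd: "bounded {x. c * b x \<noteq> 0}" for c
    by (rule bounded_subset[OF bounded_cball[of 0 e]]) (use zero in \<open>force simp: not_le[symmetric]\<close>)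
  have alg: "bump_algebra e (\<lambda>x. c * b x)" for c
    unfolding b_def by (intro bump_algebra.intros)
  have tf: "test_fun (\<lambda>x. c * b x)" for c
    by (rule bump_algebra_test_fun[OF alg bdd])
  have tb: "test_fun b" using tf[of 1] by simp
  have pos: "0 < (\<integral>x. b x \<partial>lborel)"
  proof -
    have ne: "(\<integral>x. b x \<partial>lborel) \<noteq> 0"
    proof
      assume "(\<integral>x. b x \<partial>lborel) = 0"
      then have "AE x in lborel. b x = 0"
        using integral_nonneg_eq_0_iff_AE[OF test_fun_integrable[OF tb]] nonneg by simp
      moreover have "b x \<noteq> 0" if "x \<in> ball 0 e" for x
      proof -
        have "norm x ^ 2 < e ^ 2" using that by (intro power_strict_mono) auto
        then show ?thesis by (simp add: b_def flat_exp_def power2_norm_eq_inner)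
      qed
      ultimately have "AE x in lborel. x \<notin> ball (0::real^'n) e"
        by (auto elim: eventually_mono)
      then have "ball (0::real^'n) e \<in> null_sets lborel"
        by (subst AE_iff_null_sets) auto
      then show False
        using content_ball_pos[OF assms, of "0::real^'n"] by (simp add: measure_eq_0_null_sets)
    qed
    then show ?thesis using Bochner_Integration.integral_nonneg[of lborel b] nonneg by (simp add: less_le)
  qed
  show ?thesis
  proof (rule that[of "\<lambda>x. (1 / (\<integral>x. b x \<partial>lborel)) * b x"])
    show "test_fun (\<lambda>x. 1 / integral\<^sup>L lborel b * b x)" by (rule tf)
    show "0 \<le> 1 / integral\<^sup>L lborel b * b x" for x using pos nonneg by simp
    show "(\<integral>x. 1 / integral\<^sup>L lborel b * b x \<partial>lborel) = 1" using pos by simp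
    show "1 / integral\<^sup>L lborel b * b x = 0" if "e \<le> norm x" for x using zero[OF that] by simp
  qed
qed

text \<open>Recovers c 0 from integrals against test functions: the bump is supported where c
  differs from c 0 by less than e, so it is chosen for the given c and e.\<close>

lemma approximate_identity:
  fixes c :: "real^'n::finite \<Rightarrow> real"
  assumes c: "continuous_on UNIV c" and bdd: "\<And>z. \<bar>c z\<bar> \<le> B" and e: "0 < e"
  obtains \<phi> :: "real^'n::finite \<Rightarrow> real" where "test_fun \<phi>" "\<And>x. 0 \<le> \<phi> x" "(\<integral>x. \<phi> x \<partial>lborel) = 1"
    "\<bar>(\<integral>z. \<phi> z * c z \<partial>lborel) - c 0\<bar> \<le> e"
proof -
  have "isCont c 0" using c by (simp add: continuous_on_eq_continuous_at)
  then obtain d where d: "0 < d" "\<And>z. norm z < d \<Longrightarrow> \<bar>c z - c 0\<bar> < e"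
    using e by (auto simp: continuous_at_eps_delta dist_norm)
  obtain \<phi> :: "real^'n \<Rightarrow> real" where \<phi>: "test_fun \<phi>" "\<And>x. 0 \<le> \<phi> x" "(\<integral>x. \<phi> x \<partial>lborel) = 1"
    "\<And>x. d \<le> norm x \<Longrightarrow> \<phi> x = 0" by (rule unit_bump_exists[OF d(1)]) blast
  have [measurable]: "c \<in> borel_measurable borel" using c by (rule borel_measurable_continuous_onI)
  note int\<phi> = test_fun_integrable[OF \<phi>(1)]
  have int: "integrable lborel (\<lambda>z. \<phi> z * c z)"
    by (rule integrable_mult_bounded[OF int\<phi> _ bdd]) simp
  have int2: "integrable lborel (\<lambda>z. \<phi> z * (c z - c 0))"
    using int int\<phi> by (simp add: right_diff_distrib)
  have "(\<integral>z. \<phi> z * (c z - c 0) \<partial>lborel) = (\<integral>z. \<phi> z * c z \<partial>lborel) - c 0"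
    using int int\<phi> \<phi>(3) by (simp add: right_diff_distrib)
  moreover have "\<bar>\<integral>z. \<phi> z * (c z - c 0) \<partial>lborel\<bar> \<le> (\<integral>z. \<bar>\<phi> z * (c z - c 0)\<bar> \<partial>lborel)"
    by (rule integral_abs_bound)
  moreover have "(\<integral>z. \<bar>\<phi> z * (c z - c 0)\<bar> \<partial>lborel) \<le> (\<integral>z. e * \<phi> z \<partial>lborel)"
  proof (rule integral_mono)
    show "\<bar>\<phi> z * (c z - c 0)\<bar> \<le> e * \<phi> z" for z
    proof (cases "norm z < d")
      case True
      then show ?thesis using d(2)[of z] \<phi>(2)[of z] mult_right_mono[of "\<bar>c z - c 0\<bar>" e "\<phi> z"]
        by (simp add: abs_mult mult.commute)
    qed (simp add: \<phi>(4))
  qed (use int2 int\<phi> in auto)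
  ultimately have "\<bar>(\<integral>z. \<phi> z * c z \<partial>lborel) - c 0\<bar> \<le> e" using \<phi>(3) by simp
  then show ?thesis using that[OF \<phi>(1-3)] by blast
qed

text \<open>Two signs cancel: y enters \<phi> (x - y) with a minus sign, and the weak derivative of
  g brings another.\<close>

lemma correlation_ibp_right:
  assumes \<phi>: "test_fun \<phi>" and f: "inL2 f" and g: "inL2 g" and H: "inL2 H" and w: "weak_pd i g H"
  shows "(\<integral>z. pd i \<phi> z * correlation f g z \<partial>lborel) = (\<integral>z. \<phi> z * correlation f H z \<partial>lborel)"
proof -
  have "(\<integral>y. g y * pd i \<phi> (x - y) \<partial>lborel) = (\<integral>y. H y * \<phi> (x - y) \<partial>lborel)" for x
    using w test_fun_reflect[OF \<phi>, of x]
    by (auto simp: weak_pd_def pd_reflect[OF test_fun_differentiable[OF \<phi>]])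
  then show ?thesis
    by (simp add: integral_mult_correlation(1)[OF test_fun_integrable[OF test_fun_pd[OF \<phi>]] f g]
        integral_mult_correlation(1)[OF test_fun_integrable[OF \<phi>] f H])
qed

text \<open>Here x enters \<phi> (x - y) with a plus sign, so the sign of the weak derivative
  survives.\<close>

lemma correlation_ibp_left:
  assumes \<phi>: "test_fun \<phi>" and f: "inL2 f" and g: "inL2 g" and H: "inL2 H" and w: "weak_pd i f H"
  shows "(\<integral>z. pd i \<phi> z * correlation f g z \<partial>lborel) = - (\<integral>z. \<phi> z * correlation H g z \<partial>lborel)"
proof -
  have "(\<integral>x. f x * pd i \<phi> (x - y) \<partial>lborel) = - (\<integral>x. H x * \<phi> (x - y) \<partial>lborel)" for y
    using w test_fun_translate[OF \<phi>, of y]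
    by (auto simp: weak_pd_def pd_translate[OF test_fun_differentiable[OF \<phi>]])
  then show ?thesis
    by (simp add: integral_mult_correlation(2)[OF test_fun_integrable[OF test_fun_pd[OF \<phi>]] f g]
        integral_mult_correlation(2)[OF test_fun_integrable[OF \<phi>] H g])
qed

lemma integrable_convolution_pairing:
  fixes K f g :: "real^'n::finite \<Rightarrow> real"
  assumes K: "integrable lborel K" and f: "inL2 f" and g: "inL2 g"
  shows "integrable lborel (\<lambda>x. f x * (\<integral>y. g y * K (x - y) \<partial>lborel))"
proof -
  have "(\<integral>z. K z * (f x * g (x - z)) \<partial>lborel) = f x * (\<integral>y. g y * K (x - y) \<partial>lborel)" for x
    using lborel_integral_reflect[of "\<lambda>z. K z * (f x * g (x - z))" x, symmetric]
    by (simp add: mult_ac)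
  then show ?thesis
    using lborel_pair.integrable_snd[OF integrable_correlation_kernel[OF K f g]] by simp
qed

lemma test_fun_Lipschitz:
  fixes \<phi> :: "real^'n::finite \<Rightarrow> real"
  assumes \<phi>: "test_fun \<phi>"
  obtains L where "0 \<le> L" "\<And>x y. \<bar>\<phi> x - \<phi> y\<bar> \<le> L * norm (x - y)"
proof -
  have "\<exists>B. 0 \<le> B \<and> (\<forall>x. \<bar>pd i \<phi> x\<bar> \<le> B)" for i
  proof -
    obtain B R where B: "0 \<le> B" "\<And>x. \<bar>pd i \<phi> x\<bar> \<le> B * indicator (cball 0 R) x"
      by (rule test_fun_bounded[OF test_fun_pd[OF \<phi>]]) blast
    have "\<bar>pd i \<phi> x\<bar> \<le> B" for x
      using B(2)[of x] B(1) by (cases "x \<in> cball 0 R") simp_all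
    then show ?thesis using B(1) by blast
  qed
  then obtain B where B: "\<And>i. 0 \<le> B i" "\<And>i x. \<bar>pd i \<phi> x\<bar> \<le> B i" by metis
  have on: "onorm (\<lambda>h. \<Sum>i\<in>UNIV. h $ i * pd i \<phi> x) \<le> (\<Sum>i\<in>UNIV. B i)" for x
  proof (rule onorm_le)
    fix h :: "real^'n"
    have "norm (\<Sum>i\<in>UNIV. h $ i * pd i \<phi> x) \<le> (\<Sum>i\<in>UNIV. \<bar>h $ i * pd i \<phi> x\<bar>)"
      by (simp add: sum_abs)
    also have "\<dots> \<le> (\<Sum>i\<in>UNIV. B i * norm h)"
    proof (rule sum_mono)
      fix i
      show "\<bar>h $ i * pd i \<phi> x\<bar> \<le> B i * norm h"
        using mult_mono[OF component_le_norm_cart[of h i] B(2)[of i x]] by (simp add: abs_mult mult.commute)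
    qed
    finally show "norm (\<Sum>i\<in>UNIV. h $ i * pd i \<phi> x) \<le> (\<Sum>i\<in>UNIV. B i) * norm h"
      by (simp add: sum_distrib_right)
  qed
  show ?thesis
  proof (rule that)
    show "0 \<le> (\<Sum>i\<in>UNIV. B i)" by (intro sum_nonneg B)
    show "\<bar>\<phi> x - \<phi> y\<bar> \<le> (\<Sum>i\<in>UNIV. B i) * norm (x - y)" for x y
      using differentiable_bound[OF convex_UNIV test_fun_has_derivative[OF \<phi>] on, of x y] by simp
  qed
qed

text \<open>Only the test function moves. Its difference quotients are dominated by a Lipschitz
  constant on a fixed ball, so boundedness and measurability of c are enough to differentiate under
  the integral.\<close>

lemma DERIV_integral_translate_test_fun:
  fixes \<phi> c :: "real^'n::finite \<Rightarrow> real"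
  assumes \<phi>: "test_fun \<phi>" and [measurable]: "c \<in> borel_measurable borel" and bdd: "\<And>z. \<bar>c z\<bar> \<le> B"
  shows "((\<lambda>\<theta>. \<integral>z. \<phi> (z - \<theta> *\<^sub>R \<zeta>) * c z \<partial>lborel) has_field_derivative
      (\<integral>z. - (\<Sum>i\<in>UNIV. \<zeta> $ i * pd i \<phi> (z - \<theta> *\<^sub>R \<zeta>)) * c z \<partial>lborel)) (at \<theta>)"
  unfolding DERIV_def tendsto_at_iff_sequentially
proof (intro allI impI)
  fix X :: "nat \<Rightarrow> real" assume "\<forall>i. X i \<in> UNIV - {0}" and X: "X \<longlonglongrightarrow> 0"
  then have X0: "X n \<noteq> 0" for n by auto
  obtain M where M: "\<And>n. \<bar>X n\<bar> \<le> M"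
    using convergent_imp_Bseq[of X] X by (auto simp: convergent_def Bseq_def)
  obtain L where L: "0 \<le> L" "\<And>x y. \<bar>\<phi> x - \<phi> y\<bar> \<le> L * norm (x - y)"
    by (rule test_fun_Lipschitz[OF \<phi>]) blast
  obtain A R where A: "0 \<le> A" "\<And>x. \<bar>\<phi> x\<bar> \<le> A * indicator (cball 0 R) x"
    by (rule test_fun_bounded[OF \<phi>]) blast
  let ?q = "\<lambda>n z. (\<phi> (z - (\<theta> + X n) *\<^sub>R \<zeta>) - \<phi> (z - \<theta> *\<^sub>R \<zeta>)) / X n"
  \<comment> \<open>The sequence is bounded by M, so this ball contains the supports of all
    translates that occur.\<close>
  let ?R = "R + (\<bar>\<theta>\<bar> + M) * norm \<zeta>"
  have [measurable]: "\<phi> \<in> borel_measurable borel" "\<And>i. pd i \<phi> \<in> borel_measurable borel"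
    using \<phi> test_fun_pd by (auto intro: test_fun_measurable)
  have int: "integrable lborel (\<lambda>z. \<phi> (z - a) * c z)" for a
    by (rule integrable_mult_bounded[OF test_fun_integrable[OF test_fun_translate[OF \<phi>]] _ bdd]) simp
  have eq: "((\<integral>z. \<phi> (z - (\<theta> + X n) *\<^sub>R \<zeta>) * c z \<partial>lborel) - (\<integral>z. \<phi> (z - \<theta> *\<^sub>R \<zeta>) * c z \<partial>lborel)) / X n
      = (\<integral>z. ?q n z * c z \<partial>lborel)" for n
    using int by (simp add: left_diff_distrib diff_divide_distrib)
  have "(\<lambda>n. \<integral>z. ?q n z * c z \<partial>lborel) \<longlonglongrightarrow> (\<integral>z. - (\<Sum>i\<in>UNIV. \<zeta> $ i * pd i \<phi> (z - \<theta> *\<^sub>R \<zeta>)) * c z \<partial>lborel)"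
  proof (rule integral_dominated_convergence[where w="\<lambda>z. (L * norm \<zeta> * \<bar>B\<bar>) * indicator (cball 0 ?R) z"])
    show "integrable lborel (\<lambda>z. (L * norm \<zeta> * \<bar>B\<bar>) * indicator (cball 0 ?R) z :: real)" by simp
    show "AE z in lborel. (\<lambda>n. ?q n z * c z) \<longlonglongrightarrow> - (\<Sum>i\<in>UNIV. \<zeta> $ i * pd i \<phi> (z - \<theta> *\<^sub>R \<zeta>)) * c z"
    proof (rule AE_I2, intro tendsto_mult tendsto_const)
      fix z
      have "((\<lambda>s. z - s *\<^sub>R \<zeta>) has_derivative (\<lambda>s. - (s *\<^sub>R \<zeta>))) (at \<theta>)"
        by (auto intro!: derivative_eq_intros)
      from has_derivative_compose[OF this test_fun_has_derivative[OF \<phi>]]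
      have "((\<lambda>s. \<phi> (z - s *\<^sub>R \<zeta>)) has_derivative
          (\<lambda>s. \<Sum>i\<in>UNIV. (- (s *\<^sub>R \<zeta>)) $ i * pd i \<phi> (z - \<theta> *\<^sub>R \<zeta>))) (at \<theta>)" .
      moreover have "(\<lambda>s. \<Sum>i\<in>UNIV. (- (s *\<^sub>R \<zeta>)) $ i * pd i \<phi> (z - \<theta> *\<^sub>R \<zeta>))
          = (*) (- (\<Sum>i\<in>UNIV. \<zeta> $ i * pd i \<phi> (z - \<theta> *\<^sub>R \<zeta>)))"
        by (rule ext) (simp add: sum_distrib_left sum_negf mult_ac)
      ultimately have "((\<lambda>s. \<phi> (z - s *\<^sub>R \<zeta>)) has_field_derivative - (\<Sum>i\<in>UNIV. \<zeta> $ i * pd i \<phi> (z - \<theta> *\<^sub>R \<zeta>))) (at \<theta>)"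
        by (simp only: has_field_derivative_def)
      then have "((\<lambda>h. (\<phi> (z - (\<theta> + h) *\<^sub>R \<zeta>) - \<phi> (z - \<theta> *\<^sub>R \<zeta>)) / h) \<longlongrightarrow> - (\<Sum>i\<in>UNIV. \<zeta> $ i * pd i \<phi> (z - \<theta> *\<^sub>R \<zeta>))) (at 0)"
        by (simp add: DERIV_def)
      moreover have "filterlim X (at 0) sequentially"
        using X X0 by (simp add: filterlim_at)
      ultimately show "(\<lambda>n. ?q n z) \<longlonglongrightarrow> - (\<Sum>i\<in>UNIV. \<zeta> $ i * pd i \<phi> (z - \<theta> *\<^sub>R \<zeta>))"
        by (rule filterlim_compose)
    qed
    show "AE z in lborel. norm (?q n z * c z) \<le> (L * norm \<zeta> * \<bar>B\<bar>) * indicator (cball 0 ?R) z" for n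
    proof (rule AE_I2)
      fix z
      show "norm (?q n z * c z) \<le> (L * norm \<zeta> * \<bar>B\<bar>) * indicator (cball 0 ?R) z"
      proof (cases "z \<in> cball 0 ?R")
        case True
        have "\<bar>\<phi> (z - (\<theta> + X n) *\<^sub>R \<zeta>) - \<phi> (z - \<theta> *\<^sub>R \<zeta>)\<bar> \<le> L * norm ((z - (\<theta> + X n) *\<^sub>R \<zeta>) - (z - \<theta> *\<^sub>R \<zeta>))"
          by (rule L)
        also have "(z - (\<theta> + X n) *\<^sub>R \<zeta>) - (z - \<theta> *\<^sub>R \<zeta>) = - (X n *\<^sub>R \<zeta>)"
          by (simp add: algebra_simps)
        finally have "\<bar>?q n z\<bar> \<le> L * norm \<zeta>"
          using X0[of n] by (simp add: field_simps abs_mult)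
        moreover have "\<bar>c z\<bar> \<le> \<bar>B\<bar>" using bdd[of z] by simp
        ultimately have "\<bar>?q n z\<bar> * \<bar>c z\<bar> \<le> (L * norm \<zeta>) * \<bar>B\<bar>"
          using L(1) by (intro mult_mono) auto
        then show ?thesis using True by (simp only: abs_mult real_norm_def indicator_simps mult_1_right)
      next
        case False
        have zero: "\<phi> (z - t *\<^sub>R \<zeta>) = 0" if "\<bar>t\<bar> \<le> \<bar>\<theta>\<bar> + M" for t
        proof -
          have "norm z \<le> norm (z - t *\<^sub>R \<zeta>) + \<bar>t\<bar> * norm \<zeta>"
            using norm_triangle_ineq[of "z - t *\<^sub>R \<zeta>" "t *\<^sub>R \<zeta>"] by simp
          moreover have "\<bar>t\<bar> * norm \<zeta> \<le> (\<bar>\<theta>\<bar> + M) * norm \<zeta>"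
            by (rule mult_right_mono[OF that]) simp
          ultimately have "z - t *\<^sub>R \<zeta> \<notin> cball 0 R" using False by simp
          then show ?thesis using A(2)[of "z - t *\<^sub>R \<zeta>"] by simp
        qed
        have "\<bar>\<theta> + X n\<bar> \<le> \<bar>\<theta>\<bar> + M" "\<bar>\<theta>\<bar> \<le> \<bar>\<theta>\<bar> + M"
          using M[of n] by linarith+
        then show ?thesis using zero False by simp
      qed
    qed
  qed measurable
  then show "((\<lambda>h. ((\<integral>z. \<phi> (z - (\<theta> + h) *\<^sub>R \<zeta>) * c z \<partial>lborel) - (\<integral>z. \<phi> (z - \<theta> *\<^sub>R \<zeta>) * c z \<partial>lborel)) / h) \<circ> X)
     \<longlonglongrightarrow> (\<integral>z. - (\<Sum>i\<in>UNIV. \<zeta> $ i * pd i \<phi> (z - \<theta> *\<^sub>R \<zeta>)) * c z \<partial>lborel)"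
    by (simp add: comp_def eq)
qed

text \<open>The hypothesis \<open>ibp\<close> says that -d is the weak gradient of c. Averaging the
  increment of c with a bump and moving the shift to the bump gives a path of translated bumps; its
  speed is at most the stated sum, because the bump has mass 1.\<close>

lemma bounded_weak_gradient_Lipschitz:
  fixes c :: "real^'n::finite \<Rightarrow> real" and d :: "'n \<Rightarrow> real^'n \<Rightarrow> real"
  assumes c: "continuous_on UNIV c" "\<And>z. \<bar>c z\<bar> \<le> B"
    and d: "\<And>i. d i \<in> borel_measurable borel" "\<And>i z. \<bar>d i z\<bar> \<le> M i"
    and ibp: "\<And>\<phi> i. test_fun \<phi> \<Longrightarrow> (\<integral>z. pd i \<phi> z * c z \<partial>lborel) = (\<integral>z. \<phi> z * d i z \<partial>lborel)"
  shows "\<bar>c \<zeta> - c 0\<bar> \<le> (\<Sum>i\<in>UNIV. \<bar>\<zeta> $ i\<bar> * M i)"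
proof (rule field_le_epsilon)
  fix e :: real assume e: "0 < e"
  have [measurable]: "c \<in> borel_measurable borel" by (rule borel_measurable_continuous_onI[OF c(1)])
  have cont: "continuous_on UNIV (\<lambda>z. c (z + \<zeta>) - c z)"
    using c(1) by (intro continuous_intros continuous_on_compose2[OF c(1)]) auto
  have "\<bar>c (z + \<zeta>) - c z\<bar> \<le> 2 * B" for z using c(2)[of z] c(2)[of "z + \<zeta>"] by linarith
  from approximate_identity[OF cont this e] obtain \<phi> :: "real^'n \<Rightarrow> real" where
    \<phi>: "test_fun \<phi>" "\<And>x. 0 \<le> \<phi> x" "(\<integral>x. \<phi> x \<partial>lborel) = 1"
    and ai: "\<bar>(\<integral>z. \<phi> z * (c (z + \<zeta>) - c z) \<partial>lborel) - (c (0 + \<zeta>) - c 0)\<bar> \<le> e" by blast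
  \<comment> \<open>The path leads from the average of c at \<theta> = 0 to the average of c shifted
    by \<zeta> at \<theta> = 1.\<close>
  define k where "k \<theta> = (\<integral>z. \<phi> (z - \<theta> *\<^sub>R \<zeta>) * c z \<partial>lborel)" for \<theta>
  define k' where "k' \<theta> = (\<integral>z. - (\<Sum>i\<in>UNIV. \<zeta> $ i * pd i \<phi> (z - \<theta> *\<^sub>R \<zeta>)) * c z \<partial>lborel)" for \<theta>
  have k: "(k has_field_derivative k' \<theta>) (at \<theta> within UNIV)" for \<theta>
    unfolding k_def[abs_def] k'_def
    using DERIV_integral_translate_test_fun[OF \<phi>(1) _ c(2)] by simp
  have k'_le: "norm (k' \<theta>) \<le> (\<Sum>i\<in>UNIV. \<bar>\<zeta> $ i\<bar> * M i)" for \<theta>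
  proof -
    let ?a = "\<theta> *\<^sub>R \<zeta>"
    have tf: "test_fun (\<lambda>z. \<phi> (z - ?a))" by (rule test_fun_translate[OF \<phi>(1)])
    have tp: "pd i (\<lambda>z. \<phi> (z - ?a)) z = pd i \<phi> (z - ?a)" for i z
      by (rule pd_translate[OF test_fun_differentiable[OF \<phi>(1)]])
    have int: "integrable lborel (\<lambda>z. pd i \<phi> (z - ?a) * c z)" for i
      by (rule integrable_mult_bounded[OF test_fun_integrable[OF test_fun_translate[OF test_fun_pd[OF \<phi>(1)]]] _ c(2)]) simp
    have int\<phi>: "integrable lborel (\<lambda>z. \<phi> (z - ?a))" by (rule test_fun_integrable[OF tf])
    have intd: "integrable lborel (\<lambda>z. \<phi> (z - ?a) * d i z)" for i
      by (rule integrable_mult_bounded[OF int\<phi> _ d(2)]) (use d(1) in simp)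
    have "k' \<theta> = - (\<Sum>i\<in>UNIV. \<zeta> $ i * (\<integral>z. pd i \<phi> (z - ?a) * c z \<partial>lborel))"
      unfolding k'_def using int by (simp add: sum_distrib_right mult.assoc)
    also have "\<dots> = - (\<Sum>i\<in>UNIV. \<zeta> $ i * (\<integral>z. \<phi> (z - ?a) * d i z \<partial>lborel))"
      using ibp[OF tf] by (simp add: tp)
    finally have "norm (k' \<theta>) \<le> (\<Sum>i\<in>UNIV. \<bar>\<zeta> $ i\<bar> * \<bar>\<integral>z. \<phi> (z - ?a) * d i z \<partial>lborel\<bar>)"
      using sum_abs[of "\<lambda>i. \<zeta> $ i * (\<integral>z. \<phi> (z - ?a) * d i z \<partial>lborel)" UNIV] by (simp add: abs_mult)
    also have "\<dots> \<le> (\<Sum>i\<in>UNIV. \<bar>\<zeta> $ i\<bar> * M i)"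
    proof (intro sum_mono mult_left_mono)
      fix i
      have int_abs: "integrable lborel (\<lambda>z. \<bar>\<phi> (z - ?a) * d i z\<bar>)"
        using intd by (rule integrable_abs)
      have "\<bar>\<integral>z. \<phi> (z - ?a) * d i z \<partial>lborel\<bar> \<le> (\<integral>z. \<bar>\<phi> (z - ?a) * d i z\<bar> \<partial>lborel)"
        by (rule integral_abs_bound)
      also have "\<dots> \<le> (\<integral>z. \<phi> (z - ?a) * M i \<partial>lborel)"
        by (rule integral_mono[OF int_abs]) (use int\<phi> d(2) \<phi>(2) in \<open>auto simp: abs_mult intro!: mult_left_mono\<close>)
      also have "\<dots> = M i" using \<phi>(3) lborel_integral_translate_diff[of \<phi> ?a] by simp
      finally show "\<bar>\<integral>z. \<phi> (z - ?a) * d i z \<partial>lborel\<bar> \<le> M i" .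
    qed simp
    finally show ?thesis .
  qed
  have int: "integrable lborel (\<lambda>z. \<phi> z * c (z + a))" for a
    by (rule integrable_mult_bounded[OF test_fun_integrable[OF \<phi>(1)] _ c(2)]) simp
  have "k 1 = (\<integral>z. \<phi> z * c (z + \<zeta>) \<partial>lborel)"
    unfolding k_def using lborel_integral_translate[of "\<lambda>z. \<phi> (z - 1 *\<^sub>R \<zeta>) * c z" \<zeta>, symmetric] by simp
  moreover have "k 0 = (\<integral>z. \<phi> z * c z \<partial>lborel)" by (simp add: k_def)
  ultimately have "(\<integral>z. \<phi> z * (c (z + \<zeta>) - c z) \<partial>lborel) = k 1 - k 0"
    using int[of \<zeta>] int[of 0] by (simp add: right_diff_distrib)
  moreover have "\<bar>k 1 - k 0\<bar> \<le> (\<Sum>i\<in>UNIV. \<bar>\<zeta> $ i\<bar> * M i)"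
    using field_differentiable_bound[OF convex_UNIV k k'_le, of 1 0] by simp
  ultimately show "\<bar>c \<zeta> - c 0\<bar> \<le> (\<Sum>i\<in>UNIV. \<bar>\<zeta> $ i\<bar> * M i) + e"
    using ai by simp
qed

lemma correlation_Lipschitz:
  fixes f g :: "real^'n::finite \<Rightarrow> real"
  assumes f: "inL2 f" and g: "inL2 g" and H: "\<And>i. inL2 (H i)" "\<And>i. weak_pd i g (H i)"
  shows "\<bar>correlation f g z - l2inner f g\<bar> \<le> norm z * (l2norm f * (\<Sum>i\<in>UNIV. l2norm (H i)))"
proof -
  have "\<bar>correlation f g z - correlation f g 0\<bar> \<le> (\<Sum>i\<in>UNIV. \<bar>z $ i\<bar> * (l2norm f * l2norm (H i)))"
  proof (rule bounded_weak_gradient_Lipschitz)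
    show "continuous_on UNIV (correlation f g)" by (rule continuous_correlation[OF f g])
    show "\<bar>correlation f g z\<bar> \<le> l2norm f * l2norm g" for z by (rule correlation_le[OF f g])
    show "correlation f (H i) \<in> borel_measurable borel" for i by (rule measurable_correlation[OF f H(1)])
    show "\<bar>correlation f (H i) z\<bar> \<le> l2norm f * l2norm (H i)" for i z by (rule correlation_le[OF f H(1)])
  qed (rule correlation_ibp_right[OF _ f g H])
  also have "\<dots> \<le> (\<Sum>i\<in>UNIV. norm z * (l2norm f * l2norm (H i)))"
    by (intro sum_mono mult_right_mono component_le_norm_cart) simp
  finally show ?thesis by (simp add: sum_distrib_left)
qed

text \<open>Extends the weak equation for v from smooth test functions to g with weak gradient H.
  The difference c of the two sides, taken as correlations in z, integrates to 0 against every test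
  function; being continuous, it vanishes at z = 0.\<close>

lemma weak_divergence_pairing:
  fixes v g :: "real^'n::finite \<Rightarrow> real"
  assumes v: "inL2 v" and F: "\<And>j. inL2 (F j)"
    and eq: "\<And>\<phi>. test_fun \<phi> \<Longrightarrow> (\<integral>x. v x * \<phi> x \<partial>lborel) = (\<Sum>j\<in>UNIV. \<integral>x. F j x * pd j \<phi> x \<partial>lborel)"
    and g: "inL2 g" and H: "\<And>j. inL2 (H j)" "\<And>j. weak_pd j g (H j)"
  shows "l2inner v g = (\<Sum>j\<in>UNIV. l2inner (F j) (H j))"
proof -
  define c where "c z = correlation g v z - (\<Sum>j\<in>UNIV. correlation (H j) (F j) z)" for z
  have cont: "continuous_on UNIV c"
    unfolding c_def[abs_def] by (intro continuous_intros continuous_correlation g v H F)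
  have bdd: "\<bar>c z\<bar> \<le> l2norm g * l2norm v + (\<Sum>j\<in>UNIV. l2norm (H j) * l2norm (F j))" for z
  proof -
    have "\<bar>\<Sum>j\<in>UNIV. correlation (H j) (F j) z\<bar> \<le> (\<Sum>j\<in>UNIV. l2norm (H j) * l2norm (F j))"
      by (rule order_trans[OF sum_abs]) (intro sum_mono correlation_le H F)
    then show ?thesis using correlation_le[OF g v, of z] unfolding c_def by linarith
  qed
  have zero: "(\<integral>z. \<phi> z * c z \<partial>lborel) = 0" if \<phi>: "test_fun \<phi>" for \<phi>
  proof -
    note i\<phi> = test_fun_integrable[OF \<phi>] and ip = test_fun_integrable[OF test_fun_pd[OF \<phi>]]
    \<comment> \<open>The equation is tested with the reflected bump, and the reflection produces
      the minus sign.\<close>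
    have inner: "(\<integral>y. v y * \<phi> (x - y) \<partial>lborel) = (\<Sum>j\<in>UNIV. - (\<integral>y. F j y * pd j \<phi> (x - y) \<partial>lborel))" for x
      using eq[OF test_fun_reflect[OF \<phi>, of x]]
      by (simp add: pd_reflect[OF test_fun_differentiable[OF \<phi>]])
    have "(\<integral>z. \<phi> z * correlation g v z \<partial>lborel)
        = (\<integral>x. (\<Sum>j\<in>UNIV. - (g x * (\<integral>y. F j y * pd j \<phi> (x - y) \<partial>lborel))) \<partial>lborel)"
      unfolding integral_mult_correlation(1)[OF i\<phi> g v] inner by (simp add: sum_distrib_left)
    also have "\<dots> = (\<Sum>j\<in>UNIV. - (\<integral>x. g x * (\<integral>y. F j y * pd j \<phi> (x - y) \<partial>lborel) \<partial>lborel))"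
      by (subst Bochner_Integration.integral_sum) (auto intro: integrable_convolution_pairing[OF ip g F])
    also have "\<dots> = (\<Sum>j\<in>UNIV. - (\<integral>z. pd j \<phi> z * correlation g (F j) z \<partial>lborel))"
      by (simp add: integral_mult_correlation(1)[OF ip g F])
    also have "\<dots> = (\<Sum>j\<in>UNIV. \<integral>z. \<phi> z * correlation (H j) (F j) z \<partial>lborel)"
      by (simp add: correlation_ibp_left[OF \<phi> g F H])
    finally show ?thesis
      using integrable_mult_correlation[OF i\<phi> g v] integrable_mult_correlation[OF i\<phi> H(1) F]
      by (simp add: c_def right_diff_distrib sum_distrib_left)
  qed
  have "\<bar>c 0\<bar> \<le> 0"
  proof (rule field_le_epsilon)
    fix e :: real assume "0 < e"
    from approximate_identity[OF cont bdd this] obtain \<phi> :: "real^'n \<Rightarrow> real" where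
      "test_fun \<phi>" "\<bar>(\<integral>z. \<phi> z * c z \<partial>lborel) - c 0\<bar> \<le> e" by blast
    then show "\<bar>c 0\<bar> \<le> 0 + e" using zero by simp
  qed
  then show ?thesis
    by (simp add: c_def l2inner_commute)
qed

section \<open>Heat kernel and negative Sobolev norms\<close>

lemma measurable_cis [measurable]: "cis \<in> borel_measurable borel"
  by (intro borel_measurable_continuous_onI continuous_intros)

section \<open>Gaussian integrals and their Fourier transforms\<close>

lemma integrable_gaussian_real:
  assumes "0 < r"
  shows "integrable lborel (\<lambda>x::real. exp (- (r * x\<^sup>2)))"
proof -
  have "integrable lborel (\<lambda>x. sqrt (pi / r) * normal_density 0 (1 / sqrt (2 * r)) x)"
    using assms by (intro integrable_mult_right integrable_normal_density) simp
  moreover have "sqrt (pi / r) * normal_density 0 (1 / sqrt (2 * r)) x = exp (- (r * x\<^sup>2))" for x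
    using assms by (simp add: normal_density_def power_divide real_sqrt_divide field_simps)
  ultimately show ?thesis by simp
qed

lemma gaussian_fourier_real:
  assumes r: "0 < r"
  shows "(\<integral>x. complex_of_real (exp (- (r * x\<^sup>2))) * cis (- (w * x)) \<partial>lborel)
     = complex_of_real (sqrt (pi / r) * exp (- (w\<^sup>2 / (4 * r))))"
proof -
  \<comment> \<open>The scale with r * (c * x)^2 = x^2 / 2; the formula becomes the characteristic
    function of the standard normal law.\<close>
  define c where "c = 1 / sqrt (2 * r)"
  have c: "0 < c" "c\<^sup>2 = 1 / (2 * r)" using r by (auto simp: c_def power_divide)
  have "char std_normal_distribution t = (\<integral>x. std_normal_density x *\<^sub>R iexp (t * x) \<partial>lborel)" for t
    unfolding char_def by (subst integral_density) auto
  note char_eq = this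
  have std: "(\<integral>x. std_normal_density x *\<^sub>R iexp (t * x) \<partial>lborel) = complex_of_real (exp (- t\<^sup>2 / 2))" for t
    by (rule trans[OF char_eq[symmetric] fun_cong[OF char_std_normal_distribution]])
  let ?h = "\<lambda>x. complex_of_real (exp (- (r * x\<^sup>2))) * cis (- (w * x))"
  have "(\<integral>x. ?h x \<partial>lborel) = c *\<^sub>R (\<integral>x. ?h (0 + c * x) \<partial>lborel)"
    using lborel_integral_real_affine[of c ?h 0] c by simp
  also have "(\<lambda>x. ?h (0 + c * x)) = (\<lambda>x. sqrt (2 * pi) *\<^sub>R (std_normal_density x *\<^sub>R iexp ((- w * c) * x)))"
  proof
    fix x
    have "r * (c * x)\<^sup>2 = x\<^sup>2 / 2" using c r by (simp add: power_mult_distrib)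
    then show "?h (0 + c * x) = sqrt (2 * pi) *\<^sub>R (std_normal_density x *\<^sub>R iexp ((- w * c) * x))"
      by (simp add: std_normal_density_def cis_conv_exp scaleR_conv_of_real mult.assoc)
  qed
  also have "c *\<^sub>R (\<integral>x. sqrt (2 * pi) *\<^sub>R (std_normal_density x *\<^sub>R iexp ((- w * c) * x)) \<partial>lborel)
      = complex_of_real (c * sqrt (2 * pi) * exp (- (- w * c)\<^sup>2 / 2))"
    unfolding integral_scaleR_right std by (simp add: scaleR_conv_of_real)
  also have "c * sqrt (2 * pi) = sqrt (pi / r)"
    using r by (simp add: c_def real_sqrt_divide real_sqrt_mult)
  also have "- (- w * c)\<^sup>2 / 2 = - (w\<^sup>2 / (4 * r))"
    using c by (simp add: power_mult_distrib)
  finally show ?thesis .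
qed

lemma norm_square_Basis: "(norm (x::'a::euclidean_space))\<^sup>2 = (\<Sum>b\<in>Basis. (x \<bullet> b)\<^sup>2)"
  unfolding power2_norm_eq_inner by (subst euclidean_inner) (simp add: power2_eq_square)

interpretation lborel_prod: product_sigma_finite "\<lambda>_::'a::euclidean_space. lborel :: real measure"
  by unfold_locales

lemma integral_lborel_prod_Basis:
  fixes f :: "'a::euclidean_space \<Rightarrow> real \<Rightarrow> 'b::{real_normed_field, banach, second_countable_topology}"
  assumes f: "\<And>b. b \<in> Basis \<Longrightarrow> integrable lborel (f b)"
  shows "(\<integral>x. (\<Prod>b\<in>Basis. f b (x \<bullet> b)) \<partial>(lborel :: 'a measure)) = (\<Prod>b\<in>Basis. \<integral>x. f b x \<partial>lborel)"
    and "integrable (lborel :: 'a measure) (\<lambda>x. \<Prod>b\<in>Basis. f b (x \<bullet> b))"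
proof -
  have m: "(\<lambda>x::'a. \<Prod>b\<in>Basis. f b (x \<bullet> b)) \<in> borel_measurable borel"
  proof (rule borel_measurable_prod)
    fix b :: 'a assume "b \<in> Basis"
    then have [measurable]: "f b \<in> borel_measurable borel" using f by (auto dest: borel_measurable_integrable)
    show "(\<lambda>x::'a. f b (x \<bullet> b)) \<in> borel_measurable borel" by measurable
  qed
  have t: "(\<lambda>g. \<Sum>b\<in>Basis. g b *\<^sub>R b) \<in> (\<Pi>\<^sub>M b\<in>(Basis::'a set). lborel :: real measure) \<rightarrow>\<^sub>M borel"
    by measurable
  have eq: "(\<Prod>b\<in>Basis. f b ((\<Sum>b\<in>Basis. g b *\<^sub>R b) \<bullet> b)) = (\<Prod>b\<in>(Basis::'a set). f b (g b))" for g
    by (rule prod.cong) (auto simp: inner_sum_left inner_Basis if_distrib cong: if_cong)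
  show "(\<integral>x. (\<Prod>b\<in>Basis. f b (x \<bullet> b)) \<partial>(lborel :: 'a measure)) = (\<Prod>b\<in>Basis. \<integral>x. f b x \<partial>lborel)"
    by (subst lborel_eq, subst integral_distr[OF t m], subst eq)
      (rule lborel_prod.product_integral_prod[OF finite_Basis f])
  show "integrable (lborel :: 'a measure) (\<lambda>x. \<Prod>b\<in>Basis. f b (x \<bullet> b))"
    by (subst lborel_eq, subst integrable_distr_eq[OF t m], subst eq)
      (rule lborel_prod.product_integrable_prod[OF finite_Basis f])
qed

lemma gaussian_prod:
  "exp (- (r * (norm (x::'a::euclidean_space))\<^sup>2)) = (\<Prod>b\<in>Basis. exp (- (r * (x \<bullet> b)\<^sup>2)))"
  by (simp add: norm_square_Basis exp_sum[symmetric] sum_distrib_left sum_negf)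

lemma integrable_gaussian:
  assumes "0 < r"
  shows "integrable lborel (\<lambda>x::'a::euclidean_space. exp (- (r * (norm x)\<^sup>2)))"
  unfolding gaussian_prod
  by (rule integral_lborel_prod_Basis(2)) (rule integrable_gaussian_real[OF assms])

lemma gaussian_fourier:
  fixes w :: "'a::euclidean_space"
  assumes r: "0 < r"
  shows "(\<integral>x. complex_of_real (exp (- (r * (norm x)\<^sup>2))) * cis (- (w \<bullet> x)) \<partial>lborel)
     = complex_of_real (sqrt (pi / r) ^ DIM('a) * exp (- ((norm w)\<^sup>2 / (4 * r))))"
proof -
  let ?f = "\<lambda>b x. complex_of_real (exp (- (r * x\<^sup>2))) * cis (- ((w \<bullet> b) * x))"
  have "cis (- (w \<bullet> x)) = (\<Prod>b\<in>Basis. cis (- ((w \<bullet> b) * (x \<bullet> b))))" for x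
    by (subst euclidean_inner) (simp add: cis_conv_exp exp_sum[symmetric] sum_distrib_left sum_negf)
  then have eq: "complex_of_real (exp (- (r * (norm x)\<^sup>2))) * cis (- (w \<bullet> x)) = (\<Prod>b\<in>Basis. ?f b (x \<bullet> b))" for x
    by (simp add: gaussian_prod prod.distrib)
  have int: "integrable lborel (?f b)" for b
    by (rule Bochner_Integration.integrable_bound[OF integrable_gaussian_real[OF r]])
      (auto simp: norm_mult)
  have "exp (- ((norm w)\<^sup>2 / (4 * r))) = (\<Prod>b\<in>Basis. exp (- ((w \<bullet> b)\<^sup>2 / (4 * r))))"
    using gaussian_prod[of "1 / (4 * r)" w] by simp
  then show ?thesis
    unfolding eq
    by (subst integral_lborel_prod_Basis(1)[OF int], subst gaussian_fourier_real[OF r])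
      (simp add: prod.distrib)
qed

text \<open>The kernel of exp (r * Laplacian): it has mass 1 and its Fourier multiplier is exp (- r
  |xi|^2).\<close>

definition heat_kernel :: "real \<Rightarrow> real^'n::finite \<Rightarrow> real" where
  "heat_kernel r z = (1 / sqrt (4 * pi * r)) ^ CARD('n) * exp (- ((norm z)\<^sup>2 / (4 * r)))"

lemma heat_kernel_nonneg: "0 < r \<Longrightarrow> 0 \<le> heat_kernel r z"
  by (simp add: heat_kernel_def)

lemma heat_kernel_integrable: "0 < r \<Longrightarrow> integrable lborel (heat_kernel r :: real^'n::finite \<Rightarrow> real)"
  unfolding heat_kernel_def[abs_def]
  using integrable_gaussian[of "1 / (4 * r)"] by simp

lemma heat_kernel_integral:
  assumes "0 < r"
  shows "(\<integral>z. heat_kernel r z \<partial>(lborel :: (real^'n::finite) measure)) = 1"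
proof -
  have "complex_of_real (\<integral>z. exp (- ((norm z)\<^sup>2 / (4 * r))) \<partial>(lborel :: (real^'n) measure))
     = complex_of_real (sqrt (4 * pi * r) ^ CARD('n))"
    using gaussian_fourier[of "1 / (4 * r)" "0 :: real^'n"] assms by (simp add: mult_ac)
  then have "(\<integral>z. exp (- ((norm z)\<^sup>2 / (4 * r))) \<partial>(lborel :: (real^'n) measure)) = sqrt (4 * pi * r) ^ CARD('n)"
    by (simp only: of_real_eq_iff)
  then show ?thesis
    using assms by (simp add: heat_kernel_def power_divide)
qed

text \<open>Half of the Gaussian decay pays for the factor norm z: by x \<le> 2 * exp (x^2 / 8) the
  product is at most a multiple of the kernel at time 2 * r, which has mass 1. The power of sqrt 2
  is the ratio of the two normalisations.\<close>

lemma heat_kernel_first_moment: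
  assumes r: "0 < r"
  shows "integrable lborel (\<lambda>z::real^'n::finite. norm z * heat_kernel r z)"
    and "(\<integral>z. norm z * heat_kernel r z \<partial>(lborel :: (real^'n) measure)) \<le> 2 * sqrt 2 ^ CARD('n) * sqrt r"
proof -
  let ?C = "2 * sqrt 2 ^ CARD('n) * sqrt r"
  have le: "norm z * heat_kernel r z \<le> ?C * heat_kernel (2 * r) z" for z :: "real^'n"
  proof -
    define x where "x = norm z / sqrt r"
    have "0 \<le> (x / 2 - 1)\<^sup>2" by simp
    then have "x \<le> 2 * (1 + x\<^sup>2 / 8)" by (simp add: power2_eq_square field_simps)
    also have "\<dots> \<le> 2 * exp (x\<^sup>2 / 8)" by (intro mult_left_mono exp_ge_add_one_self) simp
    finally have x: "norm z \<le> sqrt r * (2 * exp (x\<^sup>2 / 8))"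
      using r by (simp add: x_def field_simps)
    have "norm z * exp (- ((norm z)\<^sup>2 / (4 * r))) \<le> sqrt r * (2 * exp (x\<^sup>2 / 8)) * exp (- ((norm z)\<^sup>2 / (4 * r)))"
      by (rule mult_right_mono[OF x]) simp
    also have "\<dots> = 2 * sqrt r * exp (x\<^sup>2 / 8 - (norm z)\<^sup>2 / (4 * r))"
      using exp_add[of "x\<^sup>2 / 8" "- ((norm z)\<^sup>2 / (4 * r))"] by simp
    also have "x\<^sup>2 / 8 - (norm z)\<^sup>2 / (4 * r) = - ((norm z)\<^sup>2 / (4 * (2 * r)))"
      using r by (simp add: x_def power_divide field_simps)
    finally have "norm z * exp (- ((norm z)\<^sup>2 / (4 * r))) \<le> 2 * sqrt r * exp (- ((norm z)\<^sup>2 / (4 * (2 * r))))" .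
    then have "(1 / sqrt (4 * pi * r)) ^ CARD('n) * (norm z * exp (- ((norm z)\<^sup>2 / (4 * r))))
       \<le> (1 / sqrt (4 * pi * r)) ^ CARD('n) * (2 * sqrt r * exp (- ((norm z)\<^sup>2 / (4 * (2 * r)))))"
      using r by (intro mult_left_mono) auto
    then have le: "norm z * heat_kernel r z
       \<le> (1 / sqrt (4 * pi * r)) ^ CARD('n) * (2 * sqrt r * exp (- ((norm z)\<^sup>2 / (4 * (2 * r)))))"
      unfolding heat_kernel_def by (simp only: mult.left_commute)
    have "sqrt (4 * pi * (2 * r)) = sqrt 2 * sqrt (4 * pi * r)"
      using real_sqrt_mult[of 2 "4 * pi * r"] by (simp add: mult_ac)
    then have "sqrt 2 * (1 / sqrt (4 * pi * (2 * r))) = 1 / sqrt (4 * pi * r)" by simp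
    then have c: "sqrt 2 ^ CARD('n) * (1 / sqrt (4 * pi * (2 * r))) ^ CARD('n) = (1 / sqrt (4 * pi * r)) ^ CARD('n)"
      by (simp only: power_mult_distrib[symmetric])
    have "?C * heat_kernel (2 * r) z
       = (1 / sqrt (4 * pi * r)) ^ CARD('n) * (2 * sqrt r * exp (- ((norm z)\<^sup>2 / (4 * (2 * r)))))"
      unfolding heat_kernel_def c[symmetric] by (simp only: mult_ac)
    then show ?thesis using le by (simp only:)
  qed
  have int: "integrable lborel (\<lambda>z. ?C * heat_kernel (2 * r) (z :: real^'n))"
    using heat_kernel_integrable[of "2 * r"] r by simp
  show 1: "integrable lborel (\<lambda>z::real^'n. norm z * heat_kernel r z)"
  proof (rule Bochner_Integration.integrable_bound[OF int])
    have [measurable]: "heat_kernel r \<in> borel_measurable (borel :: (real^'n) measure)"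
      using heat_kernel_integrable[OF r] by auto
    show "(\<lambda>z::real^'n. norm z * heat_kernel r z) \<in> borel_measurable lborel" by simp
    show "AE z in lborel. norm (norm z * heat_kernel r z) \<le> norm (?C * heat_kernel (2 * r) (z :: real^'n))"
    proof (rule AE_I2)
      fix z :: "real^'n"
      have "0 \<le> norm z * heat_kernel r z" by (intro mult_nonneg_nonneg norm_ge_zero heat_kernel_nonneg r)
      then show "norm (norm z * heat_kernel r z) \<le> norm (?C * heat_kernel (2 * r) z)"
        using le[of z] unfolding real_norm_def by linarith
    qed
  qed
  have "(\<integral>z. norm z * heat_kernel r z \<partial>(lborel :: (real^'n) measure)) \<le> (\<integral>z. ?C * heat_kernel (2 * r) (z :: real^'n) \<partial>lborel)"
    by (rule integral_mono[OF 1 int le])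
  then show "(\<integral>z. norm z * heat_kernel r z \<partial>(lborel :: (real^'n) measure)) \<le> ?C"
    using heat_kernel_integral[of "2 * r", where 'n='n] r by simp
qed

text \<open>The integral of \<open>fourier_trunc\<close> freed from its cutoff, so that it can be
  applied to differences of truncations.\<close>

definition fourier_L1 :: "(real^'n::finite \<Rightarrow> real) \<Rightarrow> real^'n \<Rightarrow> complex" where
  "fourier_L1 f \<xi> = complex_of_real ((2 * pi) powr (- real CARD('n) / 2)) *
     (\<integral>x. complex_of_real (f x) * cis (- (x \<bullet> \<xi>)) \<partial>lborel)"

lemma fourier_trunc_eq: "fourier_trunc R f = fourier_L1 (\<lambda>x. indicator (cball 0 R) x * f x)"
  by (simp add: fun_eq_iff fourier_trunc_def fourier_L1_def)

lemma integrable_cis_mult: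
  assumes "integrable M (f :: 'a \<Rightarrow> complex)" "p \<in> borel_measurable M"
  shows "integrable M (\<lambda>x. f x * cis (p x))"
proof (rule Bochner_Integration.integrable_bound[OF assms(1)])
  show "(\<lambda>x. f x * cis (p x)) \<in> borel_measurable M"
    using assms by measurable
qed (simp add: norm_mult)

lemma integrable_tensor_cis:
  fixes a b :: "real^'n::finite \<Rightarrow> complex"
  assumes a: "integrable lborel a" and b: "integrable lborel b"
    and [measurable]: "(\<lambda>(x, y). p x y) \<in> borel_measurable (borel \<Otimes>\<^sub>M borel)"
  shows "integrable (lborel \<Otimes>\<^sub>M lborel) (\<lambda>(x, y). a x * (b y * cis (p x y)))"
proof (rule lborel_pair.Fubini_integrable)
  have [measurable]: "a \<in> borel_measurable borel" "b \<in> borel_measurable borel"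
    using a b by auto
  show "(\<lambda>(x, y). a x * (b y * cis (p x y))) \<in> borel_measurable (lborel \<Otimes>\<^sub>M lborel)"
    by measurable
  show "integrable lborel (\<lambda>x. \<integral>y. norm (case (x, y) of (x, y) \<Rightarrow> a x * (b y * cis (p x y))) \<partial>lborel)"
    using a b by (simp add: norm_mult)
  show "AE x in lborel. integrable lborel (\<lambda>y. case (x, y) of (x, y) \<Rightarrow> a x * (b y * cis (p x y)))"
    by (intro AE_I2, unfold prod.case, intro integrable_mult_right integrable_cis_mult b) measurable
qed

text \<open>A Plancherel identity made absolutely convergent by the Gaussian weight, so that Fubini
  applies; the transform of the weight is the heat kernel. It transfers positivity to the kernel
  side and size bounds to the Fourier side.\<close>

lemma gaussian_weighted_fourier:
  fixes f :: "real^'n::finite \<Rightarrow> real"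
  assumes f: "inL2 f" and f1: "integrable lborel f" and r: "0 < r"
  shows "integrable lborel (\<lambda>\<xi>. exp (- (r * (norm \<xi>)\<^sup>2)) * (cmod (fourier_L1 f \<xi>))\<^sup>2)"
    and "(\<integral>\<xi>. exp (- (r * (norm \<xi>)\<^sup>2)) * (cmod (fourier_L1 f \<xi>))\<^sup>2 \<partial>lborel)
      = (\<integral>z. heat_kernel r z * correlation f f z \<partial>lborel)"
proof -
  define F where "F \<xi> = (\<integral>x. complex_of_real (f x) * cis (- (x \<bullet> \<xi>)) \<partial>lborel)" for \<xi> :: "real^'n"
  define g where "g \<xi> = complex_of_real (exp (- (r * (norm \<xi>)\<^sup>2)))" for \<xi> :: "real^'n"
  define G where "G w = sqrt (pi / r) ^ CARD('n) * exp (- ((norm w)\<^sup>2 / (4 * r)))" for w :: "real^'n"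
  have [measurable]: "f \<in> borel_measurable borel" using f1 by auto
  have g: "integrable lborel g" unfolding g_def[abs_def]
    by (intro integrable_of_real integrable_gaussian r)
  have [measurable]: "g \<in> borel_measurable borel" using g by auto
  have fc: "integrable lborel (\<lambda>x. complex_of_real (f x))" using f1 by simp
  have [measurable]: "F \<in> borel_measurable borel" unfolding F_def[abs_def] by measurable
  have Fb: "cmod (F \<xi>) \<le> (\<integral>x. \<bar>f x\<bar> \<partial>lborel)" for \<xi>
    unfolding F_def
    by (rule order_trans[OF integral_norm_bound]) (simp add: norm_mult)
  have gF: "integrable lborel (\<lambda>\<xi>. g \<xi> * F \<xi>)"
  proof (rule Bochner_Integration.integrable_bound)
    show "integrable lborel (\<lambda>\<xi>. (\<integral>x. \<bar>f x\<bar> \<partial>lborel) *\<^sub>R g \<xi>)" using g by simp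
    show "AE \<xi> in lborel. norm (g \<xi> * F \<xi>) \<le> norm ((\<integral>x. \<bar>f x\<bar> \<partial>lborel) *\<^sub>R g \<xi>)"
      using mult_right_mono[OF Fb, of "cmod (g _)"] by (simp add: norm_mult mult.commute)
  qed measurable
  have inner: "(\<integral>\<xi>. g \<xi> * F \<xi> * cis (y \<bullet> \<xi>) \<partial>lborel) = (\<integral>x. complex_of_real (f x * G (x - y)) \<partial>lborel)" for y
  proof -
    have "(\<integral>\<xi>. g \<xi> * F \<xi> * cis (y \<bullet> \<xi>) \<partial>lborel)
        = (\<integral>\<xi>. \<integral>x. g \<xi> * (complex_of_real (f x) * cis (- ((x - y) \<bullet> \<xi>))) \<partial>lborel \<partial>lborel)"
    proof (rule Bochner_Integration.integral_cong[OF refl])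
      fix \<xi> :: "real^'n"
      have "g \<xi> * F \<xi> * cis (y \<bullet> \<xi>) = (\<integral>x. g \<xi> * (complex_of_real (f x) * cis (- (x \<bullet> \<xi>))) * cis (y \<bullet> \<xi>) \<partial>lborel)"
        unfolding F_def by simp
      also have "\<dots> = (\<integral>x. g \<xi> * (complex_of_real (f x) * cis (- ((x - y) \<bullet> \<xi>))) \<partial>lborel)"
        by (rule Bochner_Integration.integral_cong[OF refl]) (simp add: cis_mult mult.assoc inner_diff_left)
      finally show "g \<xi> * F \<xi> * cis (y \<bullet> \<xi>) = \<dots>" .
    qed
    also have "\<dots> = (\<integral>x. \<integral>\<xi>. g \<xi> * (complex_of_real (f x) * cis (- ((x - y) \<bullet> \<xi>))) \<partial>lborel \<partial>lborel)"
      by (rule lborel_pair.Fubini_integral[symmetric], rule integrable_tensor_cis[OF g fc]) measurable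
    also have "\<dots> = (\<integral>x. complex_of_real (f x * G (x - y)) \<partial>lborel)"
    proof (rule Bochner_Integration.integral_cong[OF refl])
      fix x
      have "(\<integral>\<xi>. g \<xi> * (complex_of_real (f x) * cis (- ((x - y) \<bullet> \<xi>))) \<partial>lborel)
          = complex_of_real (f x) * (\<integral>\<xi>. g \<xi> * cis (- ((x - y) \<bullet> \<xi>)) \<partial>lborel)"
        unfolding integral_mult_right_zero[symmetric] by (simp only: mult_ac)
      also have "(\<integral>\<xi>. g \<xi> * cis (- ((x - y) \<bullet> \<xi>)) \<partial>lborel) = complex_of_real (G (x - y))"
        unfolding g_def G_def using gaussian_fourier[OF r, of "x - y"] by simp
      finally show "(\<integral>\<xi>. g \<xi> * (complex_of_real (f x) * cis (- ((x - y) \<bullet> \<xi>))) \<partial>lborel)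
          = complex_of_real (f x * G (x - y))" by simp
    qed
    finally show ?thesis .
  qed
  have cnjF: "cnj (F \<xi>) = (\<integral>y. complex_of_real (f y) * cis (y \<bullet> \<xi>) \<partial>lborel)" for \<xi>
  proof -
    have "cnj (F \<xi>) = (\<integral>x. cnj (complex_of_real (f x) * cis (- (x \<bullet> \<xi>))) \<partial>lborel)"
      unfolding F_def by (rule Bochner_Integration.integral_cnj[symmetric])
    then show ?thesis by (simp add: cis_cnj)
  qed
  have sq: "complex_of_real (exp (- (r * (norm \<xi>)\<^sup>2)) * (cmod (F \<xi>))\<^sup>2) = g \<xi> * F \<xi> * cnj (F \<xi>)" for \<xi>
    by (simp add: g_def complex_norm_square mult.assoc del: of_real_power)
  have int: "integrable lborel (\<lambda>\<xi>. exp (- (r * (norm \<xi>)\<^sup>2)) * (cmod (F \<xi>))\<^sup>2)"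
  proof (rule integrable_mult_bounded)
    show "integrable lborel (\<lambda>\<xi>::real^'n. exp (- (r * (norm \<xi>)\<^sup>2)))" by (rule integrable_gaussian[OF r])
    show "\<bar>(cmod (F \<xi>))\<^sup>2\<bar> \<le> (\<integral>x. \<bar>f x\<bar> \<partial>lborel)\<^sup>2" for \<xi>
      using power_mono[OF Fb, of \<xi> 2] by simp
  qed measurable
  have "complex_of_real (\<integral>\<xi>. exp (- (r * (norm \<xi>)\<^sup>2)) * (cmod (F \<xi>))\<^sup>2 \<partial>lborel)
      = (\<integral>\<xi>. g \<xi> * F \<xi> * cnj (F \<xi>) \<partial>lborel)"
    by (subst integral_complex_of_real[symmetric]) (simp only: sq)
  also have "\<dots> = (\<integral>\<xi>. \<integral>y. (g \<xi> * F \<xi>) * (complex_of_real (f y) * cis (y \<bullet> \<xi>)) \<partial>lborel \<partial>lborel)"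
    unfolding cnjF integral_mult_right_zero[symmetric] ..
  also have "\<dots> = (\<integral>y. \<integral>\<xi>. (g \<xi> * F \<xi>) * (complex_of_real (f y) * cis (y \<bullet> \<xi>)) \<partial>lborel \<partial>lborel)"
    by (rule lborel_pair.Fubini_integral[symmetric], rule integrable_tensor_cis[OF gF fc]) measurable
  also have "\<dots> = (\<integral>y. complex_of_real (f y) * (\<integral>\<xi>. g \<xi> * F \<xi> * cis (y \<bullet> \<xi>) \<partial>lborel) \<partial>lborel)"
    unfolding integral_mult_right_zero[symmetric] by (simp only: mult_ac)
  also have "\<dots> = complex_of_real (\<integral>y. f y * (\<integral>x. f x * G (x - y) \<partial>lborel) \<partial>lborel)"
    unfolding inner integral_complex_of_real of_real_mult[symmetric] by (rule refl)
  finally have FG: "(\<integral>\<xi>. exp (- (r * (norm \<xi>)\<^sup>2)) * (cmod (F \<xi>))\<^sup>2 \<partial>lborel)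
      = (\<integral>y. f y * (\<integral>x. f x * G (x - y) \<partial>lborel) \<partial>lborel)"
    by (simp only: of_real_eq_iff)
  \<comment> \<open>The squared unitary factor (2 pi)^(-n); multiplied by (pi / r)^(n / 2) it gives
    the normalisation (4 pi r)^(-n / 2) of the heat kernel.\<close>
  define C where "C = ((2 * pi) powr (- real CARD('n) / 2))\<^sup>2"
  have C: "C = (1 / (2 * pi)) ^ CARD('n)"
  proof -
    have "C = (2 * pi) powr (- real CARD('n))"
      by (simp add: C_def power2_eq_square powr_add[symmetric])
    then show ?thesis by (simp add: powr_minus powr_realpow power_divide field_simps)
  qed
  have FL: "(cmod (fourier_L1 f \<xi>))\<^sup>2 = C * (cmod (F \<xi>))\<^sup>2" for \<xi>
    by (simp add: fourier_L1_def F_def C_def norm_mult power_mult_distrib)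
  have CG: "C * G w = heat_kernel r w" for w
  proof -
    have "sqrt (4 * pi * r) * sqrt (pi / r) = sqrt ((2 * pi)\<^sup>2)"
      unfolding real_sqrt_mult[symmetric] using r by (simp add: power2_eq_square)
    moreover have "sqrt ((2 * pi)\<^sup>2) = 2 * pi" unfolding real_sqrt_abs by simp
    ultimately have "sqrt (4 * pi * r) * sqrt (pi / r) = 2 * pi" by (simp only:)
    then have "1 / (2 * pi) * sqrt (pi / r) = 1 / sqrt (4 * pi * r)"
      using r by (simp add: field_simps)
    then have "(1 / (2 * pi)) ^ CARD('n) * sqrt (pi / r) ^ CARD('n) = (1 / sqrt (4 * pi * r)) ^ CARD('n)"
      by (simp only: power_mult_distrib[symmetric])
    then show ?thesis by (simp add: C G_def heat_kernel_def flip: mult.assoc)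
  qed
  show "integrable lborel (\<lambda>\<xi>. exp (- (r * (norm \<xi>)\<^sup>2)) * (cmod (fourier_L1 f \<xi>))\<^sup>2)"
    unfolding FL using integrable_mult_right[OF int, of C] by (simp add: mult_ac)
  have "(\<integral>\<xi>. exp (- (r * (norm \<xi>)\<^sup>2)) * (cmod (fourier_L1 f \<xi>))\<^sup>2 \<partial>lborel)
      = C * (\<integral>\<xi>. exp (- (r * (norm \<xi>)\<^sup>2)) * (cmod (F \<xi>))\<^sup>2 \<partial>lborel)"
    unfolding FL integral_mult_right_zero[symmetric] by (simp only: mult_ac)
  also have "\<dots> = (\<integral>y. f y * (\<integral>x. f x * heat_kernel r (x - y) \<partial>lborel) \<partial>lborel)"
    unfolding FG CG[symmetric] integral_mult_right_zero[symmetric] by (simp only: mult_ac)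
  also have "\<dots> = (\<integral>z. heat_kernel r z * correlation f f z \<partial>lborel)"
    by (rule integral_mult_correlation(2)[OF heat_kernel_integrable[OF r] f f, symmetric])
  finally show "(\<integral>\<xi>. exp (- (r * (norm \<xi>)\<^sup>2)) * (cmod (fourier_L1 f \<xi>))\<^sup>2 \<partial>lborel) = \<dots>" .
qed

text \<open>The pairing of f with exp (r * Laplacian) g.\<close>

definition heat_form :: "real \<Rightarrow> (real^'n::finite \<Rightarrow> real) \<Rightarrow> (real^'n \<Rightarrow> real) \<Rightarrow> real" where
  "heat_form r f g = (\<integral>z. heat_kernel r z * correlation f g z \<partial>lborel)"

lemma heat_form_le:
  fixes f g :: "real^'n::finite \<Rightarrow> real"
  assumes "0 < r" "inL2 f" "inL2 g"
  shows "\<bar>heat_form r f g\<bar> \<le> l2norm f * l2norm g"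
proof -
  have "(\<integral>z. \<bar>heat_kernel r z\<bar> \<partial>(lborel :: (real^'n) measure)) = 1"
    using heat_kernel_integral[OF assms(1), where 'n='n] by (simp add: heat_kernel_nonneg[OF assms(1)])
  then show ?thesis
    using abs_integral_mult_correlation_le[OF heat_kernel_integrable[OF assms(1)] assms(2,3)]
    by (simp add: heat_form_def)
qed

lemma heat_form_add_left:
  assumes r: "0 < r" and "inL2 f" "inL2 g" "inL2 h"
  shows "heat_form r (\<lambda>x. f x + g x) h = heat_form r f h + heat_form r g h"
proof -
  have "correlation (\<lambda>x. f x + g x) h z = correlation f h z + correlation g h z" for z
    unfolding correlation_def by (intro l2inner_add_left assms inL2_translate)
  then show ?thesis
    using integrable_mult_correlation[OF heat_kernel_integrable[OF r] assms(2) assms(4)]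
      integrable_mult_correlation[OF heat_kernel_integrable[OF r] assms(3) assms(4)]
    by (simp add: heat_form_def distrib_left)
qed

lemma heat_form_cmult_left: "heat_form r (\<lambda>x. c * f x) h = c * heat_form r f h"
  by (simp add: heat_form_def correlation_def l2inner_cmult_left mult.left_commute)

lemma heat_form_commute: "heat_form r f g = heat_form r g f"
proof -
  have flip: "correlation f g (0 - z) = correlation g f z" for z
    using lborel_integral_translate[of "\<lambda>x. f (x - z) * g x" z]
    by (simp add: correlation_def l2inner_def mult.commute)
  have "heat_form r f g = (\<integral>z. heat_kernel r (0 - z) * correlation f g (0 - z) \<partial>lborel)"
    unfolding heat_form_def by (rule lborel_integral_reflect[symmetric])
  then show ?thesis unfolding flip by (simp add: heat_form_def heat_kernel_def)
qed

lemma heat_form_nonneg: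
  assumes "0 < r" "inL2 f" "integrable lborel f"
  shows "0 \<le> heat_form r f f"
  using gaussian_weighted_fourier(2)[OF assms(2,3,1), symmetric]
  unfolding heat_form_def by simp

lemma quadratic_nonneg_discriminant:
  fixes a b c :: real
  assumes "\<And>t. 0 \<le> a + 2 * t * b + t\<^sup>2 * c" "0 < c"
  shows "b\<^sup>2 \<le> a * c"
proof -
  have "a + 2 * (- b / c) * b + (- b / c)\<^sup>2 * c = a - b\<^sup>2 / c"
    using assms(2) by (simp add: power2_eq_square)
  then have "b\<^sup>2 / c \<le> a" using assms(1)[of "- b / c"] by linarith
  then show ?thesis using assms(2) by (simp add: pos_divide_le_eq)
qed

text \<open>Discriminant argument for the positive semidefinite heat form. The polynomial carries
  the squared norm of g in place of the form at g, which keeps its leading coefficient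
  positive.\<close>

lemma heat_form_Cauchy_Schwarz:
  fixes f g :: "real^'n::finite \<Rightarrow> real"
  assumes r: "0 < r" and f: "inL2 f" "integrable lborel f" and g: "inL2 g" "integrable lborel g"
  shows "\<bar>heat_form r f g\<bar> \<le> sqrt (heat_form r f f) * l2norm g"
proof (cases "l2norm g = 0")
  case True
  then show ?thesis using heat_form_le[OF r f(1) g(1)] by simp
next
  case False
  let ?a = "heat_form r f f" and ?b = "heat_form r f g" and ?C = "(l2norm g)\<^sup>2"
  have C: "0 < ?C" using False by simp
  have quad: "0 \<le> ?a + 2 * t * ?b + t\<^sup>2 * ?C" for t
  proof -
    note tg = inL2_cmult[OF g(1), of t]
    note ftg = inL2_add[OF f(1) tg]
    have "0 \<le> heat_form r (\<lambda>x. f x + t * g x) (\<lambda>x. f x + t * g x)"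
      by (rule heat_form_nonneg[OF r ftg]) (use f g in simp)
    also have "\<dots> = heat_form r f (\<lambda>x. f x + t * g x) + t * heat_form r g (\<lambda>x. f x + t * g x)"
      by (simp only: heat_form_add_left[OF r f(1) tg ftg] heat_form_cmult_left)
    also have "heat_form r f (\<lambda>x. f x + t * g x) = ?a + t * ?b"
      by (subst heat_form_commute, simp only: heat_form_add_left[OF r f(1) tg f(1)] heat_form_cmult_left)
        (simp add: heat_form_commute[of r g f])
    also have "heat_form r g (\<lambda>x. f x + t * g x) = ?b + t * heat_form r g g"
      by (subst heat_form_commute, simp only: heat_form_add_left[OF r f(1) tg g(1)] heat_form_cmult_left)
    finally have "0 \<le> ?a + 2 * t * ?b + t\<^sup>2 * heat_form r g g"
      by (simp add: algebra_simps power2_eq_square)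
    moreover have "t\<^sup>2 * heat_form r g g \<le> t\<^sup>2 * ?C"
      using heat_form_le[OF r g(1) g(1)] by (intro mult_left_mono) (auto simp: power2_eq_square)
    ultimately show ?thesis by linarith
  qed
  have "?b\<^sup>2 \<le> ?a * ?C"
    by (rule quadratic_nonneg_discriminant[OF quad C])
  then have "sqrt (?b\<^sup>2) \<le> sqrt (?a * ?C)" by (rule real_sqrt_le_mono)
  then show ?thesis by (simp add: real_sqrt_mult)
qed

text \<open>The kernel has mass 1 and a first moment of order sqrt r, while the correlation is
  Lipschitz at 0 because g has a weak gradient in L2.\<close>

lemma heat_form_first_order:
  fixes f g :: "real^'n::finite \<Rightarrow> real"
  assumes r: "0 < r" and f: "inL2 f" and g: "inL2 g" and H: "\<And>i. inL2 (H i)" "\<And>i. weak_pd i g (H i)"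
  shows "\<bar>heat_form r f g - l2inner f g\<bar>
    \<le> 2 * sqrt 2 ^ CARD('n) * sqrt r * (l2norm f * (\<Sum>i\<in>UNIV. l2norm (H i)))"
proof -
  let ?S = "l2norm f * (\<Sum>i\<in>UNIV. l2norm (H i))"
  note hk = heat_kernel_integrable[OF r, where 'n='n]
  note int = integrable_mult_correlation[OF hk f g]
  have S: "0 \<le> ?S" by (simp add: sum_nonneg)
  have int2: "integrable lborel (\<lambda>z. heat_kernel r z * (correlation f g z - l2inner f g))"
    using int hk by (simp add: right_diff_distrib)
  have "heat_form r f g - l2inner f g = (\<integral>z. heat_kernel r z * (correlation f g z - l2inner f g) \<partial>lborel)"
    using int hk heat_kernel_integral[OF r, where 'n='n] by (simp add: heat_form_def right_diff_distrib)
  also have "\<bar>\<dots>\<bar> \<le> (\<integral>z. \<bar>heat_kernel r z * (correlation f g z - l2inner f g)\<bar> \<partial>lborel)"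
    by (rule integral_abs_bound)
  also have "\<dots> \<le> (\<integral>z. (norm z * heat_kernel r (z :: real^'n)) * ?S \<partial>lborel)"
  proof (rule integral_mono)
    show "integrable lborel (\<lambda>z. \<bar>heat_kernel r z * (correlation f g z - l2inner f g)\<bar>)"
      using int2 by (rule integrable_abs)
    show "integrable lborel (\<lambda>z::real^'n. (norm z * heat_kernel r z) * ?S)"
      by (intro integrable_mult_left heat_kernel_first_moment(1) r)
    fix z :: "real^'n"
    show "\<bar>heat_kernel r z * (correlation f g z - l2inner f g)\<bar> \<le> (norm z * heat_kernel r z) * ?S"
      using mult_left_mono[OF correlation_Lipschitz[OF f g H, of z] heat_kernel_nonneg[OF r, of z]]
        heat_kernel_nonneg[OF r, of z]
      by (simp add: abs_mult mult_ac)
  qed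
  also have "\<dots> = (\<integral>z. norm z * heat_kernel r z \<partial>(lborel :: (real^'n) measure)) * ?S" by simp
  also have "\<dots> \<le> (2 * sqrt 2 ^ CARD('n) * sqrt r) * ?S"
    by (rule mult_right_mono[OF heat_kernel_first_moment(2)[OF r] S])
  finally show ?thesis .
qed

text \<open>As r decreases to 0 the Gaussian weights increase to 1, while the weighted integrals
  stay below the squared norm by the bound on the heat form; monotone convergence concludes.\<close>

lemma Bessel_inequality_fourier_L1:
  fixes f :: "real^'n::finite \<Rightarrow> real"
  assumes f: "inL2 f" and f1: "integrable lborel f"
  shows "integrable lborel (\<lambda>\<xi>. (cmod (fourier_L1 f \<xi>))\<^sup>2)"
    and "(\<integral>\<xi>. (cmod (fourier_L1 f \<xi>))\<^sup>2 \<partial>lborel) \<le> (l2norm f)\<^sup>2"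
proof -
  define r where "r n = inverse (real (Suc n))" for n
  have r: "0 < r n" for n by (simp add: r_def)
  let ?F = "\<lambda>\<xi>. (cmod (fourier_L1 f \<xi>))\<^sup>2"
  define G where "G n \<xi> = exp (- (r n * (norm \<xi>)\<^sup>2)) * ?F \<xi>" for n \<xi>
  have [measurable]: "f \<in> borel_measurable borel" using f1 by auto
  have m: "?F \<in> borel_measurable lborel"
    unfolding fourier_L1_def by measurable
  have int: "integrable lborel (G n)" for n
    unfolding G_def[abs_def] by (rule gaussian_weighted_fourier(1)[OF f f1 r])
  have le: "integral\<^sup>L lborel (G n) \<le> (l2norm f)\<^sup>2" for n
    using gaussian_weighted_fourier(2)[OF f f1 r[of n]] heat_form_le[OF r[of n] f f]
    unfolding G_def[abs_def] heat_form_def by (simp add: power2_eq_square)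
  have dec: "r n \<le> r m" if "m \<le> n" for m n
    using that by (simp add: r_def field_simps)
  have mono: "mono (\<lambda>n. G n \<xi>)" for \<xi>
    unfolding G_def mono_def by (auto intro!: mult_right_mono dec)
  have lim: "(\<lambda>n. G n \<xi>) \<longlonglongrightarrow> ?F \<xi>" for \<xi>
  proof -
    have "r \<longlonglongrightarrow> 0" unfolding r_def[abs_def] by (rule LIMSEQ_inverse_real_of_nat)
    then have "(\<lambda>n. G n \<xi>) \<longlonglongrightarrow> exp (- (0 * (norm \<xi>)\<^sup>2)) * ?F \<xi>"
      unfolding G_def by (intro tendsto_intros)
    then show ?thesis by simp
  qed
  have imono: "incseq (\<lambda>n. integral\<^sup>L lborel (G n))"
    unfolding incseq_def by (auto intro!: integral_mono int monoD[OF mono])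
  obtain L where L: "(\<lambda>n. integral\<^sup>L lborel (G n)) \<longlonglongrightarrow> L" "\<forall>n. integral\<^sup>L lborel (G n) \<le> L"
    using incseq_convergent[OF imono] le by blast
  show "integrable lborel ?F"
    by (rule integrable_monotone_convergence[OF int _ _ L(1) m]) (use mono lim in auto)
  have "integral\<^sup>L lborel ?F = L"
    by (rule integral_monotone_convergence[OF int _ _ L(1) m]) (use mono lim in auto)
  then show "integral\<^sup>L lborel ?F \<le> (l2norm f)\<^sup>2"
    using LIMSEQ_le_const2[OF L(1)] le by blast
qed

section \<open>Weighted Fourier energies of negative order\<close>

definition sobolev_weight :: "real \<Rightarrow> real^'n::finite \<Rightarrow> real" where
  "sobolev_weight \<sigma> \<xi> = (1 + (norm \<xi>)\<^sup>2) powr \<sigma>"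

lemma measurable_sobolev_weight [measurable]: "sobolev_weight \<sigma> \<in> borel_measurable borel"
  unfolding sobolev_weight_def[abs_def] by measurable

lemma sobolev_weight_bounds:
  assumes "0 \<le> s"
  shows "0 < sobolev_weight (- s) \<xi>" "sobolev_weight (- s) \<xi> \<le> 1"
proof -
  have "0 \<le> (norm \<xi>)\<^sup>2" by simp
  then have "0 < 1 + (norm \<xi>)\<^sup>2" "1 \<le> 1 + (norm \<xi>)\<^sup>2" by linarith+
  then show "0 < sobolev_weight (- s) \<xi>" "sobolev_weight (- s) \<xi> \<le> 1"
    using assms ge_one_powr_ge_zero[of "1 + (norm \<xi>)\<^sup>2" s]
    by (auto simp: sobolev_weight_def powr_minus inverse_le_1_iff)
qed

text \<open>The price 1 / r for controlling heat smoothing at time r by the weight of order -s: r *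
  (1 + z)^s \<le> r * (1 + z) \<le> 1 + r * z \<le> exp (r * z).\<close>

lemma gaussian_le_sobolev_weight:
  assumes r: "0 < r" "r \<le> 1" and s: "0 \<le> s" "s \<le> 1"
  shows "exp (- (r * (norm \<xi>)\<^sup>2)) \<le> (1 / r) * sobolev_weight (- s) \<xi>"
proof -
  define z where "z = (norm \<xi>)\<^sup>2"
  have z: "0 \<le> z" by (simp add: z_def)
  have "(1 + z) powr s \<le> (1 + z) powr 1" by (rule powr_mono) (use s z in auto)
  also have "(1 + z) powr 1 = 1 + z" using z by simp
  finally have "r * (1 + z) powr s \<le> r * (1 + z)" using r by simp
  also have "\<dots> \<le> 1 + r * z" using r by (simp add: distrib_left)
  also have "\<dots> \<le> exp (r * z)" by (rule exp_ge_add_one_self)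
  finally have "r * (1 + z) powr s \<le> exp (r * z)" .
  then show ?thesis
    using r z by (simp add: sobolev_weight_def z_def[symmetric] powr_minus exp_minus field_simps)
qed

definition sobolev_energy :: "real \<Rightarrow> (real^'n::finite \<Rightarrow> real) \<Rightarrow> real" where
  "sobolev_energy \<sigma> f = (\<integral>\<xi>. sobolev_weight \<sigma> \<xi> * (cmod (fourier_L1 f \<xi>))\<^sup>2 \<partial>lborel)"

lemma integrable_sobolev_energy:
  fixes f :: "real^'n::finite \<Rightarrow> real"
  assumes "0 \<le> s" "inL2 f" "integrable lborel f"
  shows "integrable lborel (\<lambda>\<xi>. sobolev_weight (- s) \<xi> * (cmod (fourier_L1 f \<xi>))\<^sup>2)"
proof -
  have "\<bar>sobolev_weight (- s) \<xi>\<bar> \<le> 1" for \<xi> :: "real^'n"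
    using sobolev_weight_bounds[OF assms(1), of \<xi>] by linarith
  then show ?thesis
    using integrable_mult_bounded[OF Bessel_inequality_fourier_L1(1)[OF assms(2,3)], of "sobolev_weight (- s)" 1]
    by (simp add: mult.commute)
qed

lemma sobolev_energy_nonneg: "0 \<le> sobolev_energy \<sigma> f"
  by (simp add: sobolev_energy_def sobolev_weight_def)

lemma sobolev_energy_le:
  assumes "0 \<le> s" "inL2 f" "integrable lborel f"
  shows "sobolev_energy (- s) f \<le> (l2norm f)\<^sup>2"
proof -
  have "sobolev_energy (- s) f \<le> (\<integral>\<xi>. (cmod (fourier_L1 f \<xi>))\<^sup>2 \<partial>lborel)"
    unfolding sobolev_energy_def
    by (rule integral_mono[OF integrable_sobolev_energy[OF assms] Bessel_inequality_fourier_L1(1)[OF assms(2,3)]])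
      (use mult_right_mono[OF sobolev_weight_bounds(2)[OF assms(1)] zero_le_power2] in simp)
  then show ?thesis using Bessel_inequality_fourier_L1(2)[OF assms(2,3)] by linarith
qed

lemma fourier_L1_diff:
  fixes f g :: "real^'n::finite \<Rightarrow> real"
  assumes "integrable lborel f" "integrable lborel g"
  shows "fourier_L1 (\<lambda>x. f x - g x) \<xi> = fourier_L1 f \<xi> - fourier_L1 g \<xi>"
proof -
  have "integrable lborel (\<lambda>x. complex_of_real (h x) * cis (- (x \<bullet> \<xi>)))" if "integrable lborel h" for h
    by (rule integrable_cis_mult) (use that in \<open>auto intro: integrable_of_real\<close>)
  then show ?thesis
    using assms by (simp add: fourier_L1_def left_diff_distrib right_diff_distrib)
qed

text \<open>Uses 2 x y \<le> d x^2 + y^2 / d. A small d keeps the factor of the energy close to 1,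
  as the Cauchy property of the energies of truncations requires.\<close>

lemma sobolev_energy_quasi_triangle:
  fixes f g :: "real^'n::finite \<Rightarrow> real"
  assumes s: "0 \<le> s" and f: "inL2 f" "integrable lborel f" and g: "inL2 g" "integrable lborel g" and d: "0 < d"
  shows "sobolev_energy (- s) f \<le> (1 + d) * sobolev_energy (- s) g + (1 + 1 / d) * (l2norm (\<lambda>x. f x - g x))\<^sup>2"
proof -
  let ?h = "\<lambda>x. f x - g x"
  note h = inL2_diff[OF f(1) g(1)] Bochner_Integration.integrable_diff[OF f(2) g(2)]
  let ?w = "sobolev_weight (- s)"
  have pt: "(cmod a)\<^sup>2 \<le> (1 + d) * (cmod b)\<^sup>2 + (1 + 1 / d) * (cmod (a - b))\<^sup>2" for a b
  proof -
    let ?x = "cmod b" and ?y = "cmod (a - b)"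
    have "cmod a \<le> ?x + ?y" using norm_triangle_ineq[of b "a - b"] by simp
    then have "(cmod a)\<^sup>2 \<le> (?x + ?y)\<^sup>2" by (intro power_mono) auto
    moreover have "0 \<le> (d * ?x - ?y)\<^sup>2 / d" using d by simp
    moreover have "(d * ?x - ?y)\<^sup>2 / d = d * ?x\<^sup>2 - 2 * ?x * ?y + ?y\<^sup>2 / d"
      using d by (simp add: power2_eq_square field_simps)
    ultimately show ?thesis by (simp add: power2_sum algebra_simps)
  qed
  have "sobolev_energy (- s) f \<le> (\<integral>\<xi>. (1 + d) * (?w \<xi> * (cmod (fourier_L1 g \<xi>))\<^sup>2)
      + (1 + 1 / d) * (?w \<xi> * (cmod (fourier_L1 ?h \<xi>))\<^sup>2) \<partial>lborel)"
    unfolding sobolev_energy_def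
  proof (rule integral_mono)
    show "integrable lborel (\<lambda>\<xi>. ?w \<xi> * (cmod (fourier_L1 f \<xi>))\<^sup>2)" by (rule integrable_sobolev_energy[OF s f])
    show "integrable lborel (\<lambda>\<xi>. (1 + d) * (?w \<xi> * (cmod (fourier_L1 g \<xi>))\<^sup>2)
      + (1 + 1 / d) * (?w \<xi> * (cmod (fourier_L1 ?h \<xi>))\<^sup>2))"
      by (intro Bochner_Integration.integrable_add integrable_mult_right integrable_sobolev_energy[OF s g] integrable_sobolev_energy[OF s h])
    fix \<xi>
    show "?w \<xi> * (cmod (fourier_L1 f \<xi>))\<^sup>2 \<le> (1 + d) * (?w \<xi> * (cmod (fourier_L1 g \<xi>))\<^sup>2)
      + (1 + 1 / d) * (?w \<xi> * (cmod (fourier_L1 ?h \<xi>))\<^sup>2)"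
      using mult_left_mono[OF pt[of "fourier_L1 f \<xi>" "fourier_L1 g \<xi>"] less_imp_le[OF sobolev_weight_bounds(1)[OF s, of \<xi>]]]
      unfolding fourier_L1_diff[OF f(2) g(2)] by (simp only: distrib_left mult.left_commute)
  qed
  also have "\<dots> = (1 + d) * sobolev_energy (- s) g + (1 + 1 / d) * sobolev_energy (- s) ?h"
    using integrable_sobolev_energy[OF s g] integrable_sobolev_energy[OF s h] by (simp add: sobolev_energy_def)
  also have "\<dots> \<le> (1 + d) * sobolev_energy (- s) g + (1 + 1 / d) * (l2norm ?h)\<^sup>2"
    using sobolev_energy_le[OF s h] d by (intro add_left_mono mult_left_mono) auto
  finally show ?thesis .
qed

lemma Cauchy_at_top_convergent:
  fixes S :: "real \<Rightarrow> real"
  assumes "\<And>e. 0 < e \<Longrightarrow> \<exists>N. \<forall>x\<ge>N. \<forall>y\<ge>N. \<bar>S x - S y\<bar> < e"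
  shows "\<exists>L. (S \<longlongrightarrow> L) at_top"
proof -
  have "Cauchy (\<lambda>n. S (real n))"
  proof (rule metric_CauchyI)
    fix e :: real assume "0 < e"
    then obtain N where "\<forall>x\<ge>N. \<forall>y\<ge>N. \<bar>S x - S y\<bar> < e" using assms by blast
    moreover have "N \<le> real n" if "nat \<lceil>N\<rceil> \<le> n" for n using that by linarith
    ultimately show "\<exists>M. \<forall>m\<ge>M. \<forall>n\<ge>M. dist (S (real m)) (S (real n)) < e"
      by (intro exI[of _ "nat \<lceil>N\<rceil>"]) (simp add: dist_real_def)
  qed
  then obtain L where L: "(\<lambda>n. S (real n)) \<longlonglongrightarrow> L" by (auto simp: Cauchy_convergent_iff convergent_def)
  have "(S \<longlongrightarrow> L) at_top"
  proof (rule tendstoI)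
    fix e :: real assume "0 < e"
    then obtain N where N: "\<And>x y. x \<ge> N \<Longrightarrow> y \<ge> N \<Longrightarrow> \<bar>S x - S y\<bar> < e / 2" using assms[of "e / 2"] by auto
    obtain M where M: "\<And>n. n \<ge> M \<Longrightarrow> \<bar>S (real n) - L\<bar> < e / 2"
      using LIMSEQ_D[OF L, of "e / 2"] \<open>0 < e\<close> by auto
    let ?n = "max M (nat \<lceil>N\<rceil>)"
    have "N \<le> real ?n" by linarith
    then have "dist (S x) L < e" if "x \<ge> N" for x
      unfolding dist_real_def
      using N[OF that, of "real ?n"] M[OF max.cobounded1, of "nat \<lceil>N\<rceil>"] by linarith
    then show "\<forall>\<^sub>F x in at_top. dist (S x) L < e"
      by (auto simp: eventually_at_top_linorder)
  qed
  then show ?thesis by blast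
qed

section \<open>Truncation to balls and the limit that defines the negative Sobolev norm\<close>

context
  fixes f :: "real^'n::finite \<Rightarrow> real"
  assumes f: "inL2 f"
begin

abbreviation trunc :: "real \<Rightarrow> real^'n \<Rightarrow> real" where
  "trunc R \<equiv> \<lambda>x. indicator (cball 0 R) x * f x"

lemma inL2_trunc: "inL2 (trunc R)"
proof (rule inL2_bounded[OF f])
  have [measurable]: "f \<in> borel_measurable borel" "cball (0::real^'n) R \<in> sets borel"
    using f by (auto intro: inL2_measurable)
  show "trunc R \<in> borel_measurable borel" by measurable
  show "\<bar>trunc R x\<bar> \<le> 1 * \<bar>f x\<bar>" for x by (simp add: indicator_def)
qed

lemma integrable_trunc: "integrable lborel (trunc R)"
proof -
  have "inL2 (indicator (cball 0 R) :: real^'n \<Rightarrow> real)"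
  proof -
    have "(\<lambda>x. (indicator (cball 0 R) x :: real)\<^sup>2) = indicator (cball (0::real^'n) R)"
      by (auto simp: fun_eq_iff indicator_def)
    then show ?thesis
      using integrable_indicator_cball[of "0::real^'n" R] borel_measurable_integrable
      unfolding inL2_def by metis
  qed
  from inL2_mult_integrable[OF this f] show ?thesis .
qed

lemma l2norm_trunc_le: "l2norm (trunc R) \<le> l2norm f"
  by (rule l2norm_mono[OF inL2_trunc f]) (simp add: indicator_def)

lemma trunc_tendsto: "((\<lambda>R. l2norm (\<lambda>x. f x - trunc R x)) \<longlongrightarrow> 0) at_top"
proof -
  have [measurable]: "f \<in> borel_measurable borel" "\<And>R. cball (0::real^'n) R \<in> sets borel"
    using f by (auto intro: inL2_measurable)
  have "((\<lambda>R. \<integral>x. (f x - trunc R x)\<^sup>2 \<partial>lborel) \<longlongrightarrow> (\<integral>x. 0 \<partial>(lborel :: (real^'n) measure))) at_top"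
  proof (rule integral_dominated_convergence_at_top)
    show "integrable lborel (\<lambda>x. (f x)\<^sup>2)" by (rule inL2_integrable_square[OF f])
    show "\<forall>\<^sub>F R in at_top. AE x in lborel. norm ((f x - trunc R x)\<^sup>2) \<le> (f x)\<^sup>2"
      by (auto simp: indicator_def)
    show "AE x in lborel. ((\<lambda>R. (f x - trunc R x)\<^sup>2) \<longlongrightarrow> 0) at_top"
    proof (rule AE_I2)
      fix x :: "real^'n"
      have "\<forall>\<^sub>F R in at_top. (f x - trunc R x)\<^sup>2 = 0"
        by (rule eventually_mono[OF eventually_ge_at_top[of "norm x"]]) (simp add: indicator_def)
      then show "((\<lambda>R. (f x - trunc R x)\<^sup>2) \<longlongrightarrow> 0) at_top" by (rule tendsto_eventually)
    qed
  qed measurable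
  from tendsto_real_sqrt[OF this] show ?thesis by (simp add: l2norm_def)
qed

text \<open>\<open>sobolev_norm\<close> is written with \<open>Lim\<close>, which is meaningful only
  once the limit exists. The truncations converge in L2 and the energy depends continuously on the
  function there, so the Cauchy criterion applies.\<close>

lemma sobolev_energy_trunc_converges:
  assumes s: "0 \<le> s"
  shows "((\<lambda>R. sobolev_energy (- s) (trunc R)) \<longlongrightarrow> (sobolev_norm (- s) f)\<^sup>2) at_top"
proof -
  let ?S = "\<lambda>R. sobolev_energy (- s) (trunc R)"
  have "\<exists>L. (?S \<longlongrightarrow> L) at_top"
  proof (rule Cauchy_at_top_convergent)
    fix e :: real assume e: "0 < e"
    define A where "A = (l2norm f)\<^sup>2"
    have A: "0 \<le> A" by (simp add: A_def)
    \<comment> \<open>This d bounds the error proportional to the energy by e / 4; the L2 threshold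
      h below is small enough to offset the factor 1 + 1 / d.\<close>
    define d where "d = e / (4 * (A + 1))"
    have d: "0 < d" using e A by (simp add: d_def)
    have dA: "d * A \<le> e / 4" using e A by (simp add: d_def field_simps)
    define B where "B = 1 + 1 / d"
    have B: "0 < B" using d by (simp add: B_def add_pos_pos)
    define h where "h = sqrt (e / (16 * B))"
    have h: "0 < h" "B * (h + h)\<^sup>2 = e / 4" using e B
      by (auto simp: h_def power2_eq_square algebra_simps real_sqrt_mult[symmetric])
    have "\<forall>\<^sub>F R in at_top. l2norm (\<lambda>x. f x - trunc R x) < h"
      using order_tendstoD(2)[OF trunc_tendsto h(1)] .
    then obtain N where N: "\<And>R. R \<ge> N \<Longrightarrow> l2norm (\<lambda>x. f x - trunc R x) < h"
      by (auto simp: eventually_at_top_linorder)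
    have one: "?S R \<le> ?S R' + e / 2" if R: "R \<ge> N" "R' \<ge> N" for R R'
    proof -
      have "l2norm (\<lambda>x. trunc R x - trunc R' x) = l2norm (\<lambda>x. (f x - trunc R' x) - (f x - trunc R x))"
        by simp
      also have "\<dots> \<le> l2norm (\<lambda>x. f x - trunc R' x) + l2norm (\<lambda>x. f x - trunc R x)"
        by (intro l2norm_diff_le inL2_diff f inL2_trunc)
      also have "\<dots> \<le> h + h" using N[OF R(1)] N[OF R(2)] by linarith
      finally have "(l2norm (\<lambda>x. trunc R x - trunc R' x))\<^sup>2 \<le> (h + h)\<^sup>2"
        by (intro power_mono) auto
      from mult_left_mono[OF this less_imp_le[OF B]]
      have "B * (l2norm (\<lambda>x. trunc R x - trunc R' x))\<^sup>2 \<le> e / 4" unfolding h(2) .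
      moreover have "d * ?S R' \<le> e / 4"
      proof -
        have "?S R' \<le> (l2norm (trunc R'))\<^sup>2" by (rule sobolev_energy_le[OF s inL2_trunc integrable_trunc])
        also have "\<dots> \<le> A" unfolding A_def by (intro power_mono l2norm_trunc_le) simp
        finally have "d * ?S R' \<le> d * A" using d by simp
        then show ?thesis using dA by linarith
      qed
      moreover have "?S R \<le> (1 + d) * ?S R' + B * (l2norm (\<lambda>x. trunc R x - trunc R' x))\<^sup>2"
        unfolding B_def by (rule sobolev_energy_quasi_triangle[OF s inL2_trunc integrable_trunc inL2_trunc integrable_trunc d])
      ultimately show ?thesis by (simp add: distrib_right)
    qed
    have "\<bar>?S R - ?S R'\<bar> < e" if R: "R \<ge> N" "R' \<ge> N" for R R'
      using one[OF R] one[OF R(2) R(1)] e by linarith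
    then show "\<exists>N. \<forall>x\<ge>N. \<forall>y\<ge>N. \<bar>?S x - ?S y\<bar> < e" by blast
  qed
  then obtain L where L: "(?S \<longlongrightarrow> L) at_top" by blast
  have "0 \<le> L"
    by (rule tendsto_lowerbound[OF L always_eventually]) (auto intro: sobolev_energy_nonneg)
  have "sobolev_norm (- s) f = sqrt (Lim at_top ?S)"
    unfolding sobolev_norm_def sobolev_energy_def sobolev_weight_def fourier_trunc_eq ..
  also have "Lim at_top ?S = L" by (rule tendsto_Lim[OF _ L]) simp
  finally show ?thesis using L \<open>0 \<le> L\<close> by simp
qed

lemma sobolev_norm_nonneg: "0 \<le> s \<Longrightarrow> 0 \<le> sobolev_norm (- s) f"
proof -
  assume s: "0 \<le> s"
  have eq: "sobolev_norm (- s) f = sqrt (Lim at_top (\<lambda>R. sobolev_energy (- s) (trunc R)))"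
    unfolding sobolev_norm_def sobolev_energy_def sobolev_weight_def fourier_trunc_eq ..
  have "Lim at_top (\<lambda>R. sobolev_energy (- s) (trunc R)) = (sobolev_norm (- s) f)\<^sup>2"
    by (rule tendsto_Lim[OF _ sobolev_energy_trunc_converges[OF s]]) simp
  then have "0 \<le> Lim at_top (\<lambda>R. sobolev_energy (- s) (trunc R))"
    by (simp only: zero_le_power2)
  then show ?thesis unfolding eq by (rule real_sqrt_ge_zero)
qed

end

text \<open>Cauchy-Schwarz leaves the heat form at f, where the Gaussian is at most the Sobolev
  weight divided by r. The Fourier side needs integrable functions, so this is done for truncations
  and passed to the limit.\<close>

lemma heat_form_le_sobolev:
  fixes f g :: "real^'n::finite \<Rightarrow> real"
  assumes r: "0 < r" "r \<le> 1" and s: "0 \<le> s" "s \<le> 1" and f: "inL2 f" and g: "inL2 g"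
  shows "\<bar>heat_form r f g\<bar> \<le> sobolev_norm (- s) f / sqrt r * l2norm g"
proof -
  let ?T = "\<lambda>f R x. indicator (cball 0 R) x * f x"
  have bound: "\<bar>heat_form r (?T f R) (?T g R)\<bar> \<le> sqrt (sobolev_energy (- s) (?T f R) / r) * l2norm g" for R
  proof -
    note fR = inL2_trunc[OF f, of R] integrable_trunc[OF f, of R]
    have "heat_form r (?T f R) (?T f R) \<le> (\<integral>\<xi>. (1 / r) * (sobolev_weight (- s) \<xi> * (cmod (fourier_L1 (?T f R) \<xi>))\<^sup>2) \<partial>lborel)"
      unfolding heat_form_def gaussian_weighted_fourier(2)[OF fR r(1), symmetric]
    proof (rule integral_mono[OF gaussian_weighted_fourier(1)[OF fR r(1)]])
      show "integrable lborel (\<lambda>\<xi>. (1 / r) * (sobolev_weight (- s) \<xi> * (cmod (fourier_L1 (?T f R) \<xi>))\<^sup>2))"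
        by (intro integrable_mult_right integrable_sobolev_energy fR s)
      show "exp (- (r * (norm \<xi>)\<^sup>2)) * (cmod (fourier_L1 (?T f R) \<xi>))\<^sup>2
          \<le> (1 / r) * (sobolev_weight (- s) \<xi> * (cmod (fourier_L1 (?T f R) \<xi>))\<^sup>2)" for \<xi>
        using mult_right_mono[OF gaussian_le_sobolev_weight[OF r s, of \<xi>] zero_le_power2]
        by (simp only: mult.assoc)
    qed
    also have "\<dots> = sobolev_energy (- s) (?T f R) / r"
      unfolding sobolev_energy_def by simp
    finally have le: "heat_form r (?T f R) (?T f R) \<le> sobolev_energy (- s) (?T f R) / r" .
    have "\<bar>heat_form r (?T f R) (?T g R)\<bar> \<le> sqrt (heat_form r (?T f R) (?T f R)) * l2norm (?T g R)"
      by (rule heat_form_Cauchy_Schwarz[OF r(1) fR inL2_trunc[OF g] integrable_trunc[OF g]])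
    also have "\<dots> \<le> sqrt (sobolev_energy (- s) (?T f R) / r) * l2norm g"
      by (intro mult_mono real_sqrt_le_mono le l2norm_trunc_le[OF g])
        (use r in \<open>auto intro!: divide_nonneg_pos sobolev_energy_nonneg\<close>)
    finally show ?thesis .
  qed
  have approx: "\<bar>heat_form r f g - heat_form r (?T f R) (?T g R)\<bar>
      \<le> l2norm (\<lambda>x. f x - ?T f R x) * l2norm g + l2norm f * l2norm (\<lambda>x. g x - ?T g R x)" for R
  proof -
    let ?fR = "?T f R" and ?gR = "?T g R"
    note fR = inL2_trunc[OF f, of R] and gR = inL2_trunc[OF g, of R]
    note df = inL2_diff[OF f fR] and dg = inL2_diff[OF g gR]
    have "heat_form r f g = heat_form r (\<lambda>x. (f x - ?fR x) + ?fR x) g" by simp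
    also have "\<dots> = heat_form r (\<lambda>x. f x - ?fR x) g + heat_form r ?fR g"
      by (rule heat_form_add_left[OF r(1) df fR g])
    also have "heat_form r ?fR g = heat_form r (\<lambda>x. (g x - ?gR x) + ?gR x) ?fR"
      by (simp add: heat_form_commute[of r _ g])
    also have "\<dots> = heat_form r (\<lambda>x. g x - ?gR x) ?fR + heat_form r ?gR ?fR"
      by (rule heat_form_add_left[OF r(1) dg gR fR])
    finally have "heat_form r f g - heat_form r ?fR ?gR
        = heat_form r (\<lambda>x. f x - ?fR x) g + heat_form r (\<lambda>x. g x - ?gR x) ?fR"
      by (simp add: heat_form_commute[of r ?gR])
    moreover have "\<bar>heat_form r (\<lambda>x. f x - ?fR x) g\<bar> \<le> l2norm (\<lambda>x. f x - ?fR x) * l2norm g"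
      by (rule heat_form_le[OF r(1) df g])
    moreover have "\<bar>heat_form r (\<lambda>x. g x - ?gR x) ?fR\<bar> \<le> l2norm (\<lambda>x. g x - ?gR x) * l2norm f"
      by (rule order_trans[OF heat_form_le[OF r(1) dg fR] mult_left_mono[OF l2norm_trunc_le[OF f]]]) simp
    ultimately show ?thesis by (simp add: mult.commute)
  qed
  have lim: "((\<lambda>R. l2norm (\<lambda>x. f x - ?T f R x) * l2norm g + l2norm f * l2norm (\<lambda>x. g x - ?T g R x)
      + sqrt (sobolev_energy (- s) (?T f R) / r) * l2norm g)
      \<longlongrightarrow> 0 * l2norm g + l2norm f * 0 + sqrt ((sobolev_norm (- s) f)\<^sup>2 / r) * l2norm g) at_top"
    using r by (intro tendsto_intros trunc_tendsto[OF f] trunc_tendsto[OF g] sobolev_energy_trunc_converges[OF f s(1)]) auto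
  have "\<bar>heat_form r f g\<bar> \<le> 0 * l2norm g + l2norm f * 0 + sqrt ((sobolev_norm (- s) f)\<^sup>2 / r) * l2norm g"
  proof (rule tendsto_lowerbound[OF lim always_eventually], rule allI)
    show "\<bar>heat_form r f g\<bar> \<le> l2norm (\<lambda>x. f x - ?T f R x) * l2norm g + l2norm f * l2norm (\<lambda>x. g x - ?T g R x)
      + sqrt (sobolev_energy (- s) (?T f R) / r) * l2norm g" for R
      using approx[of R] bound[of R] by linarith
  qed simp
  then show ?thesis using r sobolev_norm_nonneg[OF f s(1)] by (simp add: real_sqrt_divide)
qed

text \<open>Splitting \<open>g\<close> by the heat semigroup at time \<open>\<rho>\<close> interpolates between \<open>H\<^sup>-\<^sup>s\<close> and \<open>H\<^sup>1\<close>
  without computing an \<open>H\<^sup>s\<close> norm of \<open>g\<close>.\<close>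

lemma sobolev_pairing:
  fixes f g :: "real^'n::finite \<Rightarrow> real"
  assumes s: "0 \<le> s" "s \<le> 1" and \<rho>: "0 < \<rho>" "\<rho> \<le> 1" "sobolev_norm (- s) f \<le> \<rho>"
    and f: "inL2 f" and g: "inL2 g" and H: "\<And>i. inL2 (H i)" "\<And>i. weak_pd i g (H i)"
  shows "\<bar>l2inner f g\<bar> \<le> sqrt \<rho> * (l2norm g + 2 * sqrt 2 ^ CARD('n) * l2norm f * (\<Sum>i\<in>UNIV. l2norm (H i)))"
proof -
  \<comment> \<open>The bound \<rho> doubles as heat time: the smoothed part costs \<rho> / sqrt
    \<rho> and the remainder sqrt \<rho>, so the two balance.\<close>
  have "sobolev_norm (- s) f / sqrt \<rho> * l2norm g \<le> \<rho> / sqrt \<rho> * l2norm g"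
    using \<rho> by (intro mult_right_mono divide_right_mono) auto
  also have "\<rho> / sqrt \<rho> = sqrt \<rho>" using \<rho> by (simp add: real_div_sqrt)
  finally have "\<bar>heat_form \<rho> f g\<bar> \<le> sqrt \<rho> * l2norm g"
    using heat_form_le_sobolev[OF \<rho>(1,2) s f g] by linarith
  then have "\<bar>l2inner f g\<bar> \<le> sqrt \<rho> * l2norm g
      + 2 * sqrt 2 ^ CARD('n) * sqrt \<rho> * (l2norm f * (\<Sum>i\<in>UNIV. l2norm (H i)))"
    using heat_form_first_order[OF \<rho>(1) f g H] by linarith
  then show ?thesis by (simp only: distrib_left mult_ac)
qed

section \<open>Energy inequalities for the backward parabolic equation\<close>

lemma inL2_test_fun:
  assumes \<phi>: "test_fun \<phi>"
  shows "inL2 \<phi>"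
proof -
  obtain B R where B: "0 \<le> B" "\<And>x. \<bar>\<phi> x\<bar> \<le> B * indicator (cball 0 R) x"
    by (rule test_fun_bounded[OF \<phi>]) blast
  have "\<bar>\<phi> x\<bar> \<le> B" for x using B(2)[of x] B(1) by (cases "x \<in> cball 0 R") simp_all
  from integrable_mult_bounded[OF test_fun_integrable[OF \<phi>] _ this] show ?thesis
    using test_fun_measurable[OF \<phi>] by (simp add: inL2_def power2_eq_square)
qed

text \<open>Product rule for L2-valued functions: the quadratic remainder is |s - t| times a product
  of quotients whose norms stay bounded.\<close>

lemma has_field_derivative_l2inner:
  fixes p q :: "real \<Rightarrow> real^'n::finite \<Rightarrow> real"
  assumes L2: "\<And>s. s \<in> S \<Longrightarrow> inL2 (p s)" "\<And>s. s \<in> S \<Longrightarrow> inL2 (q s)" "inL2 p'" "inL2 q'" and t: "t \<in> S"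
    and p: "((\<lambda>s. l2norm (\<lambda>x. (p s x - p t x) / (s - t) - p' x)) \<longlongrightarrow> 0) (at t within S)"
    and q: "((\<lambda>s. l2norm (\<lambda>x. (q s x - q t x) / (s - t) - q' x)) \<longlongrightarrow> 0) (at t within S)"
  shows "((\<lambda>s. l2inner (p s) (q s)) has_field_derivative l2inner p' (q t) + l2inner (p t) q') (at t within S)"
  unfolding has_field_derivative_iff
proof (rule LIM_zero_cancel, rule Lim_null_comparison)
  let ?dp = "\<lambda>s x. (p s x - p t x) / (s - t)" and ?dq = "\<lambda>s x. (q s x - q t x) / (s - t)"
  let ?ep = "\<lambda>s. l2norm (\<lambda>x. ?dp s x - p' x)" and ?eq = "\<lambda>s. l2norm (\<lambda>x. ?dq s x - q' x)"
  let ?E = "\<lambda>s. ?ep s * l2norm (q t) + l2norm (p t) * ?eq s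
      + \<bar>s - t\<bar> * ((?ep s + l2norm p') * (?eq s + l2norm q'))"
  have "(?E \<longlongrightarrow> 0 * l2norm (q t) + l2norm (p t) * 0 + \<bar>t - t\<bar> * ((0 + l2norm p') * (0 + l2norm q'))) (at t within S)"
    by (intro tendsto_intros p q)
  then show "(?E \<longlongrightarrow> 0) (at t within S)" by simp
  show "\<forall>\<^sub>F s in at t within S. norm ((l2inner (p s) (q s) - l2inner (p t) (q t)) / (s - t)
      - (l2inner p' (q t) + l2inner (p t) q')) \<le> ?E s"
    unfolding eventually_at_topological
  proof (rule exI[of _ UNIV], intro conjI ballI impI)
    fix s assume s: "s \<noteq> t" "s \<in> S"
    note ps = L2(1)[OF s(2)] and pt = L2(1)[OF t] and qs = L2(2)[OF s(2)] and qt = L2(2)[OF t]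
    have dp: "inL2 (?dp s)" and dq: "inL2 (?dq s)"
      using inL2_cmult[OF inL2_diff[OF ps pt], of "1 / (s - t)"] inL2_cmult[OF inL2_diff[OF qs qt], of "1 / (s - t)"]
      by (simp_all)
    note ep = inL2_diff[OF dp L2(3)] and eq = inL2_diff[OF dq L2(4)]
    have p_eq: "p s = (\<lambda>x. p t x + (s - t) * ?dp s x)" and q_eq: "q s = (\<lambda>x. q t x + (s - t) * ?dq s x)"
      using s(1) by auto
    have "l2inner (p s) (q s) = l2inner (\<lambda>x. p t x + (s - t) * ?dp s x) (\<lambda>x. q t x + (s - t) * ?dq s x)"
      using p_eq q_eq by simp
    also have "\<dots> = l2inner (p t) (q t) + (s - t) * l2inner (p t) (?dq s)
        + (s - t) * (l2inner (?dp s) (q t) + (s - t) * l2inner (?dp s) (?dq s))"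
      using pt qt inL2_cmult[OF dp, of "s - t"] inL2_cmult[OF dq, of "s - t"] dp dq
      by (simp only: l2inner_add_left l2inner_add_right l2inner_cmult_left inL2_add
          l2inner_commute[of _ "\<lambda>x. (s - t) * ?dq s x"] l2inner_commute[of "?dq s"])
    finally have "(l2inner (p s) (q s) - l2inner (p t) (q t)) / (s - t)
        = l2inner (p t) (?dq s) + l2inner (?dp s) (q t) + (s - t) * l2inner (?dp s) (?dq s)"
      using s(1) by (simp add: field_simps)
    then have "(l2inner (p s) (q s) - l2inner (p t) (q t)) / (s - t) - (l2inner p' (q t) + l2inner (p t) q')
        = l2inner (\<lambda>x. ?dp s x - p' x) (q t) + l2inner (p t) (\<lambda>x. ?dq s x - q' x) + (s - t) * l2inner (?dp s) (?dq s)"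
      by (simp only: l2inner_diff_left[OF dp L2(3) qt] l2inner_diff_right[OF dq L2(4) pt])
    moreover have "\<bar>l2inner (\<lambda>x. ?dp s x - p' x) (q t)\<bar> \<le> ?ep s * l2norm (q t)"
      by (rule l2inner_le[OF ep qt])
    moreover have "\<bar>l2inner (p t) (\<lambda>x. ?dq s x - q' x)\<bar> \<le> l2norm (p t) * ?eq s"
      by (rule l2inner_le[OF pt eq])
    moreover have "\<bar>(s - t) * l2inner (?dp s) (?dq s)\<bar> \<le> \<bar>s - t\<bar> * ((?ep s + l2norm p') * (?eq s + l2norm q'))"
    proof -
      have "l2norm (?dp s) \<le> ?ep s + l2norm p'" "l2norm (?dq s) \<le> ?eq s + l2norm q'"
        using l2norm_add_le[OF ep L2(3)] l2norm_add_le[OF eq L2(4)] by simp_all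
      then have "l2norm (?dp s) * l2norm (?dq s) \<le> (?ep s + l2norm p') * (?eq s + l2norm q')"
        by (intro mult_mono) auto
      then have "\<bar>l2inner (?dp s) (?dq s)\<bar> \<le> (?ep s + l2norm p') * (?eq s + l2norm q')"
        using l2inner_le[OF dp dq] by linarith
      then show ?thesis unfolding abs_mult by (rule mult_left_mono) simp
    qed
    ultimately show "norm ((l2inner (p s) (q s) - l2inner (p t) (q t)) / (s - t)
        - (l2inner p' (q t) + l2inner (p t) q')) \<le> ?E s"
      unfolding real_norm_def by linarith
  qed auto
qed

definition log_modulus :: "real \<Rightarrow> real" where
  "log_modulus \<tau> = \<tau> * (1 + \<bar>ln \<tau>\<bar>)"

text \<open>\<open>is_solution\<close> only asserts that a gradient and a time derivative exist; as
  parameters they can enter definitions. The plus sign in \<open>weak_eq\<close> is that of the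
  backward equation and makes the energy grow.\<close>

locale backward_parabolic =
  fixes T \<kappa> \<Lambda> :: real and a :: "'n::finite coeffs"
    and u :: "real \<Rightarrow> real^'n \<Rightarrow> real" and G :: "real \<Rightarrow> 'n \<Rightarrow> real^'n \<Rightarrow> real"
    and u' :: "real \<Rightarrow> real^'n \<Rightarrow> real"
  assumes kappa: "0 < \<kappa>" and Lambda: "0 \<le> \<Lambda>"
    and a_measurable: "\<And>j k t. t \<in> {0..T} \<Longrightarrow> a j k t \<in> borel_measurable borel"
    and a_bounded: "\<exists>B. \<forall>j k. \<forall>t\<in>{0..T}. \<forall>x. \<bar>a j k t x\<bar> \<le> B"
    and a_sym: "\<And>j k t x. t \<in> {0..T} \<Longrightarrow> a j k t x = a k j t x"
    and a_elliptic: "\<And>t x \<xi>. t \<in> {0..T} \<Longrightarrow>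
        \<kappa> * (norm \<xi>)\<^sup>2 \<le> (\<Sum>j\<in>UNIV. \<Sum>k\<in>UNIV. a j k t x * \<xi> $ j * \<xi> $ k)"
    and a_log_Lipschitz: "\<And>j k t t' x. t \<in> {0..T} \<Longrightarrow> t' \<in> {0..T} \<Longrightarrow> t \<noteq> t' \<Longrightarrow>
        \<bar>a j k t x - a j k t' x\<bar> \<le> \<Lambda> * log_modulus \<bar>t - t'\<bar>"
    and u_L2: "\<And>t. t \<in> {0..<T} \<Longrightarrow> inL2 (u t)"
    and G_L2: "\<And>t i. t \<in> {0..<T} \<Longrightarrow> inL2 (G t i)"
    and G_weak: "\<And>t i. t \<in> {0..<T} \<Longrightarrow> weak_pd i (u t) (G t i)"
    and u'_L2: "\<And>t. t \<in> {0..<T} \<Longrightarrow> inL2 (u' t)"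
    and u_deriv: "\<And>t. t \<in> {0..<T} \<Longrightarrow>
        ((\<lambda>s. l2norm (\<lambda>x. (u s x - u t x) / (s - t) - u' t x)) \<longlongrightarrow> 0) (at t within {0..<T})"
    and weak_eq: "\<And>t \<phi>. t \<in> {0..<T} \<Longrightarrow> test_fun \<phi> \<Longrightarrow> (\<integral>x. u' t x * \<phi> x \<partial>lborel)
        = (\<Sum>j\<in>UNIV. \<Sum>k\<in>UNIV. \<integral>x. a j k t x * G t k x * pd j \<phi> x \<partial>lborel)"
begin

definition energy :: "real \<Rightarrow> real" where "energy t = l2inner (u t) (u t)"

definition grad_energy :: "real \<Rightarrow> real" where "grad_energy t = (\<Sum>i\<in>UNIV. (l2norm (G t i))\<^sup>2)"

lemma energy_nonneg: "0 \<le> energy t"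
  by (simp add: energy_def flip: l2norm_square)

lemma grad_energy_nonneg: "0 \<le> grad_energy t"
  by (simp add: grad_energy_def sum_nonneg)

lemma inL2_flux:
  assumes "t \<in> {0..T}" "inL2 g"
  shows "inL2 (\<lambda>x. a j k t x * g x)"
proof -
  obtain B where B: "\<And>x. \<bar>a j k t x\<bar> \<le> B" using a_bounded assms(1) by blast
  have [measurable]: "a j k t \<in> borel_measurable borel" "g \<in> borel_measurable borel"
    using a_measurable[OF assms(1)] assms(2) by (auto intro: inL2_measurable)
  show ?thesis
  proof (rule inL2_bounded[OF assms(2)])
    show "\<bar>a j k t x * g x\<bar> \<le> B * \<bar>g x\<bar>" for x
      unfolding abs_mult by (intro mult_right_mono B) simp
  qed measurable
qed

text \<open>Admits the solution at any time, also a time different from t, as test function in the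
  equation at time t.\<close>

lemma equation_pairing:
  assumes t: "t \<in> {0..<T}" and g: "inL2 g" and H: "\<And>j. inL2 (H j)" "\<And>j. weak_pd j g (H j)"
  shows "l2inner (u' t) g = (\<Sum>j\<in>UNIV. \<Sum>k\<in>UNIV. \<integral>x. a j k t x * G t k x * H j x \<partial>lborel)"
proof -
  have t': "t \<in> {0..T}" using t by simp
  let ?F = "\<lambda>j x. \<Sum>k\<in>UNIV. a j k t x * G t k x"
  note aG = inL2_flux[OF t' G_L2[OF t]]
  have F: "inL2 (?F j)" for j by (intro inL2_sum aG)
  have F_int: "(\<integral>x. ?F j x * h x \<partial>lborel) = (\<Sum>k\<in>UNIV. \<integral>x. a j k t x * G t k x * h x \<partial>lborel)" if "inL2 h" for j h
    unfolding sum_distrib_right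
    by (rule Bochner_Integration.integral_sum) (rule inL2_mult_integrable[OF aG that])
  have "l2inner (u' t) g = (\<Sum>j\<in>UNIV. l2inner (?F j) (H j))"
  proof (rule weak_divergence_pairing[OF u'_L2[OF t] F _ g H])
    fix \<phi> :: "real^'n \<Rightarrow> real" assume \<phi>: "test_fun \<phi>"
    show "(\<integral>x. u' t x * \<phi> x \<partial>lborel) = (\<Sum>j\<in>UNIV. \<integral>x. ?F j x * pd j \<phi> x \<partial>lborel)"
      unfolding F_int[OF inL2_test_fun[OF test_fun_pd[OF \<phi>]]] by (rule weak_eq[OF t \<phi>])
  qed
  then show ?thesis unfolding l2inner_def F_int[OF H(1)] .
qed

section \<open>Growth of the energy and control of the gradient\<close>

lemma DERIV_energy:
  assumes t: "t \<in> {0..<T}"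
  shows "(energy has_field_derivative 2 * l2inner (u' t) (u t)) (at t within {0..<T})"
  unfolding energy_def[abs_def]
  using has_field_derivative_l2inner[OF u_L2 u_L2 u'_L2[OF t] u'_L2[OF t] t u_deriv[OF t] u_deriv[OF t]]
  by (simp add: l2inner_commute)

lemma energy_dissipation:
  assumes t: "t \<in> {0..<T}"
  shows "\<kappa> * grad_energy t \<le> l2inner (u' t) (u t)"
proof -
  have t': "t \<in> {0..T}" using t by simp
  note aG = inL2_flux[OF t' G_L2[OF t]] and g = G_L2[OF t]
  have int: "integrable lborel (\<lambda>x. a j k t x * G t k x * G t j x)" for j k
    by (rule inL2_mult_integrable[OF aG g])
  have "\<kappa> * grad_energy t = (\<integral>x. \<kappa> * (\<Sum>i\<in>UNIV. (G t i x)\<^sup>2) \<partial>lborel)"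
    using inL2_integrable_square[OF g] by (simp add: grad_energy_def l2norm_def)
  also have "\<dots> \<le> (\<integral>x. (\<Sum>j\<in>UNIV. \<Sum>k\<in>UNIV. a j k t x * G t k x * G t j x) \<partial>lborel)"
  proof (rule integral_mono)
    show "integrable lborel (\<lambda>x. \<kappa> * (\<Sum>i\<in>UNIV. (G t i x)\<^sup>2))"
      using inL2_integrable_square[OF g] by simp
    show "integrable lborel (\<lambda>x. \<Sum>j\<in>UNIV. \<Sum>k\<in>UNIV. a j k t x * G t k x * G t j x)"
      using int by simp
    fix x
    have "(norm (\<chi> i. G t i x))\<^sup>2 = (\<Sum>i\<in>UNIV. (G t i x)\<^sup>2)"
      unfolding power2_norm_eq_inner inner_vec_def by (simp add: power2_eq_square)
    then show "\<kappa> * (\<Sum>i\<in>UNIV. (G t i x)\<^sup>2) \<le> (\<Sum>j\<in>UNIV. \<Sum>k\<in>UNIV. a j k t x * G t k x * G t j x)"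
      using a_elliptic[OF t', of "\<chi> i. G t i x" x] by (simp add: mult_ac)
  qed
  also have "\<dots> = (\<Sum>j\<in>UNIV. \<Sum>k\<in>UNIV. \<integral>x. a j k t x * G t k x * G t j x \<partial>lborel)"
    using int by simp
  also have "\<dots> = l2inner (u' t) (u t)"
    by (rule equation_pairing[OF t u_L2[OF t] g G_weak[OF t], symmetric])
  finally show ?thesis .
qed

lemma DERIV_energy_at:
  assumes "0 < t" "t < T"
  shows "(energy has_field_derivative 2 * l2inner (u' t) (u t)) (at t)"
proof -
  have "at t within {0..<T} = at t" using assms by (intro at_within_interior) simp
  then show ?thesis using DERIV_energy[of t] assms by simp
qed

lemma continuous_energy: "continuous_on {0..<T} energy"
  by (rule DERIV_continuous_on[OF DERIV_energy])

lemma energy_mono: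
  assumes "0 \<le> s" "s \<le> t" "t < T"
  shows "energy s \<le> energy t"
proof (rule DERIV_nonneg_imp_increasing_open[OF assms(2)])
  fix x assume "s < x" "x < t"
  moreover have "0 \<le> \<kappa> * grad_energy x" using kappa grad_energy_nonneg by simp
  ultimately have "0 \<le> 2 * l2inner (u' x) (u x)"
    using energy_dissipation[of x] assms by (simp del: zero_le_mult_iff)
  then show "\<exists>y. (energy has_real_derivative y) (at x) \<and> 0 \<le> y"
    using DERIV_energy_at[of x] \<open>s < x\<close> \<open>x < t\<close> assms by auto
next
  show "continuous_on {s..t} energy"
    by (rule continuous_on_subset[OF continuous_energy]) (use assms in auto)
qed

text \<open>The mean value theorem bounds the gradient at some unspecified time of the interval; the
  choice of times near the origin has to adapt to it.\<close>

lemma grad_energy_mean_value: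
  assumes "0 \<le> s" "s < t" "t < T"
  obtains \<xi> where "s < \<xi>" "\<xi> < t" "2 * \<kappa> * grad_energy \<xi> * (t - s) \<le> energy t - energy s"
proof -
  have cont: "continuous_on {s..t} energy"
    by (rule continuous_on_subset[OF continuous_energy]) (use assms in auto)
  have der: "(energy has_derivative (\<lambda>h. 2 * l2inner (u' x) (u x) * h)) (at x)" if "s < x" "x < t" for x
    using DERIV_energy_at[of x] that assms by (simp add: has_field_derivative_def)
  obtain \<xi> where \<xi>: "s < \<xi>" "\<xi> < t" "energy t - energy s = 2 * l2inner (u' \<xi>) (u \<xi>) * (t - s)"
    using mvt[OF assms(2) cont der] by blast
  have "\<kappa> * grad_energy \<xi> \<le> l2inner (u' \<xi>) (u \<xi>)"
    by (rule energy_dissipation) (use \<xi> assms in simp)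
  then have "(2 * (\<kappa> * grad_energy \<xi>)) * (t - s) \<le> (2 * l2inner (u' \<xi>) (u \<xi>)) * (t - s)"
    using assms by (intro mult_right_mono) auto
  then show ?thesis using that[OF \<xi>(1,2)] \<xi>(3) by (simp add: mult.assoc)
qed

text \<open>Symmetry of the coefficients leaves only the difference of the coefficients at the two times.\<close>

lemma cross_derivative_le:
  assumes p: "p \<in> {0..<T}" and q: "q \<in> {0..<T}" and ne: "p \<noteq> q"
  shows "\<bar>l2inner (u' p) (u q) - l2inner (u p) (u' q)\<bar>
    \<le> \<Lambda> * log_modulus \<bar>p - q\<bar> * (CARD('n) / 2 * (grad_energy p + grad_energy q))"
proof -
  have p': "p \<in> {0..T}" and q': "q \<in> {0..T}" using p q by auto
  let ?w = "\<Lambda> * log_modulus \<bar>p - q\<bar>"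
  have w: "0 \<le> ?w" using Lambda by (simp add: log_modulus_def)
  note gp = G_L2[OF p] and gq = G_L2[OF q]
  have int1: "integrable lborel (\<lambda>x. a j k p x * G p k x * G q j x)" for j k
    by (rule inL2_mult_integrable[OF inL2_flux[OF p' gp] gq])
  have int2: "integrable lborel (\<lambda>x. a j k q x * G p k x * G q j x)" for j k
    by (rule inL2_mult_integrable[OF inL2_flux[OF q' gp] gq])
  have diff: "(\<integral>x. a j k p x * G p k x * G q j x \<partial>lborel) - (\<integral>x. a j k q x * G p k x * G q j x \<partial>lborel)
      = (\<integral>x. (a j k p x - a j k q x) * (G p k x * G q j x) \<partial>lborel)" for j k
    unfolding Bochner_Integration.integral_diff[OF int1 int2, symmetric]
    by (simp only: left_diff_distrib mult.assoc)
  have e1: "l2inner (u' p) (u q) = (\<Sum>j\<in>UNIV. \<Sum>k\<in>UNIV. \<integral>x. a j k p x * G p k x * G q j x \<partial>lborel)"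
    by (rule equation_pairing[OF p u_L2[OF q] gq G_weak[OF q]])
  have "l2inner (u p) (u' q) = (\<Sum>k\<in>UNIV. \<Sum>j\<in>UNIV. \<integral>x. a k j q x * G q j x * G p k x \<partial>lborel)"
    unfolding l2inner_commute[of "u p"] by (rule equation_pairing[OF q u_L2[OF p] gp G_weak[OF p]])
  also have "\<dots> = (\<Sum>j\<in>UNIV. \<Sum>k\<in>UNIV. \<integral>x. a j k q x * G p k x * G q j x \<partial>lborel)"
    by (subst sum.swap) (simp add: a_sym[OF q'] mult_ac)
  finally have "l2inner (u' p) (u q) - l2inner (u p) (u' q)
      = (\<Sum>j\<in>UNIV. \<Sum>k\<in>UNIV. \<integral>x. (a j k p x - a j k q x) * (G p k x * G q j x) \<partial>lborel)"
    unfolding e1 by (simp only: sum_subtractf[symmetric] diff)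
  also have "\<bar>\<dots>\<bar> \<le> (\<Sum>j\<in>UNIV. \<Sum>k\<in>UNIV. ?w * (((l2norm (G p k))\<^sup>2 + (l2norm (G q j))\<^sup>2) / 2))"
  proof (intro order_trans[OF sum_abs] sum_mono)
    fix j k
    have int: "integrable lborel (\<lambda>x. \<bar>G p k x * G q j x\<bar>)"
      using inL2_mult_integrable[OF gp gq] by (rule integrable_abs)
    have intd: "integrable lborel (\<lambda>x. (a j k p x - a j k q x) * (G p k x * G q j x))"
      using int1[of j k] int2[of j k] by (simp add: left_diff_distrib mult.assoc)
    have "\<bar>\<integral>x. (a j k p x - a j k q x) * (G p k x * G q j x) \<partial>lborel\<bar>
        \<le> (\<integral>x. \<bar>(a j k p x - a j k q x) * (G p k x * G q j x)\<bar> \<partial>lborel)"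
      by (rule integral_abs_bound)
    also have "\<dots> \<le> (\<integral>x. ?w * \<bar>G p k x * G q j x\<bar> \<partial>lborel)"
    proof (rule integral_mono)
      show "\<bar>(a j k p x - a j k q x) * (G p k x * G q j x)\<bar> \<le> ?w * \<bar>G p k x * G q j x\<bar>" for x
        unfolding abs_mult[of "a j k p x - a j k q x"]
        by (intro mult_right_mono a_log_Lipschitz p' q' ne) simp
    qed (use int intd in \<open>auto intro: integrable_abs\<close>)
    also have "\<dots> = ?w * (\<integral>x. \<bar>G p k x * G q j x\<bar> \<partial>lborel)" by simp
    also have "\<dots> \<le> ?w * (((l2norm (G p k))\<^sup>2 + (l2norm (G q j))\<^sup>2) / 2)"
    proof (rule mult_left_mono[OF _ w])
      have "x * y \<le> (x\<^sup>2 + y\<^sup>2) / 2" for x y :: real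
        using sum_squares_bound[of x y] by simp
      then show "(\<integral>x. \<bar>G p k x * G q j x\<bar> \<partial>lborel) \<le> ((l2norm (G p k))\<^sup>2 + (l2norm (G q j))\<^sup>2) / 2"
        by (rule order_trans[OF abs_integral_mult_le[OF gp gq]])
    qed
    finally show "\<bar>\<integral>x. (a j k p x - a j k q x) * (G p k x * G q j x) \<partial>lborel\<bar>
        \<le> ?w * (((l2norm (G p k))\<^sup>2 + (l2norm (G q j))\<^sup>2) / 2)" .
  qed
  also have "\<dots> = ?w * (CARD('n) / 2 * (grad_energy p + grad_energy q))"
    by (simp add: sum_distrib_left[symmetric] sum.distrib sum_divide_distrib[symmetric] grad_energy_def
        distrib_left add_divide_distrib, simp add: mult_ac)
  finally show ?thesis .
qed

text \<open>For constant coefficients \<open>l2inner (u (t + s)) (u (t - s))\<close> does not depend on \<open>s\<close>; in general its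
  derivative is absorbed by the growth of the energy. With the Cauchy-Schwarz inequality this is a
  perturbed log-convexity of the energy.\<close>

lemma three_point:
  assumes h: "0 < h" "h \<le> t" "t + h < T"
    and e: "\<And>s. 0 < s \<Longrightarrow> s < h \<Longrightarrow> CARD('n) * \<Lambda> / (4 * \<kappa>) * log_modulus (2 * s) \<le> e"
  shows "energy t \<le> l2inner (u (t + h)) (u (t - h)) + e * (energy (t + h) - energy (t - h))"
proof -
  \<comment> \<open>At s = 0 the correction vanishes and \<psi> is the energy at t; at s = h it is
    the right-hand side. It remains to show that \<psi> is nondecreasing.\<close>
  define \<psi> where "\<psi> s = l2inner (u (t + s)) (u (t - s)) + e * (energy (t + s) - energy (t - s))" for s
  define \<psi>' where "\<psi>' s = (l2inner (u' (t + s)) (u (t - s)) - l2inner (u (t + s)) (u' (t - s)))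
      + e * (2 * l2inner (u' (t + s)) (u (t + s)) + 2 * l2inner (u' (t - s)) (u (t - s)))" for s
  have der: "(\<psi> has_field_derivative \<psi>' s) (at s within {0..h})" if s: "s \<in> {0..h}" for s
  proof -
    have in1: "t + r \<in> {0..<T}" and in2: "t - r \<in> {0..<T}" if "r \<in> {0..h}" for r using that h by auto
    have f1: "filterlim (\<lambda>r. t + r) (at (t + s) within {0..<T}) (at s within {0..h})"
      unfolding filterlim_at
    proof
      show "\<forall>\<^sub>F r in at s within {0..h}. t + r \<in> {0..<T} \<and> t + r \<noteq> t + s"
        using in1 by (auto simp: eventually_at_topological intro!: exI[of _ UNIV])
      show "((\<lambda>r. t + r) \<longlongrightarrow> t + s) (at s within {0..h})" by (intro tendsto_intros)
    qed
    have f2: "filterlim (\<lambda>r. t - r) (at (t - s) within {0..<T}) (at s within {0..h})"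
      unfolding filterlim_at
    proof
      show "\<forall>\<^sub>F r in at s within {0..h}. t - r \<in> {0..<T} \<and> t - r \<noteq> t - s"
        using in2 by (auto simp: eventually_at_topological intro!: exI[of _ UNIV])
      show "((\<lambda>r. t - r) \<longlongrightarrow> t - s) (at s within {0..h})" by (intro tendsto_intros)
    qed
    have d1: "((\<lambda>r. l2norm (\<lambda>x. (u (t + r) x - u (t + s) x) / (r - s) - u' (t + s) x)) \<longlongrightarrow> 0) (at s within {0..h})"
      using filterlim_compose[OF u_deriv[OF in1[OF s]] f1] by simp
    have "((\<lambda>r. l2norm (\<lambda>x. (u (t - r) x - u (t - s) x) / ((t - r) - (t - s)) - u' (t - s) x)) \<longlongrightarrow> 0) (at s within {0..h})"
      by (rule filterlim_compose[OF u_deriv[OF in2[OF s]] f2])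
    \<comment> \<open>Time runs backwards in this factor, so its derivative with respect to s is -
      u' (t - s).\<close>
    moreover have "l2norm (\<lambda>x. (u (t - r) x - u (t - s) x) / ((t - r) - (t - s)) - u' (t - s) x)
        = l2norm (\<lambda>x. (u (t - r) x - u (t - s) x) / (r - s) - (- 1) * u' (t - s) x)" for r
    proof -
      have "(u (t - r) x - u (t - s) x) / ((t - r) - (t - s)) - u' (t - s) x
          = (- 1) * ((u (t - r) x - u (t - s) x) / (r - s) - (- 1) * u' (t - s) x)" for x
      proof -
        have "(t - r) - (t - s) = - (r - s)" by simp
        then show ?thesis by (simp only: minus_divide_right[symmetric]) simp
      qed
      then show ?thesis by (simp only: l2norm_cmult abs_minus_cancel abs_one mult_1)
    qed
    ultimately have d2: "((\<lambda>r. l2norm (\<lambda>x. (u (t - r) x - u (t - s) x) / (r - s) - (- 1) * u' (t - s) x)) \<longlongrightarrow> 0) (at s within {0..h})"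
      by simp
    have U1: "inL2 (u (t + r))" and U2: "inL2 (u (t - r))" if "r \<in> {0..h}" for r
      using u_L2[OF in1[OF that]] u_L2[OF in2[OF that]] .
    have V1: "inL2 (u' (t + s))" and V2: "inL2 (\<lambda>x. (- 1) * u' (t - s) x)"
      using u'_L2[OF in1[OF s]] inL2_cmult[OF u'_L2[OF in2[OF s]], of "- 1"] .
    have c: "((\<lambda>r. l2inner (u (t + r)) (u (t - r))) has_field_derivative
        l2inner (u' (t + s)) (u (t - s)) + l2inner (u (t + s)) (\<lambda>x. (- 1) * u' (t - s) x)) (at s within {0..h})"
      by (rule has_field_derivative_l2inner[OF U1 U2 V1 V2 s d1 d2])
    have c': "l2inner (u (t + s)) (\<lambda>x. (- 1) * u' (t - s) x) = - l2inner (u (t + s)) (u' (t - s))"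
      by (simp add: l2inner_def)
    have e1: "((\<lambda>r. energy (t + r)) has_field_derivative 2 * l2inner (u' (t + s)) (u (t + s))) (at s within {0..h})"
      unfolding energy_def using has_field_derivative_l2inner[OF U1 U1 V1 V1 s d1 d1]
      by (simp add: l2inner_commute)
    have e2: "((\<lambda>r. energy (t - r)) has_field_derivative 2 * l2inner (\<lambda>x. (- 1) * u' (t - s) x) (u (t - s))) (at s within {0..h})"
      unfolding energy_def using has_field_derivative_l2inner[OF U2 U2 V2 V2 s d2 d2]
      by (simp add: l2inner_commute)
    have e2': "l2inner (\<lambda>x. (- 1) * u' (t - s) x) (u (t - s)) = - l2inner (u' (t - s)) (u (t - s))"
      by (simp add: l2inner_def)
    have "(\<psi> has_field_derivative
        (l2inner (u' (t + s)) (u (t - s)) + l2inner (u (t + s)) (\<lambda>x. (- 1) * u' (t - s) x))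
        + e * (2 * l2inner (u' (t + s)) (u (t + s)) - 2 * l2inner (\<lambda>x. (- 1) * u' (t - s) x) (u (t - s)))) (at s within {0..h})"
      unfolding \<psi>_def[abs_def] by (intro DERIV_add DERIV_cmult DERIV_diff c e1 e2)
    then show ?thesis unfolding c' e2' \<psi>'_def by simp
  qed
  have "\<psi> 0 \<le> \<psi> h"
  proof (rule DERIV_nonneg_imp_increasing_open[of 0 h \<psi>])
    show "0 \<le> h" using h by simp
    show "continuous_on {0..h} \<psi>" by (rule DERIV_continuous_on[OF der])
    fix s assume s: "0 < s" "s < h"
    have "at s within {0..h} = at s" using s by (intro at_within_interior) simp
    then have d: "(\<psi> has_real_derivative \<psi>' s) (at s)" using der[of s] s by simp
    have i: "t + s \<in> {0..<T}" "t - s \<in> {0..<T}" "t + s \<noteq> t - s" using s h by auto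
    let ?E = "grad_energy (t + s) + grad_energy (t - s)"
    have E: "0 \<le> ?E" by (intro add_nonneg_nonneg grad_energy_nonneg)
    have abs: "\<bar>(t + s) - (t - s)\<bar> = 2 * s" using s by simp
    have "0 \<le> CARD('n) * \<Lambda> / (4 * \<kappa>) * log_modulus (2 * s)"
      using Lambda kappa s by (simp add: log_modulus_def)
    then have e0: "0 \<le> e" using e[OF s] by linarith
    \<comment> \<open>The cross term carries n / 2 times the gradient energies, the growth of the
      energy at least 2 * \<kappa> times them; the quotient explains n * \<Lambda> / (4 *
      \<kappa>).\<close>
    have "\<Lambda> * log_modulus (2 * s) * (CARD('n) / 2 * ?E)
        = (CARD('n) * \<Lambda> / (4 * \<kappa>) * log_modulus (2 * s)) * (2 * \<kappa> * ?E)"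
      using kappa by (simp add: field_simps)
    also have "\<dots> \<le> e * (2 * \<kappa> * ?E)"
      by (rule mult_right_mono[OF e[OF s]]) (use kappa E in simp)
    also have "\<dots> = e * (2 * (\<kappa> * grad_energy (t + s)) + 2 * (\<kappa> * grad_energy (t - s)))"
      by (simp add: algebra_simps)
    also have "\<dots> \<le> e * (2 * l2inner (u' (t + s)) (u (t + s)) + 2 * l2inner (u' (t - s)) (u (t - s)))"
      using energy_dissipation[OF i(1)] energy_dissipation[OF i(2)] by (intro mult_left_mono e0) linarith
    finally have "0 \<le> \<psi>' s"
      using cross_derivative_le[OF i] unfolding \<psi>'_def abs by linarith
    then show "\<exists>y. (\<psi> has_real_derivative y) (at s) \<and> 0 \<le> y" using d by blast
  qed
  then show ?thesis by (simp add: \<psi>_def energy_def)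
qed

end

section \<open>Discrete log-convexity\<close>

text \<open>Put y2 = y1 * exp b and y0 = y1 * exp (- (b + 2 * d)). The geometric mean is y1 * exp (-
  d), so a positive excess d must be paid by the error term, which gives d \<le> 8 * \<epsilon> * b.
  Positivity of y0 holds because for y0 = 0 the error term alone would have to reach y1.\<close>

lemma log_ratio_step:
  fixes y0 y1 y2 \<epsilon> :: real
  assumes y: "0 \<le> y0" "y0 \<le> y1" "y1 \<le> y2" "0 < y1"
    and step: "y1 \<le> sqrt (y2 * y0) + \<epsilon> * (y2 - y0)"
    and eps: "0 \<le> \<epsilon>" "\<epsilon> \<le> 1 / 8"
    and b: "ln y2 - ln y1 \<le> 1"
  shows "0 < y0" and "ln y1 - ln y0 \<le> (ln y2 - ln y1) * (1 + 24 * \<epsilon>)"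
proof -
  define b where "b = ln y2 - ln y1"
  have y2: "0 < y2" using y by linarith
  have b0: "0 \<le> b" "b \<le> 1" using y y2 assms(8) by (auto simp: b_def)
  have y2_eq: "y2 = y1 * exp b" using y y2 by (simp add: b_def exp_diff)
  have eb: "exp b \<le> 1 + 2 * b"
  proof -
    have "exp b \<le> 1 + b + b\<^sup>2" by (rule exp_bound[OF b0])
    moreover have "b\<^sup>2 \<le> b" using b0 by (simp add: power2_eq_square mult_left_le)
    ultimately show ?thesis by linarith
  qed
  show y0: "0 < y0"
  proof (rule ccontr)
    assume "\<not> 0 < y0"
    then have "y0 = 0" using y by simp
    then have "y1 \<le> \<epsilon> * y2" using step by simp
    also have "\<dots> \<le> 1 / 8 * y2" using eps y2 by (intro mult_right_mono) auto
    also have "\<dots> \<le> 1 / 8 * (y1 * 3)" unfolding y2_eq using eb b0 y by (intro mult_left_mono) auto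
    finally show False using y by simp
  qed
  define d where "d = (ln y1 - ln y0 - b) / 2"
  show "ln y1 - ln y0 \<le> (ln y2 - ln y1) * (1 + 24 * \<epsilon>)"
  proof (cases "d \<le> 0")
    case True
    then have "ln y1 - ln y0 \<le> b" by (simp add: d_def)
    also have "\<dots> \<le> b * (1 + 24 * \<epsilon>)" using b0 eps by (simp add: distrib_left)
    finally show ?thesis by (simp add: b_def)
  next
    case False
    then have d: "0 < d" by simp
    have d2: "2 * d = ln y1 - ln y0 - b" by (simp add: d_def)
    then have "- (b + 2 * d) = ln y0 - ln y1" by linarith
    then have y0_eq: "y0 = y1 * exp (- (b + 2 * d))" using y y0 by (simp only: exp_diff exp_ln) simp
    have "y2 * y0 = (y1 * exp (- d))\<^sup>2"
      unfolding y2_eq y0_eq by (simp add: power2_eq_square mult_exp_exp algebra_simps)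
    then have "sqrt (y2 * y0) = y1 * exp (- d)" using y by simp
    then have "y1 * 1 \<le> y1 * (exp (- d) + \<epsilon> * (exp b - exp (- (b + 2 * d))))"
      using step unfolding y2_eq y0_eq by (simp add: algebra_simps)
    then have main: "1 \<le> exp (- d) + \<epsilon> * (exp b - exp (- (b + 2 * d)))"
      using y by (simp only: mult_le_cancel_left_pos)
    have le1: "exp b - exp (- (b + 2 * d)) \<le> 3 * b + 2 * d"
      using eb exp_ge_add_one_self[of "- (b + 2 * d)"] by linarith
    have le2: "exp b - exp (- (b + 2 * d)) \<le> 3" using eb b0 exp_gt_zero[of "- (b + 2 * d)"] by linarith
    \<comment> \<open>A crude bound first: with exp (- d) \<ge> 5 / 8 the loss 1 - exp (- d) is at
      least 5 / 8 * d, so that 2 * \<epsilon> * d \<le> d / 4 can be absorbed.\<close>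
    have "\<epsilon> * (exp b - exp (- (b + 2 * d))) \<le> \<epsilon> * 3" by (rule mult_left_mono[OF le2 eps(1)])
    then have ed: "5 / 8 \<le> exp (- d)" using main eps by linarith
    have "exp (- d) * (1 + d) \<le> exp (- d) * exp d" by (intro mult_left_mono exp_ge_add_one_self) simp
    then have "exp (- d) * d \<le> 1 - exp (- d)" by (simp add: distrib_left mult_exp_exp)
    moreover have "5 / 8 * d \<le> exp (- d) * d" using ed d by (intro mult_right_mono) auto
    moreover have "\<epsilon> * (exp b - exp (- (b + 2 * d))) \<le> \<epsilon> * (3 * b + 2 * d)" by (rule mult_left_mono[OF le1 eps(1)])
    ultimately have "5 / 8 * d \<le> \<epsilon> * (3 * b + 2 * d)" using main by linarith
    also have "\<dots> = 3 * (\<epsilon> * b) + 2 * (\<epsilon> * d)" by (simp add: algebra_simps)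
    also have "\<epsilon> * d \<le> 1 / 8 * d" using eps d by (intro mult_right_mono) auto
    finally have "d \<le> 8 * (\<epsilon> * b)" by simp
    moreover have "0 \<le> \<epsilon> * b" using eps b0 by simp
    ultimately have "b + 2 * d \<le> b * (1 + 24 * \<epsilon>)" by (simp add: algebra_simps)
    then show ?thesis using d2 unfolding b_def[symmetric] by linarith
  qed
qed

text \<open>Pigeonhole on a telescoping sum: not all increments exceed their average.\<close>

lemma small_increment_exists:
  fixes f :: "nat \<Rightarrow> real"
  assumes "0 < n" "f (a + n) - f a \<le> B"
  obtains i where "a \<le> i" "i < a + n" "f (Suc i) - f i \<le> B / n"
proof -
  have "\<exists>i<n. f (Suc (a + i)) - f (a + i) \<le> B / n"
  proof (rule ccontr)
    assume "\<not> ?thesis"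
    then have "(\<Sum>i<n. B / n) < (\<Sum>i<n. f (a + Suc i) - f (a + i))"
      using assms(1) by (intro sum_strict_mono) (auto simp: not_le)
    also have "\<dots> = f (a + n) - f a" by (subst sum_lessThan_telescope[of "\<lambda>i. f (a + i)"]) simp
    finally show False using assms by simp
  qed
  then obtain i where "i < n" "f (Suc (a + i)) - f (a + i) \<le> B / n" by blast
  then show ?thesis using that[of "a + i"] by simp
qed

locale log_convex_profile =
  fixes y :: "real \<Rightarrow> real" and T2 C \<tau> :: real
  assumes C: "0 < C" and tau: "0 < \<tau>" "48 * C * \<tau> \<le> 1"
    and nonneg: "\<And>t. 0 \<le> y t"
    and mono: "\<And>s t. 0 \<le> s \<Longrightarrow> s \<le> t \<Longrightarrow> t \<le> T2 \<Longrightarrow> y s \<le> y t"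
    and step: "\<And>(m :: nat) (i :: nat). 4 \<le> m \<Longrightarrow> 1 \<le> i \<Longrightarrow> (real i + 1) / m \<le> T2 \<Longrightarrow>
        y (i / m) \<le> sqrt (y ((real i + 1) / m) * y ((real i - 1) / m))
          + C * ln m / m * (y ((real i + 1) / m) - y ((real i - 1) / m))"
begin

text \<open>The summands ensure in turn m \<ge> 4, \<tau> * m \<ge> 8, and C * ln m / m \<le> 1 /
  32, the last one through ln m \<le> 2 * sqrt m.\<close>

definition M0 :: real where "M0 = 4 + 8 / \<tau> + (64 * C)\<^sup>2"

lemma M0_props:
  assumes "M0 \<le> real m"
  shows "4 \<le> m" "8 \<le> \<tau> * m" "0 \<le> C * ln m / m" "C * ln m / m \<le> 1 / 32"
proof -
  have pos: "0 \<le> 8 / \<tau>" "0 \<le> (64 * C)\<^sup>2" using tau by simp_all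
  have "4 \<le> real m" using assms pos unfolding M0_def by linarith
  then show m4: "4 \<le> m" by simp
  then have m: "1 \<le> real m" by simp
  have "8 / \<tau> \<le> real m" using assms pos unfolding M0_def by linarith
  then show "8 \<le> \<tau> * m" using tau by (simp add: field_simps)
  show "0 \<le> C * ln m / m" using C m by simp
  have "(64 * C)\<^sup>2 \<le> real m" using assms pos unfolding M0_def by linarith
  then have s: "64 * C \<le> sqrt m" by (rule real_le_rsqrt)
  have "ln (sqrt m) \<le> sqrt m - 1" by (rule ln_le_minus_one) (use m in simp)
  then have "ln m \<le> 2 * sqrt m" using m by (simp add: ln_sqrt)
  then have "32 * C * ln m \<le> 32 * C * (2 * sqrt m)" using C by (intro mult_left_mono) auto
  also have "\<dots> = 64 * C * sqrt m" by simp
  also have "\<dots> \<le> sqrt m * sqrt m" using s by (intro mult_right_mono) auto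
  also have "\<dots> = m" by simp
  finally show "C * ln m / m \<le> 1 / 32" using m by (simp add: field_simps)
qed

text \<open>One step multiplies the increment by at most 1 + 24 * C * ln m / m, hence \<tau> * m
  steps by at most exp (24 * C * \<tau> * ln m) \<le> sqrt m. Starting from 1 / sqrt m the
  increments stay at most 1, which is what the next step requires.\<close>

lemma descend:
  fixes m i k :: nat
  assumes m: "M0 \<le> real m" and T2: "(real i + 1) / m \<le> T2" and pos: "0 < y (i / m)"
    and start: "ln (y ((real i + 1) / m)) - ln (y (i / m)) \<le> 1 / sqrt m"
    and k: "k < i" "k \<le> \<tau> * m"
  shows "0 < y (real (i - k) / m)" "ln (y ((real (i - k) + 1) / m)) - ln (y (real (i - k) / m)) \<le> 1"
proof -
  note M = M0_props[OF m]
  let ?\<epsilon> = "C * ln m / m"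
  have m0: "0 < real m" using M(1) by simp
  let ?r = "1 + 24 * ?\<epsilon>"
  have r1: "1 \<le> ?r" using M by simp
  have growth: "1 / sqrt m * ?r ^ j \<le> 1" if "j \<le> \<tau> * m" for j :: nat
  proof -
    have "?r ^ j \<le> exp (24 * ?\<epsilon>) ^ j"
      using r1 exp_ge_add_one_self[of "24 * ?\<epsilon>"] by (intro power_mono) auto
    also have "\<dots> = exp (real j * (24 * ?\<epsilon>))" by (simp only: exp_of_nat_mult)
    also have "\<dots> \<le> exp (ln m / 2)"
    proof -
      have "real j * (24 * ?\<epsilon>) \<le> (\<tau> * m) * (24 * ?\<epsilon>)"
        using that M(3) by (intro mult_right_mono) auto
      also have "\<dots> = 24 * C * \<tau> * ln m" using m0 by simp
      also have "\<dots> \<le> 1 / 2 * ln m" using tau M(1) by (intro mult_right_mono) auto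
      finally show ?thesis by simp
    qed
    also have "\<dots> = sqrt m" using m0 by (simp add: ln_sqrt[symmetric])
    finally show ?thesis using m0 by (simp add: field_simps)
  qed
  have main: "k < i \<Longrightarrow> k \<le> \<tau> * m \<Longrightarrow> 0 < y (real (i - k) / m) \<and>
      ln (y ((real (i - k) + 1) / m)) - ln (y (real (i - k) / m)) \<le> 1 / sqrt m * ?r ^ k"
  proof (induction k)
    case 0
    then show ?case using pos start by simp
  next
    case (Suc k)
    then have IH: "0 < y (real (i - k) / m)"
      "ln (y ((real (i - k) + 1) / m)) - ln (y (real (i - k) / m)) \<le> 1 / sqrt m * ?r ^ k" by auto
    let ?j = "i - k"
    have j: "1 \<le> ?j" "real (i - Suc k) = real ?j - 1" using Suc.prems by auto
    have jT: "(real ?j + 1) / m \<le> T2"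
      using T2 divide_right_mono[of "real ?j + 1" "real i + 1" "real m"] m0 by simp
    have mono1: "y ((real ?j - 1) / m) \<le> y (?j / m)"
    proof (rule mono)
      show "0 \<le> (real ?j - 1) / m" using j(1) m0 by simp
      show "(real ?j - 1) / m \<le> ?j / m" by (intro divide_right_mono) auto
      have "?j / m \<le> (real ?j + 1) / m" by (intro divide_right_mono) auto
      then show "?j / m \<le> T2" using jT by linarith
    qed
    have mono2: "y (?j / m) \<le> y ((real ?j + 1) / m)"
      using jT m0 by (intro mono) (auto simp: divide_right_mono)
    have b1: "ln (y ((real ?j + 1) / m)) - ln (y (?j / m)) \<le> 1"
      using IH(2) growth[of k] Suc.prems by simp
    have e: "?\<epsilon> \<le> 1 / 8" using M(4) by linarith
    note s = log_ratio_step[OF nonneg mono1 mono2 IH(1) step[OF M(1) j(1) jT] M(3) e b1]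
    have "ln (y (?j / m)) - ln (y ((real ?j - 1) / m)) \<le> (1 / sqrt m * ?r ^ k) * ?r"
      using s(2) mult_right_mono[OF IH(2), of ?r] r1 by linarith
    then show ?case using s(1) unfolding j(2) by (simp add: mult_ac)
  qed
  show "0 < y (real (i - k) / m)" using main k by blast
  show "ln (y ((real (i - k) + 1) / m)) - ln (y (real (i - k) / m)) \<le> 1"
    using main growth[of k] k by linarith
qed

lemma descend_total:
  fixes m i k :: nat
  assumes m: "M0 \<le> real m" and T2: "(real i + 1) / m \<le> T2" and pos: "0 < y (i / m)"
    and start: "ln (y ((real i + 1) / m)) - ln (y (i / m)) \<le> 1 / sqrt m"
    and k: "k < i" "k \<le> \<tau> * m"
  shows "ln (y (i / m)) - ln (y (real (i - k) / m)) \<le> k"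
  using k
proof (induction k)
  case (Suc k)
  have "real (i - Suc k) + 1 = real (i - k)" using Suc.prems by simp
  then have "ln (y (real (i - k) / m)) - ln (y (real (i - Suc k) / m)) \<le> 1"
    using descend(2)[OF m T2 pos start Suc.prems] by simp
  then show ?case using Suc.IH Suc.prems by simp
qed simp

text \<open>On a time interval of length \<open>\<tau>\<close> the frequency grows at most by the factor \<open>sqrt m\<close>;
  the mesh is then refined from \<open>1 / m\<close> to \<open>1 / m\<^sup>2\<close>.\<close>

lemma reach_origin:
  fixes m i J :: nat
  assumes "M0 \<le> real m" "(real i + 1) / m \<le> T2" "0 < y (i / m)"
    and "ln (y ((real i + 1) / m)) - ln (y (i / m)) \<le> 1 / sqrt m"
    and "\<tau> / 4 \<le> i / m" "i / m \<le> \<tau> + J * \<tau> / 4"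
  shows "\<exists>n::nat. m \<le> n \<and> n \<le> m ^ 2 ^ J \<and> 0 < y (1 / n) \<and> ln (y (3 / n)) - ln (y (1 / n)) \<le> 2
    \<and> 3 / n \<le> T2 \<and> ln (y (i / m)) - ln (y (1 / n)) \<le> (J + 1) * (\<tau> + 1) * real m ^ 2 ^ J"
  using assms
proof (induction J arbitrary: m i)
  case 0
  note M = M0_props[OF 0(1)] and d = descend[OF 0(1-4)] and dt = descend_total[OF 0(1-4)]
  have m0: "0 < real m" using M(1) by simp
  have "\<tau> * m \<le> 4 * real i" using 0(5) m0 by (simp add: field_simps)
  then have i2: "2 \<le> i" using M(2) by linarith
  have i\<tau>: "real i \<le> \<tau> * m" using 0(6) m0 by (simp add: field_simps)
  have e1: "i - (i - 1) = 1" "i - (i - 2) = 2" using i2 by auto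
  \<comment> \<open>At most \<tau> * m steps remain, so a single descent reaches index 1; its last
    two increments, each at most 1, compare the values at 3 / m and 1 / m.\<close>
  have p1: "0 < y (1 / m)" and r1: "ln (y (2 / m)) - ln (y (1 / m)) \<le> 1"
    using d[of "i - 1"] i2 i\<tau> unfolding e1 by (auto simp: of_nat_diff)
  have r2: "ln (y (3 / m)) - ln (y (2 / m)) \<le> 1"
    using d(2)[of "i - 2"] i2 i\<tau> unfolding e1 by (auto simp: of_nat_diff)
  have t: "ln (y (i / m)) - ln (y (1 / m)) \<le> real (i - 1)"
    using dt[of "i - 1"] i2 i\<tau> unfolding e1 by (auto simp: of_nat_diff)
  have "3 / m \<le> (real i + 1) / m" using i2 m0 by (intro divide_right_mono) auto
  then have "3 / m \<le> T2" using 0(2) by linarith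
  moreover have "real (i - 1) \<le> (\<tau> + 1) * m" using i\<tau> m0 i2 by (simp add: distrib_right of_nat_diff)
  ultimately show ?case using p1 r1 r2 t by (intro exI[of _ m]) auto
next
  case (Suc J)
  note M = M0_props[OF Suc.prems(1)]
  have m0: "0 < real m" and m1: "1 \<le> real m" using M(1) by simp_all
  have mp: "m \<le> m ^ 2 ^ Suc J"
    using M(1) by (intro self_le_power) auto
  have mpr: "real m \<le> real m ^ 2 ^ Suc J"
    using m1 by (intro self_le_power) auto
  show ?case
  proof (cases "i / m \<le> \<tau> + J * \<tau> / 4")
    case True
    from Suc.IH[OF Suc.prems(1-5) True] obtain n where n: "m \<le> n" "n \<le> m ^ 2 ^ J" "0 < y (1 / n)"
      "ln (y (3 / n)) - ln (y (1 / n)) \<le> 2" "3 / n \<le> T2"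
      "ln (y (i / m)) - ln (y (1 / n)) \<le> (J + 1) * (\<tau> + 1) * real m ^ 2 ^ J" by blast
    have "m ^ 2 ^ J \<le> m ^ 2 ^ Suc J" using M(1) by (intro power_increasing) auto
    moreover have "(J + 1) * (\<tau> + 1) * real m ^ 2 ^ J \<le> (Suc J + 1) * (\<tau> + 1) * real m ^ 2 ^ Suc J"
      using m1 tau by (intro mult_mono power_increasing) auto
    ultimately show ?thesis using n by (intro exI[of _ n]) auto
  next
    case False
    \<comment> \<open>Half a stretch: the lower end stays at least at \<tau> / 2, as the induction
      needs room below, and the time still drops by \<tau> / 4 after rounding.\<close>
    define k where "k = nat \<lfloor>\<tau> * m / 2\<rfloor>"
    have "0 \<le> \<tau> * m / 2" using tau m0 by simp
    then have "real k = of_int \<lfloor>\<tau> * m / 2\<rfloor>" by (simp add: k_def)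
    then have k: "real k \<le> \<tau> * m / 2" "\<tau> * m / 2 - 1 < real k" by linarith+
    have "\<tau> \<le> i / m" using False tau by (smt (verit, best) divide_nonneg_pos mult_nonneg_nonneg of_nat_0_le_iff)
    then have i\<tau>: "\<tau> * m \<le> real i" using m0 by (simp add: field_simps)
    have ki: "k < i" "real k \<le> \<tau> * m" using k i\<tau> M(2) by linarith+
    note d = descend[OF Suc.prems(1-4) ki] and dt = descend_total[OF Suc.prems(1-4) ki]
    define j where "j = i - k"
    have j: "real j = real i - real k" using ki by (simp add: j_def of_nat_diff)
    let ?n = "m ^ 2"
    have n_real: "real ?n = real m * real m" by (simp add: power2_eq_square)
    have scale: "real (j * m + l) / real ?n = real j / m + real l / ?n" for l
      using m0 by (simp add: power2_eq_square field_simps)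
    have eq0: "real (j * m) / real ?n = real j / m" using scale[of 0] by simp
    have eq1: "real (j * m + m) / real ?n = (real j + 1) / m"
      using m0 by (simp add: power2_eq_square field_simps)
    have "ln (y (real (j * m + m) / ?n)) - ln (y (real (j * m) / ?n)) \<le> 1"
      unfolding eq0 eq1 using d(2) by (simp add: j_def)
    \<comment> \<open>The cell from j / m to (j + 1) / m has increment at most 1. One of its m
      subcells has increment at most 1 / m, the starting value required for the mesh 1 /
      m^2.\<close>
    from small_increment_exists[of m "\<lambda>l. ln (y (real l / ?n))", OF _ this] M(1)
    obtain l where l: "j * m \<le> l" "l < j * m + m"
      "ln (y (real (Suc l) / ?n)) - ln (y (real l / ?n)) \<le> 1 / m" by auto
    have jl: "real j / m \<le> real l / ?n"
      unfolding eq0[symmetric] by (intro divide_right_mono of_nat_mono l(1) of_nat_0_le_iff)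
    have lj: "(real l + 1) / ?n \<le> (real j + 1) / m"
    proof -
      have "real l + 1 \<le> real (j * m + m)" using l(2) by linarith
      then show ?thesis unfolding eq1[symmetric] by (intro divide_right_mono of_nat_0_le_iff)
    qed
    have ji: "(real j + 1) / m \<le> (real i + 1) / m" using m0 j by (intro divide_right_mono) auto
    have lT: "(real l + 1) / ?n \<le> T2" using lj ji Suc.prems(2) by linarith
    have ll: "real l / ?n \<le> (real l + 1) / ?n" by (intro divide_right_mono) auto
    have mono_jl: "y (real j / m) \<le> y (real l / ?n)"
      by (rule mono) (use jl lT ll m0 in auto)
    have pj: "0 < y (real j / m)" using d(1) by (simp add: j_def)
    have a1: "M0 \<le> real ?n" using Suc.prems(1) mult_left_mono[OF m1, of "real m"] unfolding n_real by linarith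
    have a3: "0 < y (real l / ?n)" using pj mono_jl by linarith
    have a4: "ln (y ((real l + 1) / ?n)) - ln (y (real l / ?n)) \<le> 1 / sqrt ?n"
      using l(3) m0 by (simp add: add.commute)
    have "\<tau> / 2 * m \<le> real j" using j k i\<tau> by simp
    then have "\<tau> / 2 \<le> real j / m" using m0 by (simp add: field_simps)
    then have a5: "\<tau> / 4 \<le> real l / ?n" using jl tau by linarith
    have "real l / ?n \<le> (real j + 1) / m" using ll lj by linarith
    also have "\<dots> \<le> (real i - \<tau> * m / 2 + 2) / m" using j k m0 by (intro divide_right_mono) auto
    also have "\<dots> = i / m - \<tau> / 2 + 2 / m" using m0 by (simp add: field_simps)
    \<comment> \<open>Rounding k and the position within the cell lose 2 / m, which is at most
      \<tau> / 4 because 8 \<le> \<tau> * m.\<close>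
    also have "\<dots> \<le> i / m - \<tau> / 4" using M(2) m0 by (simp add: field_simps)
    also have "\<dots> \<le> \<tau> + J * \<tau> / 4"
    proof -
      have "Suc J * \<tau> / 4 = J * \<tau> / 4 + \<tau> / 4" by (simp add: distrib_right add_divide_distrib)
      then show ?thesis using Suc.prems(6) by linarith
    qed
    finally have a6: "real l / ?n \<le> \<tau> + J * \<tau> / 4" .
    from Suc.IH[OF a1 lT a3 a4 a5 a6] obtain n where n: "?n \<le> n" "n \<le> ?n ^ 2 ^ J" "0 < y (1 / n)"
      "ln (y (3 / n)) - ln (y (1 / n)) \<le> 2" "3 / n \<le> T2"
      "ln (y (real l / ?n)) - ln (y (1 / n)) \<le> (J + 1) * (\<tau> + 1) * real ?n ^ 2 ^ J" by blast
    have pw: "?n ^ 2 ^ J = m ^ 2 ^ Suc J" by (simp add: power_mult[symmetric])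
    have pwr: "real ?n ^ 2 ^ J = real m ^ 2 ^ Suc J" by (simp add: power_mult[symmetric])
    have "m \<le> ?n" using M(1) by (intro self_le_power) auto
    then have mn: "m \<le> n" using n(1) by linarith
    have "ln (y (i / m)) - ln (y (real l / ?n)) \<le> k"
      using dt ln_mono[OF mono_jl pj] unfolding j_def by linarith
    also have "real k \<le> (\<tau> + 1) * real m ^ 2 ^ Suc J"
    proof -
      have "real k \<le> (\<tau> + 1) * m" using ki(2) m0 by (simp add: distrib_right)
      also have "\<dots> \<le> (\<tau> + 1) * real m ^ 2 ^ Suc J" using mpr tau by (intro mult_left_mono) auto
      finally show ?thesis .
    qed
    finally have "ln (y (i / m)) - ln (y (1 / n)) \<le> (\<tau> + 1) * real m ^ 2 ^ Suc J + (J + 1) * (\<tau> + 1) * real m ^ 2 ^ Suc J"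
      using n(6) unfolding pwr by linarith
    also have "\<dots> = (Suc J + 1) * (\<tau> + 1) * real m ^ 2 ^ Suc J" by (simp add: algebra_simps)
    finally show ?thesis using n mn unfolding pw by (intro exI[of _ n]) auto
  qed
qed

text \<open>At least (T2 - T1) * m / 2 cells between T1 and T2 share the increment B, so one of them
  has at most 2 * B / ((T2 - T1) * m). The lower bound on m that is quadratic in B makes this at
  most 1 / sqrt m. The bound on J lets J quarter stretches \<tau> / 4 cover T2.\<close>

lemma profile_bound:
  fixes m J :: nat
  assumes T1: "\<tau> \<le> T1" "T1 < T2" and y1: "0 < y T1" and B: "ln (y T2) - ln (y T1) \<le> B" "0 \<le> B"
    and m: "M0 \<le> real m" "4 \<le> (T2 - T1) * m" "(2 * B / (T2 - T1))\<^sup>2 \<le> m"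
    and J: "4 * T2 / \<tau> \<le> J"
  obtains n :: nat where "m \<le> n" "n \<le> m ^ 2 ^ J" "0 < y (1 / n)" "ln (y (3 / n)) - ln (y (1 / n)) \<le> 2"
    "3 / n \<le> T2" "ln (y T1) - ln (y (1 / n)) \<le> (J + 1) * (\<tau> + 1) * real m ^ 2 ^ J"
proof -
  note M = M0_props[OF m(1)]
  have m0: "0 < real m" using M(1) by simp
  have T0: "0 < T1" "0 < T2" using T1 tau by linarith+
  define i0 where "i0 = nat \<lceil>T1 * m\<rceil>"
  define i1 where "i1 = nat \<lfloor>T2 * m\<rfloor>"
  have i0: "T1 * m \<le> real i0" "real i0 < T1 * m + 1"
  proof -
    have "0 \<le> T1 * m" using T0 m0 by simp
    then have "real i0 = of_int \<lceil>T1 * m\<rceil>" by (simp add: i0_def)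
    then show "T1 * m \<le> real i0" "real i0 < T1 * m + 1" by linarith+
  qed
  have i1: "real i1 \<le> T2 * m" "T2 * m - 1 < real i1"
  proof -
    have "0 \<le> T2 * m" using T0 m0 by simp
    then have "real i1 = of_int \<lfloor>T2 * m\<rfloor>" by (simp add: i1_def)
    then show "real i1 \<le> T2 * m" "T2 * m - 1 < real i1" by linarith+
  qed
  \<comment> \<open>Rounding loses less than two cells, and half of the expected number is at least
    two.\<close>
  have diff: "(T2 - T1) * m / 2 \<le> real i1 - real i0"
    using i0 i1 m(2) left_diff_distrib[of T2 T1 "real m"] by linarith
  define n where "n = i1 - i0"
  have n: "0 < n" "real n = real i1 - real i0" "i0 + n = i1"
    using diff m(2) unfolding n_def by (auto simp: of_nat_diff)
  have g0: "T1 \<le> i0 / m" using i0 m0 by (simp add: field_simps)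
  have g1: "i1 / m \<le> T2" using i1 m0 by (simp add: field_simps)
  have gm: "real i / m \<le> T2" if "i \<le> i1" for i
    using g1 divide_right_mono[of "real i" "real i1" "real m"] that m0 by simp
  have pos: "0 < y (i / m)" "y T1 \<le> y (i / m)" if "i0 \<le> i" "i \<le> i1" for i
  proof -
    have "T1 \<le> i / m" using g0 divide_right_mono[of "real i0" "real i" "real m"] that m0 by simp
    then show "y T1 \<le> y (i / m)" using T0 gm[OF that(2)] by (intro mono) auto
    then show "0 < y (i / m)" using y1 by linarith
  qed
  have "y (i1 / m) \<le> y T2" using g1 m0 by (intro mono) auto
  then have "ln (y (i1 / m)) \<le> ln (y T2)" using pos(1)[of i1] n by (intro ln_mono) auto
  moreover have "ln (y T1) \<le> ln (y (i0 / m))" using pos[of i0] n y1 by (intro ln_mono) auto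
  ultimately have "ln (y (real (i0 + n) / m)) - ln (y (i0 / m)) \<le> B" using B unfolding n(3) by linarith
  from small_increment_exists[of n "\<lambda>i. ln (y (real i / m))", OF n(1) this]
  obtain i where i: "i0 \<le> i" "i < i0 + n" "ln (y (real (Suc i) / m)) - ln (y (real i / m)) \<le> B / n" by blast
  have "B / n \<le> 1 / sqrt m"
  proof -
    have "2 * B / (T2 - T1) \<le> sqrt m" by (rule real_le_rsqrt[OF m(3)])
    then have b: "2 * B \<le> (T2 - T1) * sqrt m" using T1 by (simp add: field_simps)
    have "B * sqrt m \<le> ((T2 - T1) * sqrt m / 2) * sqrt m" using b by (intro mult_right_mono) auto
    also have "\<dots> = (T2 - T1) * m / 2" by simp
    also have "\<dots> \<le> real n" using diff n by simp
    finally show ?thesis using n m0 by (simp add: field_simps)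
  qed
  then have a4: "ln (y ((real i + 1) / m)) - ln (y (i / m)) \<le> 1 / sqrt m" using i(3) by (simp add: add.commute)
  have a2: "(real i + 1) / m \<le> T2" using gm[of "Suc i"] i n by (simp add: add.commute)
  have "T1 \<le> i / m" using g0 divide_right_mono[of "real i0" "real i" "real m"] i m0 by simp
  then have a5: "\<tau> / 4 \<le> i / m" using T1 tau by linarith
  have "i / m \<le> T2" using gm[of i] i n by simp
  also have "T2 \<le> J * \<tau> / 4" using J tau by (simp add: field_simps)
  finally have a6: "i / m \<le> \<tau> + J * \<tau> / 4" using tau by linarith
  from reach_origin[OF m(1) a2 pos(1) a4 a5 a6] i n obtain N where N: "m \<le> N" "N \<le> m ^ 2 ^ J" "0 < y (1 / N)"
    "ln (y (3 / N)) - ln (y (1 / N)) \<le> 2" "3 / N \<le> T2"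
    "ln (y (i / m)) - ln (y (1 / N)) \<le> (J + 1) * (\<tau> + 1) * real m ^ 2 ^ J" by auto
  have "ln (y T1) \<le> ln (y (i / m))" using pos[of i] i n y1 by (intro ln_mono) auto
  then show ?thesis using that[OF N(1-5)] N(6) by linarith
qed

end

text \<open>Taking roots gives X = (|ln \<rho>| / A)^(1 / K) \<le> M + (c * B)^2. The threshold
  \<rho>' makes X at least 2 * M, so M is absorbed by X / 2, and B is at least a multiple of |ln
  \<rho>| to the power 1 / (2 * K).\<close>

lemma invert_power_bound:
  fixes A M c :: real and K :: nat
  assumes A: "0 < A" and M: "0 < M" and c: "0 < c" and K: "0 < K"
  obtains \<rho>' N \<delta> where "0 < \<rho>'" "\<rho>' < 1" "0 < N" "0 < \<delta>"
    "\<And>\<rho> B. 0 < \<rho> \<Longrightarrow> \<rho> \<le> \<rho>' \<Longrightarrow> 0 \<le> B \<Longrightarrow> - ln \<rho> \<le> A * (M + (c * B)\<^sup>2) ^ K \<Longrightarrow> N * \<bar>ln \<rho>\<bar> powr \<delta> \<le> B"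
proof -
  define \<rho>' where "\<rho>' = exp (- (A * (2 * M) ^ K))"
  define \<delta> where "\<delta> = 1 / (2 * real K)"
  show ?thesis
  proof (rule that[of \<rho>' "sqrt (1 / 2) * (1 / A) powr \<delta> / c" \<delta>])
    show "0 < \<rho>'" "\<rho>' < 1" using A M by (simp_all add: \<rho>'_def)
    show "0 < sqrt (1 / 2) * (1 / A) powr \<delta> / c" using A c by simp
    show "0 < \<delta>" using K by (simp add: \<delta>_def)
    fix \<rho> B :: real
    assume \<rho>: "0 < \<rho>" "\<rho> \<le> \<rho>'" and B: "0 \<le> B" and le: "- ln \<rho> \<le> A * (M + (c * B)\<^sup>2) ^ K"
    define L where "L = - ln \<rho>"
    have "ln \<rho> \<le> ln \<rho>'" using \<rho> by (intro ln_mono) (auto simp: \<rho>'_def)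
    then have L1: "A * (2 * M) ^ K \<le> L" by (simp add: L_def \<rho>'_def)
    have L0: "0 < L" using L1 A M by (smt (verit) mult_pos_pos zero_less_power)
    define X where "X = (L / A) powr (1 / K)"
    have root: "(z ^ K) powr (1 / K) = z" if "0 < z" for z :: real
      using that K by (simp add: powr_realpow[symmetric] powr_powr)
    have "((2 * M) ^ K) powr (1 / K) \<le> X"
      unfolding X_def using L1 A M by (intro powr_mono2) (auto simp: field_simps)
    then have X2: "2 * M \<le> X" using root[of "2 * M"] M by simp
    have Mc: "0 < M + (c * B)\<^sup>2" using M by (simp add: add_pos_nonneg)
    have "X \<le> ((M + (c * B)\<^sup>2) ^ K) powr (1 / K)"
      unfolding X_def using le L0 A by (intro powr_mono2) (auto simp: L_def field_simps)
    then have "X \<le> M + (c * B)\<^sup>2" using root[OF Mc] by simp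
    then have "X / 2 \<le> (c * B)\<^sup>2" using X2 by linarith
    then have "sqrt (X / 2) \<le> c * B" using B c by (intro real_le_lsqrt) auto
    moreover have "sqrt (X / 2) = sqrt (1 / 2) * (1 / A) powr \<delta> * L powr \<delta>"
    proof -
      have "sqrt X = X powr (1 / 2)" using L0 A by (simp add: X_def powr_half_sqrt)
      also have "\<dots> = (L / A) powr \<delta>" by (simp add: X_def powr_powr \<delta>_def mult.commute)
      also have "\<dots> = (1 / A) powr \<delta> * L powr \<delta>"
        using L0 A by (simp add: powr_mult[symmetric])
      finally show ?thesis by (simp add: real_sqrt_divide)
    qed
    moreover have "\<bar>ln \<rho>\<bar> = L" using L0 by (simp add: L_def)
    ultimately show "sqrt (1 / 2) * (1 / A) powr \<delta> / c * \<bar>ln \<rho>\<bar> powr \<delta> \<le> B"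
      using c by (simp add: field_simps)
  qed
qed

section \<open>The stability estimate\<close>

lemma ln_nat_ge_1: "4 \<le> m \<Longrightarrow> 1 \<le> ln (real m)"
  using exp_le by (subst ln_ge_iff) auto

text \<open>Comparison with the value at b = 4 / m \<le> 1: the bound ln x \<le> x - 1 at x = b /
  \<sigma> does the work of monotonicity, and 1 - ln b \<le> 2 * ln m because ln m \<ge> 1.\<close>

lemma log_modulus_le:
  assumes m: "4 \<le> (m :: nat)" and \<sigma>: "0 < \<sigma>" "\<sigma> \<le> 4 / m"
  shows "log_modulus \<sigma> \<le> 8 * (ln m / m)"
proof -
  define b where "b = 4 / real m"
  have b: "0 < b" "b \<le> 1" "\<sigma> \<le> b" using m \<sigma> by (auto simp: b_def)
  have "ln (b / \<sigma>) \<le> b / \<sigma> - 1" by (rule ln_le_minus_one) (use b \<sigma> in simp)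
  then have "\<sigma> * ln (b / \<sigma>) \<le> \<sigma> * (b / \<sigma> - 1)" using \<sigma> by (intro mult_left_mono) auto
  also have "\<dots> = b - \<sigma>" using \<sigma> by (simp add: right_diff_distrib)
  finally have 1: "\<sigma> * (ln b - ln \<sigma>) \<le> b - \<sigma>" using b \<sigma> by (simp add: ln_div)
  have lb: "0 \<le> - ln b" using b by simp
  have "ln \<sigma> \<le> 0" using b \<sigma> by simp
  then have "log_modulus \<sigma> = \<sigma> * (1 - ln \<sigma>)" by (simp add: log_modulus_def)
  also have "\<dots> = \<sigma> + \<sigma> * (ln b - ln \<sigma>) + \<sigma> * (- ln b)" by (simp add: algebra_simps)
  also have "\<dots> \<le> b + \<sigma> * (- ln b)" using 1 by linarith
  also have "\<dots> \<le> b + b * (- ln b)" using mult_right_mono[OF b(3) lb] by linarith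
  also have "\<dots> = b * (1 - ln b)" by (simp add: algebra_simps)
  also have "1 - ln b \<le> 2 * ln m"
  proof -
    have "ln b = ln 4 - ln m" using m by (simp add: b_def ln_div)
    moreover have "0 \<le> ln (4::real)" by simp
    ultimately show ?thesis using ln_nat_ge_1[OF m] by linarith
  qed
  then have "b * (1 - ln b) \<le> b * (2 * ln m)" using b by (intro mult_left_mono) auto
  finally show ?thesis by (simp add: b_def)
qed

text \<open>The factor 8 stems from \<open>log_modulus_le\<close>, the term n * \<Lambda> / (4 *
  \<kappa>) from \<open>three_point\<close>; adding 1 keeps the constant positive for \<Lambda> =
  0.\<close>

definition step_const :: "nat \<Rightarrow> real \<Rightarrow> real \<Rightarrow> real" where
  "step_const n \<kappa> \<Lambda> = 8 * (n * \<Lambda> / (4 * \<kappa>) + 1)"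

context backward_parabolic
begin

lemma step_const_pos: "0 < step_const CARD('n) \<kappa> \<Lambda>"
  using kappa Lambda by (simp add: step_const_def add_nonneg_pos)

text \<open>Half-widths up to 2 / m cover both the grid step 1 / m and the last step at time 0,
  which leaves the grid.\<close>

lemma three_point_grid:
  assumes m: "4 \<le> (m :: nat)" and h: "0 < h" "h \<le> 2 / m" "h \<le> t" "t + h < T"
  shows "energy t \<le> l2inner (u (t + h)) (u (t - h)) + step_const CARD('n) \<kappa> \<Lambda> * ln m / m * (energy (t + h) - energy (t - h))"
proof (rule three_point[OF h(1,3,4)])
  fix s assume s: "0 < s" "s < h"
  have k: "0 \<le> CARD('n) * \<Lambda> / (4 * \<kappa>)" using kappa Lambda by simp
  have "log_modulus (2 * s) \<le> 8 * (ln m / m)"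
    by (rule log_modulus_le[OF m]) (use s h in auto)
  then have "CARD('n) * \<Lambda> / (4 * \<kappa>) * log_modulus (2 * s) \<le> CARD('n) * \<Lambda> / (4 * \<kappa>) * (8 * (ln m / m))"
    by (rule mult_left_mono[OF _ k])
  also have "\<dots> \<le> (CARD('n) * \<Lambda> / (4 * \<kappa>) + 1) * (8 * (ln m / m))"
    using m by (intro mult_right_mono) auto
  also have "\<dots> = step_const CARD('n) \<kappa> \<Lambda> * ln m / m" by (simp add: step_const_def)
  finally show "CARD('n) * \<Lambda> / (4 * \<kappa>) * log_modulus (2 * s) \<le> step_const CARD('n) \<kappa> \<Lambda> * ln m / m" .
qed

lemma log_convex_profile_energy:
  assumes T2: "T2 < T" and \<tau>: "0 < \<tau>" "48 * step_const CARD('n) \<kappa> \<Lambda> * \<tau> \<le> 1"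
  shows "log_convex_profile energy T2 (step_const CARD('n) \<kappa> \<Lambda>) \<tau>"
proof
  fix m i :: nat
  assume m: "4 \<le> m" and i: "1 \<le> i" and le: "(real i + 1) / m \<le> T2"
  have m0: "0 < real m" using m by simp
  have eq: "real i / m + 1 / m = (real i + 1) / m" "real i / m - 1 / m = (real i - 1) / m"
    by (simp_all add: add_divide_distrib diff_divide_distrib)
  have in1: "(real i + 1) / m \<in> {0..<T}" using le T2 by simp
  have "(real i - 1) / m \<le> (real i + 1) / m" by (intro divide_right_mono) auto
  then have in2: "(real i - 1) / m \<in> {0..<T}" using le T2 i by simp
  have t: "energy (real i / m) \<le> l2inner (u ((real i + 1) / m)) (u ((real i - 1) / m))
      + step_const CARD('n) \<kappa> \<Lambda> * ln m / m * (energy ((real i + 1) / m) - energy ((real i - 1) / m))"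
    using three_point_grid[OF m, of "1 / m" "real i / m"] i m0 in1 unfolding eq
    by (simp add: divide_right_mono)
  have "l2inner (u ((real i + 1) / m)) (u ((real i - 1) / m))
      \<le> l2norm (u ((real i + 1) / m)) * l2norm (u ((real i - 1) / m))"
    using l2inner_le[OF u_L2[OF in1] u_L2[OF in2]] by linarith
  also have "\<dots> = sqrt (energy ((real i + 1) / m) * energy ((real i - 1) / m))"
    by (simp add: energy_def real_sqrt_mult flip: l2norm_square)
  finally show "energy (i / m) \<le> sqrt (energy ((real i + 1) / m) * energy ((real i - 1) / m))
      + step_const CARD('n) \<kappa> \<Lambda> * ln m / m * (energy ((real i + 1) / m) - energy ((real i - 1) / m))"
    using t by linarith
next
  show "energy s \<le> energy t" if "0 \<le> s" "s \<le> t" "t \<le> T2" for s t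
    using energy_mono[of s t] that T2 by simp
qed (use step_const_pos \<tau> energy_nonneg in auto)

lemma sum_l2norm_grad_le: "(\<Sum>i\<in>UNIV. l2norm (G t i)) \<le> CARD('n) * sqrt (grad_energy t)"
proof -
  have "l2norm (G t i) \<le> sqrt (grad_energy t)" for i
  proof (rule real_le_rsqrt)
    show "(l2norm (G t i))\<^sup>2 \<le> grad_energy t"
      unfolding grad_energy_def by (rule member_le_sum) auto
  qed
  then show ?thesis using sum_bounded_above[of UNIV "\<lambda>i. l2norm (G t i)" "sqrt (grad_energy t)"] by simp
qed

text \<open>The last three-point step is taken down to time \<open>0\<close>, where only the weak norm of \<open>u 0\<close> is
  small; the middle time is chosen such that the gradient at twice that time is controlled.\<close>

lemma energy_near_origin:
  fixes N :: nat
  assumes s: "0 \<le> s" "s \<le> 1" and \<rho>: "0 < \<rho>" "\<rho> \<le> 1" "sobolev_norm (- s) (u 0) \<le> \<rho>"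
    and D: "0 < D" "\<And>t. t \<in> {0..<T} \<Longrightarrow> l2norm (u t) \<le> D"
    and N: "4 \<le> N" "step_const CARD('n) \<kappa> \<Lambda> * ln N / N \<le> 1 / 32" "3 / N < T"
    and pos: "0 < energy (1 / N)" and ratio: "ln (energy (3 / N)) - ln (energy (1 / N)) \<le> 2"
  shows "energy (1 / N) \<le> 2 * (D + 2 * sqrt 2 ^ CARD('n) * D * (CARD('n) * (D / sqrt (2 * \<kappa>)))) * sqrt \<rho> * N"
proof -
  have N0: "0 < real N" "1 \<le> real N" using N by simp_all
  have "2 / N < 3 / N" using N0 by (intro divide_strict_right_mono) auto
  \<comment> \<open>The symmetric step around \<xi> / 2 ends at the times \<xi> and 0, and \<xi> / 2
    > 1 / N keeps the energy in the middle above the one at 1 / N.\<close>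
  then obtain \<xi> where \<xi>: "2 / N < \<xi>" "\<xi> < 3 / N" and
    g: "2 * \<kappa> * grad_energy \<xi> * (3 / N - 2 / N) \<le> energy (3 / N) - energy (2 / N)"
    using grad_energy_mean_value[of "2 / N" "3 / N"] N by auto
  have \<xi>0: "0 < \<xi>" "\<xi> < T" using \<xi> N N0 order_less_trans[of 0 "2 / N" \<xi>] by auto
  have in0: "0 \<in> {0..<T}" and in\<xi>: "\<xi> \<in> {0..<T}" and in3: "3 / N \<in> {0..<T}"
    using \<xi>0 N by auto
  have "energy (3 / N) = (l2norm (u (3 / N)))\<^sup>2" by (simp add: energy_def l2norm_square)
  also have "\<dots> \<le> D\<^sup>2" by (intro power_mono D(2)[OF in3]) simp
  finally have "2 * \<kappa> * grad_energy \<xi> * (3 / N - 2 / N) \<le> D\<^sup>2"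
    using g energy_nonneg[of "2 / N"] by linarith
  then have "grad_energy \<xi> \<le> D\<^sup>2 * N / (2 * \<kappa>)"
    using N0 kappa by (simp add: field_simps diff_divide_distrib[symmetric])
  \<comment> \<open>Wasteful, but it makes the square root linear in N; this is harmless since the
    logarithm of the final bound is taken.\<close>
  also have "\<dots> \<le> D\<^sup>2 * (real N)\<^sup>2 / (2 * \<kappa>)"
    using N0 kappa by (intro divide_right_mono mult_left_mono) (auto simp: power2_eq_square)
  also have "\<dots> = (D / sqrt (2 * \<kappa>) * N)\<^sup>2" using kappa by (simp add: power_divide power_mult_distrib)
  finally have "sqrt (grad_energy \<xi>) \<le> D / sqrt (2 * \<kappa>) * N"
    using D kappa by (intro real_le_lsqrt) auto
  then have "CARD('n) * sqrt (grad_energy \<xi>) \<le> CARD('n) * (D / sqrt (2 * \<kappa>) * N)"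
    by (intro mult_left_mono) auto
  then have H: "(\<Sum>i\<in>UNIV. l2norm (G \<xi> i)) \<le> CARD('n) * (D / sqrt (2 * \<kappa>) * N)"
    using sum_l2norm_grad_le[of \<xi>] by linarith
  have "l2inner (u \<xi>) (u 0) = l2inner (u 0) (u \<xi>)" by (rule l2inner_commute)
  also have "\<dots> \<le> sqrt \<rho> * (l2norm (u \<xi>) + 2 * sqrt 2 ^ CARD('n) * l2norm (u 0) * (\<Sum>i\<in>UNIV. l2norm (G \<xi> i)))"
    using sobolev_pairing[OF s \<rho> u_L2[OF in0] u_L2[OF in\<xi>] G_L2[OF in\<xi>] G_weak[OF in\<xi>]] by linarith
  also have "\<dots> \<le> sqrt \<rho> * (D * N + 2 * sqrt 2 ^ CARD('n) * D * (CARD('n) * (D / sqrt (2 * \<kappa>) * N)))"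
  proof (intro mult_left_mono add_mono mult_mono H D(2) in0)
    have "D * 1 \<le> D * N" using D N0 by (intro mult_left_mono) auto
    then show "l2norm (u \<xi>) \<le> D * N" using D(2)[OF in\<xi>] by linarith
  qed (use D \<rho> in \<open>auto intro: sum_nonneg\<close>)
  finally have ip: "l2inner (u \<xi>) (u 0) \<le> (D + 2 * sqrt 2 ^ CARD('n) * D * (CARD('n) * (D / sqrt (2 * \<kappa>)))) * sqrt \<rho> * N"
    by (simp add: algebra_simps)
  have "\<xi> / 2 \<le> 2 / N"
  proof -
    have "3 / N \<le> 4 / N" by (intro divide_right_mono) auto
    then show ?thesis using \<xi>(2) by simp
  qed
  then have "energy (\<xi> / 2) \<le> l2inner (u \<xi>) (u 0) + step_const CARD('n) \<kappa> \<Lambda> * ln N / N * (energy \<xi> - energy 0)"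
    using three_point_grid[OF N(1), of "\<xi> / 2" "\<xi> / 2"] \<xi>0 by simp
  also have "step_const CARD('n) \<kappa> \<Lambda> * ln N / N * (energy \<xi> - energy 0) \<le> 1 / 32 * (energy \<xi> - energy 0)"
    using energy_mono[of 0 \<xi>] \<xi>0 by (intro mult_right_mono N) auto
  \<comment> \<open>Since exp 2 \<le> 9, the error is at most 9 / 32 of the energy at \<xi> / 2 and
    is absorbed on the left.\<close>
  also have "\<dots> \<le> 1 / 32 * (9 * energy (\<xi> / 2))"
  proof -
    have le: "1 / N \<le> \<xi> / 2" using \<xi>(1) by simp
    have m1: "energy (1 / N) \<le> energy (\<xi> / 2)" using le \<xi>0 N0 by (intro energy_mono) auto
    have "1 / N \<le> 3 / N" by (intro divide_right_mono) auto
    then have "energy (1 / N) \<le> energy (3 / N)" using N0 N by (intro energy_mono) auto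
    then have p3: "0 < energy (3 / N)" using pos by linarith
    have "ln (energy (3 / N)) \<le> ln (energy (1 / N)) + 2" using ratio by linarith
    then have "exp (ln (energy (3 / N))) \<le> exp (ln (energy (1 / N)) + 2)" by (simp only: exp_le_cancel_iff)
    then have "energy (3 / N) \<le> energy (1 / N) * exp 2" using pos p3 by (simp add: exp_add)
    also have "exp (2::real) = exp 1 * exp 1" by (simp add: exp_add[symmetric])
    also have "energy (1 / N) * (exp 1 * exp 1) \<le> energy (1 / N) * (3 * 3)"
      using exp_le pos by (intro mult_left_mono mult_mono) auto
    finally have "energy (3 / N) \<le> 9 * energy (\<xi> / 2)" using m1 by linarith
    moreover have "energy \<xi> \<le> energy (3 / N)" using \<xi> \<xi>0 N by (intro energy_mono) auto
    ultimately have "energy \<xi> - energy 0 \<le> 9 * energy (\<xi> / 2)" using energy_nonneg[of 0] by linarith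
    then show ?thesis by (intro mult_left_mono) auto
  qed
  finally have "energy (\<xi> / 2) \<le> 2 * l2inner (u \<xi>) (u 0)"
    using energy_nonneg[of "\<xi> / 2"] by linarith
  moreover have "energy (1 / N) \<le> energy (\<xi> / 2)"
    using \<xi>(1) \<xi>0 N0 by (intro energy_mono) auto
  ultimately show ?thesis using ip by linarith
qed

end

text \<open>Here \<rho> is any upper bound of the weak norm rather than the norm itself, so that a
  vanishing norm can be treated by letting \<rho> tend to 0.\<close>

lemma backward_parabolic_log_bound:
  fixes T T1 \<kappa> \<Lambda> D s :: real
  assumes T: "0 < T1" "T1 < T" and D: "0 < D" and s: "0 \<le> s" "s \<le> 1" and \<kappa>: "0 < \<kappa>" and \<Lambda>: "0 \<le> \<Lambda>"
  shows "\<exists>A M c K. 0 < A \<and> 0 < M \<and> 0 < c \<and> 0 < K \<and>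
    (\<forall>(a :: 'n::finite coeffs) u G u' \<rho>. backward_parabolic T \<kappa> \<Lambda> a u G u' \<longrightarrow>
      (\<forall>t\<in>{0..<T}. l2norm (u t) \<le> D) \<longrightarrow> 0 < l2norm (u T1) \<longrightarrow>
      0 < \<rho> \<longrightarrow> \<rho> \<le> 1 \<longrightarrow> sobolev_norm (- s) (u 0) \<le> \<rho> \<longrightarrow>
      - ln \<rho> \<le> A * (M + (c * (ln (D\<^sup>2) - ln ((l2norm (u T1))\<^sup>2)))\<^sup>2) ^ K)"
proof -
  define C where "C = step_const CARD('n) \<kappa> \<Lambda>"
  have C: "0 < C" using \<kappa> \<Lambda> by (simp add: C_def step_const_def add_nonneg_pos)
  \<comment> \<open>The room between T1 and T2 serves the first pigeonhole argument, and T2 < T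
    keeps it where the equation holds.\<close>
  define T2 where "T2 = (T1 + T) / 2"
  have T2: "T1 < T2" "T2 < T" using T by (auto simp: T2_def)
  define \<tau> where "\<tau> = min T1 (1 / (48 * C))"
  have \<tau>: "0 < \<tau>" "\<tau> \<le> T1" using T C by (auto simp: \<tau>_def)
  have "\<tau> \<le> 1 / (48 * C)" by (simp add: \<tau>_def)
  then have \<tau>C: "48 * C * \<tau> \<le> 1" using C by (simp add: field_simps)
  define Mmin where "Mmin = 4 + 8 / \<tau> + (64 * C)\<^sup>2"
  have Mmin: "4 \<le> Mmin" using \<tau> by (simp add: Mmin_def)
  define J where "J = nat \<lceil>4 * T2 / \<tau>\<rceil>"
  have J: "4 * T2 / \<tau> \<le> J" by (simp add: J_def real_nat_ceiling_ge)
  define c where "c = 2 / (T2 - T1)"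
  have c: "0 < c" using T2 by (simp add: c_def)
  define M where "M = Mmin + 4 / (T2 - T1) + 1"
  have M: "0 < M" using Mmin T2 by (simp add: M_def add_pos_pos)
  define K1 where "K1 = 2 * (D + 2 * sqrt 2 ^ CARD('n) * D * (CARD('n) * (D / sqrt (2 * \<kappa>))))"
  have K1: "0 < K1" using D \<kappa> by (simp add: K1_def add_pos_nonneg)
  \<comment> \<open>Each term of the final estimate is at most a constant times m ^ 2 ^ J; A
    collects these constants.\<close>
  define A where "A = 2 * (1 / c + \<bar>ln K1\<bar> + \<bar>ln (D\<^sup>2)\<bar> + (J + 1) * (\<tau> + 1) + 1)"
  have A: "0 < A" unfolding A_def using c \<tau> by (intro mult_pos_pos add_nonneg_pos add_nonneg_nonneg) auto
  have "- ln \<rho> \<le> A * (M + (c * (ln (D\<^sup>2) - ln ((l2norm (u T1))\<^sup>2)))\<^sup>2) ^ (2 ^ J)"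
    if bp: "backward_parabolic T \<kappa> \<Lambda> a u G u'" and uD: "\<And>t. t \<in> {0..<T} \<Longrightarrow> l2norm (u t) \<le> D"
      and u1: "0 < l2norm (u T1)" and \<rho>: "0 < \<rho>" "\<rho> \<le> 1" "sobolev_norm (- s) (u 0) \<le> \<rho>"
    for a :: "'n coeffs" and u G u' \<rho>
  proof -
    interpret backward_parabolic T \<kappa> \<Lambda> a u G u' by (rule bp)
    interpret log_convex_profile energy T2 C \<tau>
      unfolding C_def by (rule log_convex_profile_energy[OF T2(2) \<tau>(1) \<tau>C[unfolded C_def]])
    have M0_eq: "log_convex_profile.M0 C \<tau> = Mmin" by (simp add: M0_def Mmin_def)
    have en: "energy t = (l2norm (u t))\<^sup>2" for t by (simp add: energy_def l2norm_square)
    have enD: "energy t \<le> D\<^sup>2" if "t \<in> {0..<T}" for t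
      unfolding en by (intro power_mono uD that) simp
    define B where "B = ln (D\<^sup>2) - ln (energy T1)"
    have pos1: "0 < energy T1" using u1 by (simp add: en)
    have "energy T1 \<le> energy T2" using T T2 by (intro energy_mono) auto
    then have pos2: "0 < energy T2" using pos1 by linarith
    have "energy T2 \<le> D\<^sup>2" using T T2 by (intro enD) auto
    then have B1: "ln (energy T2) - ln (energy T1) \<le> B" unfolding B_def using pos2 D by (simp add: ln_mono)
    have "energy T1 \<le> D\<^sup>2" using T by (intro enD) auto
    then have B0: "0 \<le> B" unfolding B_def using pos1 D by (simp add: ln_mono)
    \<comment> \<open>All lower bounds on m demanded by \<open>profile_bound\<close> are added up;
      rounding up costs at most 1, the last summand of M.\<close>
    define m where "m = nat \<lceil>Mmin + 4 / (T2 - T1) + (c * B)\<^sup>2\<rceil>"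
    have q: "0 \<le> 4 / (T2 - T1)" "0 \<le> (c * B)\<^sup>2" using T2 by simp_all
    then have "real m = of_int \<lceil>Mmin + 4 / (T2 - T1) + (c * B)\<^sup>2\<rceil>" using Mmin by (simp add: m_def)
    then have m: "Mmin + 4 / (T2 - T1) + (c * B)\<^sup>2 \<le> m" "m \<le> M + (c * B)\<^sup>2"
      unfolding M_def by linarith+
    have m1: "Mmin \<le> m" "4 / (T2 - T1) \<le> m" "(c * B)\<^sup>2 \<le> m" using m(1) q Mmin by linarith+
    have m2: "4 \<le> (T2 - T1) * m" using m1(2) T2 by (simp add: field_simps)
    have m3: "(2 * B / (T2 - T1))\<^sup>2 \<le> m" using m1(3) by (simp add: c_def)
    obtain N where N: "m \<le> N" "N \<le> m ^ 2 ^ J" "0 < energy (1 / N)"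
      "ln (energy (3 / N)) - ln (energy (1 / N)) \<le> 2" "3 / N \<le> T2"
      "ln (energy T1) - ln (energy (1 / N)) \<le> (J + 1) * (\<tau> + 1) * real m ^ 2 ^ J"
      by (rule profile_bound[OF \<tau>(2) T2(1) pos1 B1 B0 m1(1)[folded M0_eq] m2 m3 J]) blast
    have "Mmin \<le> real N" using m1(1) N(1) by linarith
    note MN = M0_props[OF this[folded M0_eq]]
    \<comment> \<open>The two bounds meet at time 1 / N: the weak initial norm limits the energy
      from above, the profile bound limits it from below in terms of the energy at T1.\<close>
    have "energy (1 / N) \<le> K1 * sqrt \<rho> * N"
      unfolding K1_def
      by (rule energy_near_origin[OF s \<rho> D uD MN(1) MN(4)[unfolded C_def] _ N(3,4)]) (use N(5) T2 in auto)
    then have "ln (energy (1 / N)) \<le> ln (K1 * sqrt \<rho> * N)" using N(3) by (intro ln_mono) auto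
    also have "\<dots> = ln K1 + ln \<rho> / 2 + ln N"
      using K1 \<rho> MN(1) by (simp add: ln_mult ln_sqrt)
    also have "ln N \<le> real N - 1" using MN(1) by (intro ln_le_minus_one) simp
    finally have l1: "ln (energy (1 / N)) \<le> ln K1 + ln \<rho> / 2 + real N" by linarith
    define P where "P = real m ^ 2 ^ J"
    have m1r: "1 \<le> real m" using m1(1) Mmin by linarith
    have P1: "1 \<le> P" unfolding P_def by (rule one_le_power[OF m1r])
    have mP: "real m \<le> P" unfolding P_def using m1r by (intro self_le_power) auto
    have NP: "real N \<le> P" unfolding P_def using N(2) by (metis of_nat_le_iff of_nat_power)
    have BP: "B \<le> 1 / c * P"
    proof -
      have "2 * (c * B) \<le> 1 + (c * B)\<^sup>2" using sum_squares_bound[of 1 "c * B"] by simp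
      moreover have "0 \<le> c * B" using B0 c by simp
      ultimately have "c * B \<le> 1 + (c * B)\<^sup>2" by linarith
      also have "\<dots> \<le> m" using m(1) Mmin q by linarith
      finally have "c * B \<le> P" using mP by linarith
      then show ?thesis using c by (simp add: field_simps)
    qed
    have "- ln \<rho> \<le> 2 * (B + \<bar>ln K1\<bar> + \<bar>ln (D\<^sup>2)\<bar> + (J + 1) * (\<tau> + 1) * P + P)"
    proof -
      have "- r \<le> 2 * (d - e + \<bar>b\<bar> + \<bar>d\<bar> + x + p)"
        if "a \<le> b + r / 2 + n" "e - a \<le> x" "n \<le> p" for a b r n e x p d :: real
        using that by argo
      from this[OF l1 N(6)[folded P_def] NP] show ?thesis unfolding B_def .
    qed
    also have "\<dots> \<le> 2 * (1 / c * P + \<bar>ln K1\<bar> * P + \<bar>ln (D\<^sup>2)\<bar> * P + (J + 1) * (\<tau> + 1) * P + P)"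
    proof -
      have "\<bar>z\<bar> \<le> \<bar>z\<bar> * P" for z :: real
        using mult_left_mono[OF P1, of "\<bar>z\<bar>"] by simp
      then show ?thesis by (intro mult_left_mono add_mono BP order_refl) auto
    qed
    also have "\<dots> = A * P" by (simp add: A_def algebra_simps)
    also have "\<dots> \<le> A * (M + (c * B)\<^sup>2) ^ 2 ^ J"
      unfolding P_def using A m(2) by (intro mult_left_mono power_mono) auto
    finally show ?thesis by (simp add: B_def en)
  qed
  then show ?thesis
    using A M c by (intro exI[of _ A] exI[of _ M] exI[of _ c] exI[of _ "2 ^ J"]) auto
qed

section \<open>From the hypotheses on coefficients and solution to the abstract setting\<close>

lemma log_Lipschitz_A_LL:
  assumes A: "A_LL T a = ereal L" and t: "t \<in> {0..T}" "t' \<in> {0..T}" "t \<noteq> t'"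
  shows "\<bar>a j k t x - a j k t' x\<bar> \<le> \<bar>L\<bar> * log_modulus \<bar>t - t'\<bar>"
proof -
  let ?w = "\<bar>t - t'\<bar> * (1 + \<bar>ln \<bar>t - t'\<bar>\<bar>)"
  have w: "0 < ?w" using t(3) by (intro mult_pos_pos) auto
  have "0 < \<bar>t - t'\<bar>" "\<bar>t - t'\<bar> \<le> T" using t by auto
  then have "ereal (\<bar>a j k t x - a j k t' x\<bar> / ?w) \<le> A_LL T a"
    unfolding A_LL_def using t by (intro Sup_upper) blast
  then have "\<bar>a j k t x - a j k t' x\<bar> / ?w \<le> \<bar>L\<bar>" unfolding A by simp
  then show ?thesis using w by (simp add: log_modulus_def pos_divide_le_eq)
qed

lemma is_solution_backward_parabolic:
  assumes \<kappa>: "0 < \<kappa>" and a: "coeff_hyp T \<kappa> aLL aA a" and u: "is_solution T a u"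
  obtains G u' where "backward_parabolic T \<kappa> \<bar>aLL\<bar> a u G u'"
proof -
  from u obtain G u' where
    G: "\<forall>t\<in>{0..<T}. \<forall>i. inL2 (G t i) \<and> weak_pd i (u t) (G t i) \<and>
            ((\<lambda>s. l2dist (G s i) (G t i)) \<longlongrightarrow> 0) (at t within {0..<T})"
    and u': "\<forall>t\<in>{0..<T}. inL2 (u' t) \<and>
            ((\<lambda>s. l2dist (u' s) (u' t)) \<longlongrightarrow> 0) (at t within {0..<T}) \<and>
            ((\<lambda>s. l2norm (\<lambda>x. (u s x - u t x) / (s - t) - u' t x)) \<longlongrightarrow> 0) (at t within {0..<T})"
    and eq: "\<forall>t\<in>{0..<T}. \<forall>\<phi>. test_fun \<phi> \<longrightarrow>
            (\<integral>x. u' t x * \<phi> x \<partial>lborel)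
              - (\<Sum>j\<in>UNIV. \<Sum>k\<in>UNIV. \<integral>x. a j k t x * G t k x * pd j \<phi> x \<partial>lborel) = 0"
    unfolding is_solution_def by blast
  have uL2: "inL2 (u t)" if "t \<in> {0..<T}" for t
    using u that unfolding is_solution_def by auto
  have meas: "a j k t \<in> borel_measurable borel" if t: "t \<in> {0..T}" for j k t
  proof -
    have 1: "(\<lambda>(t, x). a j k t x) \<in> borel_measurable (restrict_space borel ({0..T} \<times> UNIV))"
      using a unfolding coeff_hyp_def by blast
    \<comment> \<open>Composing with the embedding of the slice at time t turns joint measurability
      on the strip into measurability in x.\<close>
    have 2: "(\<lambda>x. (t, x)) \<in> borel \<rightarrow>\<^sub>M restrict_space borel ({0..T} \<times> UNIV)"
      using t by (intro measurable_restrict_space2) (auto intro!: borel_measurable_continuous_onI continuous_intros)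
    from measurable_compose[OF 2 1] show ?thesis by simp
  qed
  have "backward_parabolic T \<kappa> \<bar>aLL\<bar> a u G u'"
  proof
    show "\<bar>a j k t x - a j k t' x\<bar> \<le> \<bar>aLL\<bar> * log_modulus \<bar>t - t'\<bar>"
      if "t \<in> {0..T}" "t' \<in> {0..T}" "t \<noteq> t'" for j k t t' x
    proof (rule log_Lipschitz_A_LL[OF _ that])
      show "A_LL T a = ereal aLL" using a unfolding coeff_hyp_def by blast
    qed
  next
    show "\<exists>B. \<forall>j k. \<forall>t\<in>{0..T}. \<forall>x. \<bar>a j k t x\<bar> \<le> B"
      using a unfolding coeff_hyp_def by blast
  next
    show "a j k t x = a k j t x" if "t \<in> {0..T}" for j k t x
      using a that unfolding coeff_hyp_def by blast
  next
    show "\<kappa> * (norm \<xi>)\<^sup>2 \<le> (\<Sum>j\<in>UNIV. \<Sum>k\<in>UNIV. a j k t x * \<xi> $ j * \<xi> $ k)" if "t \<in> {0..T}" for t x \<xi>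
      using a that unfolding coeff_hyp_def by blast
  qed (use \<kappa> meas uL2 G u' eq in auto)
  then show ?thesis using that by blast
qed

text \<open>Since the energy is nondecreasing, \<open>T'\<close> is the worst time. The logarithmic
  bound, solved for \<open>ln (D\<^sup>2)\<close> minus the logarithm of the energy at
  \<open>T'\<close>, gives the estimate with D itself as the constant \<open>M'\<close>.\<close>

theorem theorem3:
  fixes T T' D s :: real
  assumes "T > 0" and "0 < T'" and "T' < T" and "D > 0" and "0 < s" and "s < 1"
  shows "\<forall>\<kappa> aLL aA. 0 < \<kappa> \<and> \<kappa> < 1 \<longrightarrow>
    (\<exists>\<rho>' \<delta>' M' N'. \<rho>' > 0 \<and> \<delta>' > 0 \<and> M' > 0 \<and> N' > 0 \<and>
      (\<forall>(a :: 'n::finite coeffs) (u :: real \<Rightarrow> real^'n \<Rightarrow> real).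
        coeff_hyp T \<kappa> aLL aA a \<and> is_solution T a u \<and>
        sobolev_norm (- s) (u 0) \<le> \<rho>' \<and> (\<forall>t\<in>{0..T}. l2norm (u t) \<le> D) \<longrightarrow>
        (\<forall>t\<in>{0..T'}. l2norm (u t) \<le>
           (if sobolev_norm (- s) (u 0) = 0 then 0
            else M' * exp (- N' * \<bar>ln (sobolev_norm (- s) (u 0))\<bar> powr \<delta>')))))"
  proof (intro allI impI, elim conjE)
  fix \<kappa> aLL aA :: real assume \<kappa>: "0 < \<kappa>" "\<kappa> < 1"
  have s: "0 \<le> s" "s \<le> 1" using assms by auto
  from backward_parabolic_log_bound[OF assms(2,3,4) s \<kappa>(1) abs_ge_zero[of aLL], where 'n='n]
  obtain A M c K where AMc: "0 < A" "0 < M" "0 < c" "0 < K"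
    and bound: "\<And>(a :: 'n coeffs) u G u' \<rho>. backward_parabolic T \<kappa> \<bar>aLL\<bar> a u G u' \<Longrightarrow>
      \<forall>t\<in>{0..<T}. l2norm (u t) \<le> D \<Longrightarrow> 0 < l2norm (u T') \<Longrightarrow>
      0 < \<rho> \<Longrightarrow> \<rho> \<le> 1 \<Longrightarrow> sobolev_norm (- s) (u 0) \<le> \<rho> \<Longrightarrow>
      - ln \<rho> \<le> A * (M + (c * (ln (D\<^sup>2) - ln ((l2norm (u T'))\<^sup>2)))\<^sup>2) ^ K" by blast
  from invert_power_bound[OF AMc] obtain \<rho>' N \<delta> where \<rho>': "0 < \<rho>'" "\<rho>' < 1" "0 < N" "0 < \<delta>"
    and inv: "\<And>\<rho> B. 0 < \<rho> \<Longrightarrow> \<rho> \<le> \<rho>' \<Longrightarrow> 0 \<le> B \<Longrightarrow> - ln \<rho> \<le> A * (M + (c * B)\<^sup>2) ^ K \<Longrightarrow> N * \<bar>ln \<rho>\<bar> powr \<delta> \<le> B"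
    by blast
  \<comment> \<open>The rate N is halved because \<open>inv\<close> estimates the logarithm of the
    squared norm.\<close>
  have "l2norm (u t) \<le> (if sobolev_norm (- s) (u 0) = 0 then 0
            else D * exp (- (N / 2) * \<bar>ln (sobolev_norm (- s) (u 0))\<bar> powr \<delta>))"
    if a: "coeff_hyp T \<kappa> aLL aA a" and u: "is_solution T a u" and le: "sobolev_norm (- s) (u 0) \<le> \<rho>'"
      and uD: "\<forall>t\<in>{0..T}. l2norm (u t) \<le> D" and t: "t \<in> {0..T'}"
    for a :: "'n coeffs" and u t
  proof -
    obtain G u' where bp: "backward_parabolic T \<kappa> \<bar>aLL\<bar> a u G u'"
      by (rule is_solution_backward_parabolic[OF \<kappa>(1) a u])
    interpret backward_parabolic T \<kappa> "\<bar>aLL\<bar>" a u G u' by (rule bp)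
    define S where "S = sobolev_norm (- s) (u 0)"
    have u0: "inL2 (u 0)" using assms by (intro u_L2) auto
    have S0: "0 \<le> S" unfolding S_def by (rule sobolev_norm_nonneg[OF u0 s(1)])
    have "energy t \<le> energy T'" using t assms by (intro energy_mono) auto
    then have mono: "l2norm (u t) \<le> l2norm (u T')"
      unfolding energy_def l2norm_square[symmetric] by (rule power2_le_imp_le) simp
    let ?B = "ln (D\<^sup>2) - ln ((l2norm (u T'))\<^sup>2)"
    have uT': "l2norm (u T') \<le> D" using uD assms by simp
    have rate: "N * \<bar>ln \<rho>\<bar> powr \<delta> \<le> ?B" if pos: "0 < l2norm (u T')" and \<rho>: "0 < \<rho>" "\<rho> \<le> \<rho>'" "S \<le> \<rho>" for \<rho>
    proof (rule inv[OF \<rho>(1,2)])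
      have "(l2norm (u T'))\<^sup>2 \<le> D\<^sup>2" by (intro power_mono uT') simp
      then show "0 \<le> ?B" using pos by (simp add: ln_mono)
      show "- ln \<rho> \<le> A * (M + (c * ?B)\<^sup>2) ^ K"
        by (rule bound[OF bp _ pos \<rho>(1)]) (use uD \<rho> \<rho>' in \<open>auto simp: S_def\<close>)
    qed
    show ?thesis
    proof (cases "S = 0")
      \<comment> \<open>With vanishing weak norm every small \<rho> is admissible, and
        \<open>rate\<close> would make ?B arbitrarily large; hence the solution vanishes up to
        \<open>T'\<close>. This case is separate because the value of \<open>ln 0\<close> in HOL
        would not express infinite decay.\<close>
      case True
      have "l2norm (u T') = 0"
      proof (rule ccontr)
        assume "l2norm (u T') \<noteq> 0"
        then have pos: "0 < l2norm (u T')" by (simp add: less_le)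
        \<comment> \<open>Large enough for N * x powr \<delta> to exceed ?B and for exp (- x) to be
          an admissible \<rho>.\<close>
        define x where "x = max (- ln \<rho>') (((\<bar>?B\<bar> + 1) / N) powr (1 / \<delta>))"
        have xp: "((\<bar>?B\<bar> + 1) / N) powr (1 / \<delta>) \<le> x" "- ln \<rho>' \<le> x" by (simp_all add: x_def)
        have x0: "0 < x" using xp(1) \<rho>' by (smt (verit) divide_pos_pos powr_gt_zero)
        have "exp (- x) \<le> exp (ln \<rho>')" using xp(2) by simp
        then have "N * \<bar>ln (exp (- x))\<bar> powr \<delta> \<le> ?B" using \<rho>' True by (intro rate[OF pos]) auto
        then have 1: "N * x powr \<delta> \<le> ?B" using x0 by simp
        have "(\<bar>?B\<bar> + 1) / N = (((\<bar>?B\<bar> + 1) / N) powr (1 / \<delta>)) powr \<delta>"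
          using \<rho>' by (simp add: powr_powr)
        also have "\<dots> \<le> x powr \<delta>" using xp(1) \<rho>' by (intro powr_mono2) auto
        finally have "\<bar>?B\<bar> + 1 \<le> N * x powr \<delta>" using \<rho>' by (simp add: field_simps)
        then show False using 1 by linarith
      qed
      then show ?thesis using True mono by (simp add: S_def)
    next
      case False
      then have Sp: "0 < S" using S0 by simp
      have "l2norm (u T') \<le> D * exp (- (N / 2) * \<bar>ln S\<bar> powr \<delta>)"
      proof (cases "l2norm (u T') = 0")
        case False
        then have pos: "0 < l2norm (u T')" by (simp add: less_le)
        have "N * \<bar>ln S\<bar> powr \<delta> \<le> ?B" using le Sp by (intro rate[OF pos]) (auto simp: S_def)
        also have "?B = 2 * (ln D - ln (l2norm (u T')))" using pos assms by (simp add: ln_realpow)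
        finally have "ln (l2norm (u T')) \<le> ln D + (- (N / 2) * \<bar>ln S\<bar> powr \<delta>)" by simp
        then have "exp (ln (l2norm (u T'))) \<le> exp (ln D + (- (N / 2) * \<bar>ln S\<bar> powr \<delta>))"
          by (simp only: exp_le_cancel_iff)
        then show ?thesis using pos assms by (simp only: exp_add exp_ln)
      qed (use assms in simp)
      then show ?thesis using False mono by (simp add: S_def)
    qed
  qed
  note main = this
  show "\<exists>\<rho>' \<delta>' M' N'. \<rho>' > 0 \<and> \<delta>' > 0 \<and> M' > 0 \<and> N' > 0 \<and>
      (\<forall>(a :: 'n::finite coeffs) (u :: real \<Rightarrow> real^'n \<Rightarrow> real).
        coeff_hyp T \<kappa> aLL aA a \<and> is_solution T a u \<and>
        sobolev_norm (- s) (u 0) \<le> \<rho>' \<and> (\<forall>t\<in>{0..T}. l2norm (u t) \<le> D) \<longrightarrow>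
        (\<forall>t\<in>{0..T'}. l2norm (u t) \<le>
           (if sobolev_norm (- s) (u 0) = 0 then 0
            else M' * exp (- N' * \<bar>ln (sobolev_norm (- s) (u 0))\<bar> powr \<delta>'))))"
  proof (rule exI[of _ \<rho>'], rule exI[of _ \<delta>], rule exI[of _ D], rule exI[of _ "N / 2"], intro conjI allI impI ballI)
    fix a :: "'n coeffs" and u t
    assume "coeff_hyp T \<kappa> aLL aA a \<and> is_solution T a u \<and>
        sobolev_norm (- s) (u 0) \<le> \<rho>' \<and> (\<forall>t\<in>{0..T}. l2norm (u t) \<le> D)" and "t \<in> {0..T'}"
    then show "l2norm (u t) \<le> (if sobolev_norm (- s) (u 0) = 0 then 0
            else D * exp (- (N / 2) * \<bar>ln (sobolev_norm (- s) (u 0))\<bar> powr \<delta>))"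
      by (intro main) auto
  qed (use \<rho>' assms(4) in auto)
qed

end
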